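(* Let $d\ge1$ and let $\mathbf X=(X_t)_{t\ge0}$ be an isotropic unimodal Lévy process on $\mathbb R^d$ with characteristic exponent $\psi$, transition density $p(t,\cdot)$ and Lévy density $\nu$. Then the following are equivalent: (i) $\psi\in\mathcal R^0_\alpha$ for some $\alpha\in(0,2)$; (ii) there is $c>0$ such that $$\lim_{\substack{|x|\to+\infty\\ t\psi(|x|^{-1})\to0}}\frac{p(t,x)}{|x|^{-d}\,t\,\psi(|x|^{-1})}=c;$$ (iii) there is $c>0$ such that $$\lim_{|x|\to+\infty}\frac{\nu(x)}{|x|^{-d}\,\psi(|x|^{-1})}=c.$$
   Context: An isotropic Lévy process in $\mathbb R^d$ is a Lévy process $\mathbf X=(X_t)_{t\ge0}$ with $X_0=0$ a.s. such that each $X_t$ has a rotationally invariant distribution $p(t,dx)$. Its Lévy–Khintchine (characteristic) exponent $\psi$ is defined by $\int_{\mathbb R^d}e^{i\langle\xi,x\rangle}p(t,dx)=e^{-t\psi(\xi)}$, with $\psi(\xi)=\int_{\mathbb R^d}(1-\cos\langle\xi,x\rangle)\,\nu(dx)+\eta|\xi|^2$, where $\eta\ge0$ and $\nu$ is a rotationally invariant Lévy measure. The function $\psi$ is radial and one writes $\psi(r)=\psi(\xi)$ for $r=|\xi|$. A Borel measure is isotropic unimodal if it is absolutely continuous on $\mathbb R^d\setminus\{0\}$ with a radial, radially non-increasing density. $\mathbf X$ is isotropic unimodal if $p(t,dx)$ is isotropic unimodal for every $t>0$ (equivalently, by a theorem of Watanabe, if its Lévy measure is isotropic unimodal); $p(t,x)$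 and $\nu(x)$ denote the radial, radially non-increasing densities on $\mathbb R^d\setminus\{0\}$ of $p(t,dx)$ and of the Lévy measure. Regular variation: $f:[x_0,+\infty)\to(0,+\infty)$, $x_0>0$, is in $\mathcal R^\infty_\alpha$ (regularly varying of index $\alpha$ at infinity) if $f(\lambda x)/f(x)\to\lambda^\alpha$ as $x\to+\infty$ for each $\lambda>0$. A function $f$, positive near zero, is in $\mathcal R^0_\alpha$ (regularly varying of index $\alpha$ at zero) if $x\mapsto f(x^{-1})^{-1}$ is in $\mathcal R^\infty_\alpha$, i.e. $f(\lambda x)/f(x)\to\lambda^\alpha$ as $x\to0^+$ for each $\lambda>0$. The condition $\psi\in\mathcal R^0_\alpha$ refers to $r\mapsto\psi(r)$. The joint limit in (ii) means: for every $\varepsilon>0$ there is $\delta>0$ such that the quotient is within $\varepsilon$ of the limit for all $t>0$ and all $x$ with $|x|\ge\delta^{-1}$ and $t\psi(|x|^{-1})\le\delta$. *)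

theory Defs
  imports "HOL-Probability.Probability"
begin

section \<open>Isotropic and unimodal measures\<close>

text \<open>Invariance is required under the full orthogonal group, so that in dimension one it means
  symmetry. In higher dimensions invariance under proper rotations would give the same measures.\<close>

definition rotation_invariant :: "'a::euclidean_space measure \<Rightarrow> bool" where
  "rotation_invariant \<mu> \<longleftrightarrow> (\<forall>T. orthogonal_transformation T \<longrightarrow> distr \<mu> borel T = \<mu>)"

text \<open>Nothing is said about \<open>f 0\<close>, nor about the mass of \<open>\<mu>\<close> at the origin, which may be positive
  or infinite.\<close>

definition isotropic_unimodal_density :: "'a::euclidean_space measure \<Rightarrow> ('a \<Rightarrow> real) \<Rightarrow> bool" where
  "isotropic_unimodal_density \<mu> f \<longleftrightarrow>
     f \<in> borel_measurable borel \<and>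
     (\<forall>x. x \<noteq> 0 \<longrightarrow> 0 \<le> f x) \<and>
     (\<forall>x y. x \<noteq> 0 \<and> y \<noteq> 0 \<and> norm x = norm y \<longrightarrow> f x = f y) \<and>
     (\<forall>x y. x \<noteq> 0 \<and> norm x \<le> norm y \<longrightarrow> f y \<le> f x) \<and>
     (\<forall>A\<in>sets borel. 0 \<notin> A \<longrightarrow> emeasure \<mu> A = (\<integral>\<^sup>+x\<in>A. ennreal (f x) \<partial>lborel))"

definition isotropic_unimodal :: "'a::euclidean_space measure \<Rightarrow> bool" where
  "isotropic_unimodal \<mu> \<longleftrightarrow> sets \<mu> = sets borel \<and> (\<exists>f. isotropic_unimodal_density \<mu> f)"


section \<open>Levy processes\<close>

text \<open>Paths are only assumed stochastically continuous. Processes with cadlag paths are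
  covered, since stationary independent increments and right-continuous paths with left limits
  imply stochastic continuity.\<close>

locale levy_process = prob_space M
  for M :: "'w measure" +
  fixes X :: "real \<Rightarrow> 'w \<Rightarrow> 'a::euclidean_space"
  assumes measurable_X: "t \<ge> 0 \<Longrightarrow> X t \<in> borel_measurable M"
    and start_zero: "AE \<omega> in M. X 0 \<omega> = 0"
    and independent_increments:
      "\<lbrakk>s 0 \<ge> 0; \<And>i. i < n \<Longrightarrow> s i \<le> s (Suc i)\<rbrakk> \<Longrightarrow>
         indep_vars (\<lambda>_. borel) (\<lambda>i \<omega>. X (s (Suc i)) \<omega> - X (s i) \<omega>) {..<n::nat}"
    and stationary_increments:
      "\<lbrakk>0 \<le> s'; s' \<le> t\<rbrakk> \<Longrightarrow> distr M borel (\<lambda>\<omega>. X t \<omega> - X s' \<omega>) = distr M borel (X (t - s'))"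
    and stochastically_continuous:
      "\<lbrakk>0 \<le> s'; 0 < e\<rbrakk> \<Longrightarrow>
         ((\<lambda>t. prob {\<omega> \<in> space M. dist (X t \<omega>) (X s' \<omega>) > e}) \<longlongrightarrow> 0) (at s' within {0..})"

locale isotropic_levy_process = levy_process M X
  for M :: "'w measure" and X :: "real \<Rightarrow> 'w \<Rightarrow> 'a::euclidean_space" +
  assumes isotropic: "t \<ge> 0 \<Longrightarrow> rotation_invariant (distr M borel (X t))"

locale isotropic_unimodal_levy_process = isotropic_levy_process M X
  for M :: "'w measure" and X :: "real \<Rightarrow> 'w \<Rightarrow> 'a::euclidean_space" +
  assumes unimodal: "t > 0 \<Longrightarrow> isotropic_unimodal (distr M borel (X t))"

definition levy_measure :: "'a::euclidean_space measure \<Rightarrow> bool" where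
  "levy_measure N \<longleftrightarrow> sets N = sets borel \<and> emeasure N {0} = 0 \<and>
     (\<integral>\<^sup>+x. ennreal (min 1 ((norm x)\<^sup>2)) \<partial>N) < \<infinity>"

text \<open>\<open>\<psi>\<close> is the characteristic exponent of \<open>X\<close>, with Gaussian coefficient \<open>\<eta>\<close> and Levy
  measure \<open>N\<close>. For an isotropic process all three exist and are uniquely determined.\<close>

definition levy_khintchine ::
  "'w measure \<Rightarrow> (real \<Rightarrow> 'w \<Rightarrow> 'a::euclidean_space) \<Rightarrow> ('a \<Rightarrow> real) \<Rightarrow> real \<Rightarrow> 'a measure \<Rightarrow> bool" where
  "levy_khintchine M X \<psi> \<eta> N \<longleftrightarrow>
     0 \<le> \<eta> \<and> levy_measure N \<and> rotation_invariant N \<and>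
     (\<forall>t\<ge>0. \<forall>\<xi>. (CLINT x|distr M borel (X t). exp (\<i> * complex_of_real (\<xi> \<bullet> x)))
                 = complex_of_real (exp (- t * \<psi> \<xi>))) \<and>
     (\<forall>\<xi>. \<psi> \<xi> = (LINT x|N. 1 - cos (\<xi> \<bullet> x)) + \<eta> * (norm \<xi>)\<^sup>2)"


section \<open>Radial profile and regular variation\<close>

text \<open>Intended for radial \<open>f\<close> and \<open>r \<ge> 0\<close>, where the choice of the point of norm \<open>r\<close> is
  irrelevant.\<close>

definition radial_profile :: "('a::euclidean_space \<Rightarrow> real) \<Rightarrow> real \<Rightarrow> real" where
  "radial_profile f r = f (SOME x. norm x = r)"

definition regularly_varying_at_infinity :: "real \<Rightarrow> (real \<Rightarrow> real) \<Rightarrow> bool" where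
  "regularly_varying_at_infinity \<alpha> f \<longleftrightarrow>
     (\<exists>x0>0. \<forall>x\<ge>x0. f x > 0) \<and>
     (\<forall>l>0. ((\<lambda>x. f (l * x) / f x) \<longlongrightarrow> l powr \<alpha>) at_top)"

definition regularly_varying_at_zero :: "real \<Rightarrow> (real \<Rightarrow> real) \<Rightarrow> bool" where
  "regularly_varying_at_zero \<alpha> f \<longleftrightarrow>
     regularly_varying_at_infinity \<alpha> (\<lambda>x. inverse (f (inverse x)))"

end

theory Submission
  imports Defs "HOL-Complex_Analysis.Great_Picard"
begin

text \<open>Write \<open>\<psi>(r)\<close> for the radial profile of the exponent and \<open>\<Lambda>\<close> for the measure \<open>|z|\<^sup>-\<^sup>d dz\<close>, which is
invariant under dilations. The proof goes around the circle (i), (ii), (iii), (i).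

From (i) to (ii). Averaging \<open>cos \<langle>\<xi>, y\<rangle>\<close> over a standard Gaussian \<open>\<xi>\<close> turns exponents into Laplace
transforms in \<open>|y|\<^sup>2\<close>: the integral of \<open>1 - exp(-s|y|\<^sup>2)\<close> against the law of \<open>X\<^sub>t\<close> is the Gaussian mean of
\<open>1 - exp(-t \<psi>(\<surd>(2s) \<xi>))\<close>. Rescale space by \<open>r\<close> and divide by \<open>t \<psi>(1/r)\<close>. When \<open>r\<close> tends to infinity and
\<open>t \<psi>(1/r)\<close> to zero, regular variation makes these means converge to a multiple of \<open>s\<close> to the power
\<open>\<alpha>/2\<close>, which is the transform of a multiple of \<open>|y|\<close> to the power \<open>-d-\<alpha>\<close>
(\<open>scaled_laplace_limit\<close>, \<open>homogeneous_power_laplace\<close>). Convergence of the transforms at the integers is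
convergence of moments in the variable \<open>exp(-|y|\<^sup>2)\<close>, so Weierstrass approximation gives convergence
against test functions supported in annuli. The densities are radially nonincreasing, and therefore
weak convergence forces pointwise convergence (\<open>eventually_density_greater\<close>,
\<open>eventually_density_less\<close>).

From (ii) to (iii). The same Tauberian argument at a fixed scale, with \<open>t\<close> tending to zero, shows that
\<open>p(t,x)/t\<close> tends to \<open>\<nu>(x)\<close> wherever \<open>\<nu>\<close> is continuous; the bounds in (ii) then pass to \<open>\<nu>\<close>.

From (iii) to (i). This is a Mercerian statement. Inserting \<open>\<nu>(x) \<sim> c |x|\<^sup>-\<^sup>d \<psi>(1/|x|)\<close> into the
Levy-Khintchine formula shows that every limit \<open>G(s)\<close> of \<open>\<psi>(r e\<^sup>s)/\<psi>(r)\<close> along some \<open>r \<rightarrow> 0\<close> solves the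
convolution equation \<open>G(s) = \<integral> G(s+v) \<kappa>(dv)\<close>, where \<open>\<kappa>\<close> is the image of \<open>c(1 - cos \<langle>e, z\<rangle>) \<Lambda>(dz)\<close> under
\<open>z \<mapsto> -ln |z|\<close> (\<open>limit_equation\<close>). Solutions form a compact class. A maximum principle shows that linear
functionals attain their extrema over it at exponentials \<open>e\<^sup>\<rho>\<^sup>s\<close>, and by strict convexity
there are at most two of these, with ratios \<open>q\<^sub>1 \<le> q\<^sub>2\<close>. Hence every solution satisfies
\<open>G(2) - (q\<^sub>1+q\<^sub>2) G(1) + q\<^sub>1 q\<^sub>2 = 0\<close>, the successive ratios of \<open>\<psi>\<close> asymptotically obey a Moebius recursion
with fixed points \<open>q\<^sub>1\<close> and \<open>q\<^sub>2\<close>, and they converge to one of them. A solution with extremal ratio is an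
exponential, and so \<open>\<psi>\<close> varies regularly (\<open>asymptotic_solution_tendsto_exponential\<close>).

Two properties of \<open>\<psi>\<close> provide the compactness. Unimodality gives \<open>\<psi>(l\<xi>) \<le> 8(1+l)\<^sup>2 \<psi>(\<xi>)\<close>, by shifting a
half-space by half a period of the cosine (\<open>half_space_mass_le\<close>, \<open>exponent_scaleR_le\<close>). Under (iii) the
powers 0 and 2 are moreover excluded with room to spare, because \<open>min(2, \<langle>e,z\<rangle>\<^sup>2/2)\<close> has infinite
\<open>\<Lambda>\<close>-integral at infinity and, after division by \<open>|z|\<^sup>2\<close>, also at the origin
(\<open>profile_ratio_decay\<close>, \<open>profile_power_bounds\<close>). The same bounds place the index in the open interval
from 0 to 2.\<close>

section \<open>Sequences and subsequences\<close>

lemma LIMSEQ_subsequence_principle: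
  fixes x :: "nat \<Rightarrow> 'a::metric_space"
  assumes "\<And>r::nat\<Rightarrow>nat. strict_mono r \<Longrightarrow> \<exists>r'::nat\<Rightarrow>nat. strict_mono r' \<and> (\<lambda>n. x (r (r' n))) \<longlonglongrightarrow> L"
  shows "x \<longlonglongrightarrow> L"
proof (rule ccontr)
  assume "\<not> x \<longlonglongrightarrow> L"
  then obtain e where e: "e > 0" "\<not> eventually (\<lambda>n. dist (x n) L < e) sequentially"
    by (auto simp: tendsto_iff)
  then obtain r :: "nat \<Rightarrow> nat" where r: "strict_mono r" "\<And>n. \<not> dist (x (r n)) L < e"
    using not_eventually_sequentiallyD by blast
  obtain r' where r': "strict_mono r'" "(\<lambda>n. x (r (r' n))) \<longlonglongrightarrow> L"
    using assms[OF r(1)] by blast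
  then show False
    using e(1) r(2) by (auto simp: tendsto_iff eventually_sequentially)
qed

text \<open>A diagonal argument over the rationals, extended to all reals by equicontinuity. Both hypotheses hold
only eventually, with a threshold depending on the point, because rescaled functions satisfy uniform
bounds only once the scale is small.\<close>

lemma pointwise_convergent_subsequence:
  fixes g :: "nat \<Rightarrow> real \<Rightarrow> real"
  assumes bounded: "\<And>s. eventually (\<lambda>n. \<bar>g n s\<bar> \<le> C s) sequentially"
    and equicont: "\<And>s e. e > 0 \<Longrightarrow> \<exists>d>0. \<forall>u. \<bar>u\<bar> < d \<longrightarrow> eventually (\<lambda>n. \<bar>g n (s + u) - g n s\<bar> \<le> e) sequentially"
  obtains r G where "strict_mono (r::nat\<Rightarrow>nat)" "\<And>s. (\<lambda>n. g (r n) s) \<longlonglongrightarrow> G s"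
proof -
  \<comment> \<open>Rescaled to have the uniform bound 1, and set to 0 at the finitely many indices where the bound fails.\<close>
  define h where "h n s = (if \<bar>g n s\<bar> \<le> C s then g n s / (1 + \<bar>C s\<bar>) else 0)" for n s
  have hb: "norm (h n s) \<le> 1" for n s
    by (auto simp: h_def divide_simps)
  obtain r where r: "strict_mono (r::nat\<Rightarrow>nat)" and conv: "\<And>x. x \<in> \<rat> \<Longrightarrow> \<exists>l. (\<lambda>n. h (r n) x) \<longlonglongrightarrow> l"
    using function_convergent_subsequence[OF countable_rat, of h 1] hb by metis
  have convg: "convergent (\<lambda>n. g (r n) x)" if x: "x \<in> \<rat>" for x
  proof -
    obtain l where l: "(\<lambda>n. h (r n) x) \<longlonglongrightarrow> l" using conv[OF x] by blast
    have "(\<lambda>n. h (r n) x * (1 + \<bar>C x\<bar>)) \<longlonglongrightarrow> l * (1 + \<bar>C x\<bar>)"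
      by (intro tendsto_intros l)
    moreover have "eventually (\<lambda>n. h (r n) x * (1 + \<bar>C x\<bar>) = g (r n) x) sequentially"
      using eventually_subseq[OF r bounded[of x]]
      by eventually_elim (auto simp: h_def)
    ultimately have "(\<lambda>n. g (r n) x) \<longlonglongrightarrow> l * (1 + \<bar>C x\<bar>)"
      by (rule Lim_transform_eventually)
    then show ?thesis by (auto simp: convergent_def)
  qed
  have "convergent (\<lambda>n. g (r n) s)" for s
  proof -
    have "Cauchy (\<lambda>n. g (r n) s)"
    proof (rule metric_CauchyI)
      fix e :: real assume e: "e > 0"
      obtain d where d: "d > 0" "\<forall>u. \<bar>u\<bar> < d \<longrightarrow> eventually (\<lambda>n. \<bar>g n (s + u) - g n s\<bar> \<le> e/4) sequentially"
        using equicont[of "e/4" s] e by auto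
      obtain x where x: "x \<in> \<rat>" "s < x" "x < s + d"
        using Rats_dense_in_real[of s "s + d"] d by auto
      have "eventually (\<lambda>n. \<bar>g n x - g n s\<bar> \<le> e/4) sequentially"
        using d(2)[rule_format, of "x - s"] x by auto
      then have "eventually (\<lambda>n. \<bar>g (r n) x - g (r n) s\<bar> \<le> e/4) sequentially"
        by (rule eventually_subseq[OF r])
      then obtain N1 where N1: "\<And>n. n \<ge> N1 \<Longrightarrow> \<bar>g (r n) x - g (r n) s\<bar> \<le> e/4"
        by (auto simp: eventually_sequentially)
      obtain N2 where N2: "\<And>m n. m \<ge> N2 \<Longrightarrow> n \<ge> N2 \<Longrightarrow> dist (g (r m) x) (g (r n) x) < e/4"
        using convergent_Cauchy[OF convg[OF x(1)]] e by (meson metric_CauchyD divide_pos_pos zero_less_numeral)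
      show "\<exists>M. \<forall>m\<ge>M. \<forall>n\<ge>M. dist (g (r m) s) (g (r n) s) < e"
      proof (intro exI[of _ "max N1 N2"] allI impI)
        fix m n assume mn: "max N1 N2 \<le> m" "max N1 N2 \<le> n"
        show "dist (g (r m) s) (g (r n) s) < e"
          using N1[of m] N1[of n] N2[of m n] mn e unfolding dist_real_def abs_less_iff abs_le_iff
          by (simp; linarith)
      qed
    qed
    then show ?thesis by (simp add: Cauchy_convergent_iff)
  qed
  then have "\<forall>s. \<exists>l. (\<lambda>n. g (r n) s) \<longlonglongrightarrow> l" by (auto simp: convergent_def)
  then obtain G where "\<And>s. (\<lambda>n. g (r n) s) \<longlonglongrightarrow> G s" by metis
  with r that show ?thesis by blast
qed

text \<open>Below the level \<open>\<epsilon>/2\<close> the errors are absorbed by the gap \<open>1 - \<theta>\<close>, and the excess over that level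
shrinks geometrically.\<close>

lemma contraction_with_vanishing_error:
  fixes a e :: "nat \<Rightarrow> real"
  assumes nn: "\<And>n. 0 \<le> a n" and th: "0 \<le> \<theta>" "\<theta> < 1"
    and step: "eventually (\<lambda>n. a (Suc n) \<le> \<theta> * a n + e n) sequentially" and e: "e \<longlonglongrightarrow> 0"
  shows "a \<longlonglongrightarrow> 0"
proof (rule tendstoI)
  fix \<epsilon> :: real assume eps: "\<epsilon> > 0"
  have "eventually (\<lambda>n. e n < (1 - \<theta>) * (\<epsilon> / 2)) sequentially"
    using e eps th by (intro order_tendstoD(2)) auto
  then have "eventually (\<lambda>n. e n < (1 - \<theta>) * (\<epsilon> / 2) \<and> a (Suc n) \<le> \<theta> * a n + e n) sequentially"
    using step by eventually_elim auto
  then obtain N where N: "\<And>n. n \<ge> N \<Longrightarrow> e n < (1 - \<theta>) * (\<epsilon> / 2) \<and> a (Suc n) \<le> \<theta> * a n + e n"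
    by (auto simp: eventually_sequentially)
  have bnd: "a (N + k) \<le> \<theta> ^ k * a N + \<epsilon> / 2" for k
  proof (induction k)
    case 0 then show ?case using eps by simp
  next
    case (Suc k)
    have "a (N + Suc k) \<le> \<theta> * a (N + k) + (1 - \<theta>) * (\<epsilon> / 2)"
      using N[of "N + k"] by simp
    also have "\<dots> \<le> \<theta> * (\<theta> ^ k * a N + \<epsilon> / 2) + (1 - \<theta>) * (\<epsilon> / 2)"
      using Suc th by (intro add_right_mono mult_left_mono) auto
    also have "\<dots> = \<theta> ^ Suc k * a N + \<epsilon> / 2" by (simp add: field_simps)
    finally show ?case .
  qed
  have "(\<lambda>k. \<theta> ^ k * a N) \<longlonglongrightarrow> 0 * a N"
    by (intro tendsto_intros) (use th in auto)
  then have "eventually (\<lambda>k. \<theta> ^ k * a N < \<epsilon> / 2) sequentially"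
    using eps by (intro order_tendstoD(2)[of _ 0]) auto
  then have "eventually (\<lambda>k. dist (a (k + N)) 0 < \<epsilon>) sequentially"
  proof eventually_elim
    case (elim k)
    then show ?case using bnd[of k] nn[of "N+k"] by (simp add: add.commute)
  qed
  then show "eventually (\<lambda>k. dist (a k) 0 < \<epsilon>) sequentially"
    by (subst (asm) eventually_sequentially_seg)
qed

text \<open>Up to a vanishing error the recursion is \<open>x\<^sub>n\<^sub>+\<^sub>1 = q\<^sub>1q\<^sub>2 / (q\<^sub>1 + q\<^sub>2 - x\<^sub>n)\<close>, whose fixed points are \<open>q\<^sub>1\<close>
(attracting) and \<open>q\<^sub>2\<close> (repelling). If the sequence does not converge to \<open>q\<^sub>2\<close>, then it falls below some
\<open>b < q\<^sub>2\<close> at a late time. From then on it is trapped below \<open>b\<close>, where the recursion contracts towards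
\<open>q\<^sub>1\<close>.\<close>

lemma asymptotic_Moebius_recursion:
  fixes x :: "nat \<Rightarrow> real"
  assumes q: "0 < q1" "q1 \<le> q2"
    and up: "\<And>b. b > q2 \<Longrightarrow> eventually (\<lambda>n. x n < b) sequentially"
    and lo: "\<And>b. b < q1 \<Longrightarrow> eventually (\<lambda>n. x n > b) sequentially"
    and rel: "(\<lambda>n. x n * x (Suc n) - (q1 + q2) * x (Suc n) + q1 * q2) \<longlonglongrightarrow> 0"
  shows "x \<longlonglongrightarrow> q1 \<or> x \<longlonglongrightarrow> q2"
proof (cases "\<forall>b<q2. eventually (\<lambda>n. x n > b) sequentially")
  case True
  then show ?thesis using up by (auto intro: order_tendstoI)
next
  case False
  then obtain b0 where b0: "b0 < q2" "frequently (\<lambda>n. x n \<le> b0) sequentially"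
    by (auto simp: frequently_def not_le)
  have q12: "q1 < q2"
  proof (rule ccontr)
    assume "\<not> q1 < q2"
    then have "q1 = q2" using q by simp
    then show False using lo[of b0] b0 by (auto simp: frequently_def not_le)
  qed
  define b where "b = max b0 ((q1 + q2) / 2)"
  have b: "q1 < b" "b < q2" using b0(1) q12 by (auto simp: b_def less_max_iff_disj)
  have fr: "frequently (\<lambda>n. x n \<le> b) sequentially"
    using b0(2) by (rule frequently_elim1) (auto simp: b_def)
  define e where "e n = x n * x (Suc n) - (q1 + q2) * x (Suc n) + q1 * q2" for n
  have eid: "x (Suc n) * (q1 + q2 - x n) = q1 * q2 - e n" for n by (simp add: e_def algebra_simps)
  \<comment> \<open>With error below this amount the image of \<open>b\<close> under the recursion is at most \<open>b\<close>.\<close>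
  define gap where "gap = (b - q1) * (q2 - b)"
  have gap: "gap > 0" using b by (simp add: gap_def)
  have "eventually (\<lambda>n. \<bar>e n\<bar> < gap) sequentially"
    using rel gap unfolding e_def[symmetric] tendsto_iff dist_real_def by simp
  then obtain N where N: "\<And>n. n \<ge> N \<Longrightarrow> \<bar>e n\<bar> < gap" by (auto simp: eventually_sequentially)
  obtain M where M: "M \<ge> N" "x M \<le> b"
    using fr by (auto simp: frequently_sequentially)
  have inv: "x (M + k) \<le> b" for k
  proof (induction k)
    case 0 then show ?case using M by simp
  next
    case (Suc k)
    let ?n = "M + k"
    have d: "q1 + q2 - x ?n \<ge> q1 + q2 - b" using Suc by simp
    have pos: "q1 + q2 - b > 0" using b q by linarith
    have "x (Suc ?n) * (q1 + q2 - x ?n) \<le> q1 * q2 + gap"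
      using eid[of ?n] N[of ?n] M by (simp add: abs_if split: if_splits)
    also have "\<dots> = b * (q1 + q2 - b)" by (simp add: gap_def algebra_simps)
    also have "\<dots> \<le> b * (q1 + q2 - x ?n)"
      using d b q by (intro mult_left_mono) auto
    finally show ?case using d pos by simp
  qed
  define \<theta> where "\<theta> = q1 / (q1 + q2 - b)"
  have pos: "q1 + q2 - b > q1" using b by simp
  have th: "0 \<le> \<theta>" "\<theta> < 1" using pos q by (auto simp: \<theta>_def)
  have "(\<lambda>n. \<bar>x n - q1\<bar>) \<longlonglongrightarrow> 0"
  proof (rule contraction_with_vanishing_error[OF _ th])
    show "eventually (\<lambda>n. \<bar>x (Suc n) - q1\<bar> \<le> \<theta> * \<bar>x n - q1\<bar> + \<bar>e n\<bar> / (q1 + q2 - b)) sequentially"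
      unfolding eventually_sequentially
    proof (intro exI[of _ M] allI impI)
      fix n assume "n \<ge> M"
      then have xn: "x n \<le> b" using inv[of "n - M"] by simp
      have p: "q1 + q2 - x n \<ge> q1 + q2 - b" "q1 + q2 - b > 0" using xn pos q by auto
      have "(x (Suc n) - q1) * (q1 + q2 - x n) = q1 * (x n - q1) - e n"
        using eid[of n] by (simp add: algebra_simps)
      then have "\<bar>x (Suc n) - q1\<bar> * (q1 + q2 - x n) = \<bar>q1 * (x n - q1) - e n\<bar>"
        using p by (metis abs_mult abs_of_pos less_le_trans)
      also have "\<dots> \<le> q1 * \<bar>x n - q1\<bar> + \<bar>e n\<bar>"
        using q by (metis abs_mult abs_of_pos abs_triangle_ineq4)
      finally have "\<bar>x (Suc n) - q1\<bar> * (q1 + q2 - b) \<le> q1 * \<bar>x n - q1\<bar> + \<bar>e n\<bar>"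
        using p by (meson abs_ge_zero mult_left_mono order_trans)
      then have "\<bar>x (Suc n) - q1\<bar> \<le> (q1 * \<bar>x n - q1\<bar> + \<bar>e n\<bar>) / (q1 + q2 - b)"
        using p by (simp add: pos_le_divide_eq)
      then show "\<bar>x (Suc n) - q1\<bar> \<le> \<theta> * \<bar>x n - q1\<bar> + \<bar>e n\<bar> / (q1 + q2 - b)"
        by (simp add: \<theta>_def add_divide_distrib)
    qed
    have "(\<lambda>n. \<bar>e n\<bar> / (q1 + q2 - b)) \<longlonglongrightarrow> \<bar>0\<bar> / (q1 + q2 - b)"
      using rel unfolding e_def[symmetric] by (intro tendsto_intros) (use pos q in auto)
    then show "(\<lambda>n. \<bar>e n\<bar> / (q1 + q2 - b)) \<longlonglongrightarrow> 0" by simp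
  qed auto
  then have "x \<longlonglongrightarrow> q1" by (simp add: tendsto_rabs_zero_iff LIM_zero_iff)
  then show ?thesis ..
qed

section \<open>Positive solutions of convolution equations\<close>

text \<open>The equation \<open>G(s) = \<integral> G(s + v) \<kappa>(dv)\<close> on the real line. The functions \<open>B\<close> and \<open>\<omega>\<close> control growth and
oscillation. Together they make the class of solutions compact: \<open>\<omega>\<close> gives equicontinuity, and
integrability of \<open>B\<close> lets the equation pass to limits.\<close>

locale convolution_equation =
  fixes \<kappa> :: "real measure" and B \<omega> :: "real \<Rightarrow> real"
  assumes sets_kernel: "sets \<kappa> = sets borel"
    and full_support: "a < b \<Longrightarrow> emeasure \<kappa> {a<..<b} \<noteq> 0"
    and integrable_B: "integrable \<kappa> B"
    and modulus: "(\<omega> \<longlongrightarrow> 0) (at 0)"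
begin

lemma measurable_kernel [measurable_cong]: "sets \<kappa> = sets borel" by (rule sets_kernel)

text \<open>Apart from the normalisation at 0 every condition is homogeneous in \<open>G\<close> and invariant under
translations, so that the class is stable under \<open>G \<mapsto> G(\<sqdot> + u)/G(u)\<close>.\<close>

definition solution :: "(real \<Rightarrow> real) \<Rightarrow> bool" where
  "solution G \<longleftrightarrow> G 0 = 1 \<and> (\<forall>s. 0 \<le> G s) \<and> (\<forall>s u. G (s + u) \<le> B u * G s) \<and>
     (\<forall>s u. \<bar>G (s + u) - G s\<bar> \<le> \<omega> u * G s) \<and> (\<forall>s. G s = (\<integral>v. G (s + v) \<partial>\<kappa>))"

lemma solutionD:
  assumes "solution G"
  shows "G 0 = 1" "0 \<le> G s" "G (s + u) \<le> B u * G s" "\<bar>G (s + u) - G s\<bar> \<le> \<omega> u * G s"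
    "(\<integral>v. G (s + v) \<partial>\<kappa>) = G s"
  using assms unfolding solution_def by (blast, blast, blast, blast, metis)

text \<open>Harnack inequality: the growth bound, applied from \<open>s\<close> back to 0, bounds \<open>G(s)\<close> from below.\<close>

lemma solution_pos: assumes "solution G" shows "G s > 0"
proof -
  have "G (s + (-s)) \<le> B (-s) * G s" "G 0 = 1" "0 \<le> G s" using assms unfolding solution_def by blast+
  then show ?thesis by (cases "G s = 0") auto
qed

lemma solution_continuous: assumes "solution G" shows "isCont G s"
proof -
  have "((\<lambda>u. G (s + u)) \<longlongrightarrow> G s) (at 0)"
  proof (rule Lim_null_comparison[THEN LIM_zero_cancel])
    show "eventually (\<lambda>u. norm (G (s + u) - G s) \<le> \<omega> u * G s) (at 0)"
      using solutionD(4)[OF assms] by simp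
    show "((\<lambda>u. \<omega> u * G s) \<longlongrightarrow> 0) (at 0)"
      using tendsto_mult_right[OF modulus, of "G s"] by (simp add: mult.commute)
  qed
  then show ?thesis by (simp add: isCont_iff)
qed

lemma solution_measurable: "solution G \<Longrightarrow> G \<in> borel_measurable borel"
  by (intro borel_measurable_continuous_onI continuous_at_imp_continuous_on) (auto intro: solution_continuous)

lemma solution_integrable: assumes "solution G" shows "integrable \<kappa> (\<lambda>v. G (s + v))"
proof (rule Bochner_Integration.integrable_bound)
  show "integrable \<kappa> (\<lambda>v. B v * G s)" using integrable_B by simp
  show "(\<lambda>v. G (s + v)) \<in> borel_measurable \<kappa>" 
    by (rule measurable_compose[OF _ solution_measurable[OF assms]]) measurable
  show "AE v in \<kappa>. norm (G (s + v)) \<le> norm (B v * G s)"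
  proof (rule AE_I2)
    fix v
    have "0 \<le> G (s + v)" "G (s + v) \<le> B v * G s" using assms unfolding solution_def by blast+
    then show "norm (G (s + v)) \<le> norm (B v * G s)" by simp
  qed
qed

lemma solution_shift: assumes "solution G" shows "solution (\<lambda>s. G (s + u) / G u)"
proof -
  have p: "G u > 0" by (rule solution_pos[OF assms])
  have eq: "G (s + u) = (\<integral>v. G (s + v + u) \<partial>\<kappa>)" for s
  proof -
    have *: "s + u + v = s + v + u" for v by simp
    show ?thesis using assms unfolding solution_def *[symmetric] by blast
  qed
  have B: "G (s + v + u) \<le> B v * G (s + u)" and w: "\<bar>G (s + v + u) - G (s + u)\<bar> \<le> \<omega> v * G (s + u)"
    and nn: "0 \<le> G s" for s v
  proof -
    have *: "s + u + v = s + v + u" for v by simp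
    show "G (s + v + u) \<le> B v * G (s + u)" "\<bar>G (s + v + u) - G (s + u)\<bar> \<le> \<omega> v * G (s + u)" "0 \<le> G s"
      using assms unfolding solution_def *[symmetric] by blast+
  qed
  show ?thesis unfolding solution_def
  proof (intro conjI allI)
    show "\<bar>G (s + ua + u) / G u - G (s + u) / G u\<bar> \<le> \<omega> ua * (G (s + u) / G u)" for s ua
      using w[of s ua] p by (simp add: diff_divide_distrib[symmetric] divide_right_mono)
    show "G (s + ua + u) / G u \<le> B ua * (G (s + u) / G u)" for s ua
      using B[of s ua] p by (simp add: divide_right_mono)
    show "G (s + u) / G u = (\<integral>v. G (s + v + u) / G u \<partial>\<kappa>)" for s
      using eq[of s] by (simp only: integral_divide_zero)
  qed (use p nn in auto)
qed

text \<open>Dominated convergence, with the integrable majorant \<open>B\<close> times a bound for the numbers \<open>F\<^sub>n(s)\<close>.\<close>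

lemma solution_limit:
  assumes F: "\<And>n. solution (F n)" and lim: "\<And>s. (\<lambda>n. F n s) \<longlonglongrightarrow> G s"
  shows "solution G"
  unfolding solution_def
proof (intro conjI allI)
  show "G 0 = 1" using lim[of 0] by (simp add: solutionD(1)[OF F] LIMSEQ_const_iff)
  show "0 \<le> G s" for s
    by (intro LIMSEQ_le_const[OF lim]) (simp add: solutionD[OF F])
  show "G (s + u) \<le> B u * G s" for s u
    by (rule LIMSEQ_le[OF lim tendsto_mult_left[OF lim]]) (simp add: solutionD[OF F])
  show "\<bar>G (s + u) - G s\<bar> \<le> \<omega> u * G s" for s u
    by (rule LIMSEQ_le[OF tendsto_rabs[OF tendsto_diff[OF lim lim]] tendsto_mult_left[OF lim]])
       (simp add: solutionD[OF F])
  have mG: "G \<in> borel_measurable borel"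
    by (rule borel_measurable_LIMSEQ_metric[OF _ lim]) (rule solution_measurable[OF F])
  show "G s = (\<integral>v. G (s + v) \<partial>\<kappa>)" for s
  proof -
    have "convergent (\<lambda>n. F n s)" using lim by (auto simp: convergent_def)
    then obtain K where K: "\<And>n. \<bar>F n s\<bar> \<le> K"
      using convergent_imp_Bseq BseqE by (metis real_norm_def)
    have "(\<lambda>n. \<integral>v. F n (s + v) \<partial>\<kappa>) \<longlonglongrightarrow> (\<integral>v. G (s + v) \<partial>\<kappa>)"
    proof (rule integral_dominated_convergence)
      show "integrable \<kappa> (\<lambda>v. norm (B v) * K)" using integrable_B by simp
      show "AE v in \<kappa>. norm (F n (s + v)) \<le> norm (B v) * K" for n
      proof (rule AE_I2)
        fix v
        have a: "0 \<le> F n (s + v)" "F n (s + v) \<le> B v * F n s" by (simp_all add: solutionD[OF F])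
        have "B v * F n s \<le> norm (B v) * \<bar>F n s\<bar>" by (metis abs_ge_self abs_mult real_norm_def)
        also have "\<dots> \<le> norm (B v) * K" using K[of n] by (intro mult_left_mono) auto
        finally show "norm (F n (s + v)) \<le> norm (B v) * K" using a by simp
      qed
    qed (use mG lim solution_measurable[OF F] in \<open>auto\<close>)
    moreover have "(\<integral>v. F n (s + v) \<partial>\<kappa>) = F n s" for n by (rule solutionD[OF F])
    ultimately show ?thesis using lim[of s] LIMSEQ_unique by simp
  qed
qed

lemma modulus_small: assumes "e > 0" shows "\<exists>d>0. \<forall>u. \<bar>u\<bar> < d \<and> u \<noteq> 0 \<longrightarrow> \<bar>\<omega> u\<bar> < e"
proof -
  obtain d where "d > 0" "\<forall>u. u \<noteq> 0 \<and> dist u 0 < d \<longrightarrow> dist (\<omega> u) 0 < e"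
    using modulus assms unfolding LIM_def by blast
  then show ?thesis by (intro exI[of _ d]) auto
qed

lemma solution_compact:
  assumes F: "\<And>n. solution (F n)"
  obtains r G where "strict_mono (r::nat\<Rightarrow>nat)" "solution G" "\<And>s. (\<lambda>n. F (r n) s) \<longlonglongrightarrow> G s"
proof -
  have b: "\<bar>F n s\<bar> \<le> B s" for n :: nat and s
  proof -
    have "0 \<le> F n s" "F n (0 + s) \<le> B s * F n 0" "F n 0 = 1" using F[of n] unfolding solution_def by blast+
    then show ?thesis by simp
  qed
  have eq: "\<exists>d>0. \<forall>u. \<bar>u\<bar> < d \<longrightarrow> eventually (\<lambda>n. \<bar>F n (s + u) - F n s\<bar> \<le> e) sequentially"
    if e: "e > 0" for s e
  proof -
    have "1 + \<bar>B s\<bar> > 0" by (rule add_pos_nonneg) auto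
    then have "e / (1 + \<bar>B s\<bar>) > 0" using e by (rule divide_pos_pos[rotated])
    from modulus_small[OF this] obtain d
      where d: "d > 0" "\<forall>u. \<bar>u\<bar> < d \<and> u \<noteq> 0 \<longrightarrow> \<bar>\<omega> u\<bar> < e / (1 + \<bar>B s\<bar>)"
      by (elim exE conjE)
    have "\<bar>F n (s + u) - F n s\<bar> \<le> e" if u: "\<bar>u\<bar> < d" for u n
    proof (cases "u = 0")
      case False
      have "\<bar>F n (s + u) - F n s\<bar> \<le> \<omega> u * F n s" by (rule solutionD[OF F])
      also have "\<dots> \<le> \<bar>\<omega> u\<bar> * \<bar>F n s\<bar>" by (metis abs_ge_self abs_mult)
      also have "\<dots> \<le> (e / (1 + \<bar>B s\<bar>)) * (1 + \<bar>B s\<bar>)"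
      proof (rule mult_mono)
        show "\<bar>\<omega> u\<bar> \<le> e / (1 + \<bar>B s\<bar>)" using d(2) u False by (simp add: less_imp_le)
        show "\<bar>F n s\<bar> \<le> 1 + \<bar>B s\<bar>" using b[of n s] by linarith
      qed (use e in auto)
      also have "\<dots> = e" using \<open>1 + \<bar>B s\<bar> > 0\<close> by simp
      finally show ?thesis .
    qed (use e in simp)
    then have "\<forall>u. \<bar>u\<bar> < d \<longrightarrow> eventually (\<lambda>n. \<bar>F n (s + u) - F n s\<bar> \<le> e) sequentially"
      by simp
    with d(1) show ?thesis by blast
  qed
  have ev: "eventually (\<lambda>n. \<bar>F n s\<bar> \<le> B s) sequentially" for s using b by simp
  obtain r G where r: "strict_mono (r::nat\<Rightarrow>nat)" "\<And>s. (\<lambda>n. F (r n) s) \<longlonglongrightarrow> G s"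
    using pointwise_convergent_subsequence[of F B, OF ev eq] by metis
  show ?thesis
    by (rule that[OF r(1) solution_limit[OF F r(2)] r(2)])
qed

lemma nonneg_zero_integral_imp_zero:
  fixes D :: "real \<Rightarrow> real"
  assumes cont: "\<And>s. isCont D s" and nn: "\<And>s. 0 \<le> D s" and int: "integrable \<kappa> D" and z: "(\<integral>v. D v \<partial>\<kappa>) = 0"
  shows "D s = 0"
proof (rule ccontr)
  assume "D s \<noteq> 0"
  then have Ds: "D s > 0" using nn[of s] by simp
  have "(D \<longlongrightarrow> D s) (at s)" using cont[of s] by (simp add: isCont_def)
  then have "eventually (\<lambda>x. D x > 0) (at s)"
    by (rule order_tendstoD(1)[OF _ Ds])
  then obtain d where d: "d > 0" "\<forall>x. x \<noteq> s \<and> dist x s < d \<longrightarrow> D x > 0"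
    unfolding eventually_at by blast
  have "AE v in \<kappa>. D v = 0"
    using integral_nonneg_eq_0_iff_AE[OF int] nn z by auto
  then have "AE v in \<kappa>. v \<notin> {s<..<s+d}"
  proof eventually_elim
    case (elim v)
    then show ?case using d(2)[rule_format, of v] by (auto simp: dist_real_def)
  qed
  then have "emeasure \<kappa> {s<..<s+d} = 0"
    by (subst (asm) AE_iff_measurable[where N = "{s<..<s+d}"])
       (auto simp: sets_eq_imp_space_eq[OF sets_kernel])
  then show False using full_support[of s "s+d"] d by simp
qed

text \<open>These sets play the role of the closed faces in Choquet theory: they are stable under normalised
translations and pointwise limits.\<close>

definition invariant_closed :: "(real \<Rightarrow> real) set \<Rightarrow> bool" where
  "invariant_closed T \<longleftrightarrow> T \<noteq> {} \<and> T \<subseteq> Collect solution \<and>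
     (\<forall>G\<in>T. \<forall>u. (\<lambda>s. G (s + u) / G u) \<in> T) \<and>
     (\<forall>F G. (\<forall>n::nat. F n \<in> T) \<and> (\<forall>s. (\<lambda>n. F n s) \<longlonglongrightarrow> G s) \<longrightarrow> G \<in> T)"

lemma invariant_closed_solutions: "solution G \<Longrightarrow> invariant_closed (Collect solution)"
  unfolding invariant_closed_def by (auto intro: solution_shift solution_limit)

text \<open>A maximum principle. Let \<open>m\<close> be the maximum of \<open>\<alpha> G(a) + \<beta> G(b)\<close> over \<open>T\<close>, which is attained by
compactness. Applied to the normalised translates of \<open>G\<close>, maximality says that
\<open>D(s) = m G(s) - \<alpha> G(s+a) - \<beta> G(s+b)\<close> is nonnegative. It solves the convolution equation as well, and it
vanishes at 0 if \<open>G\<close> is a maximiser; having full support, the kernel then forces \<open>D\<close> to vanish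
everywhere.\<close>

lemma maximal_face:
  fixes \<alpha> \<beta> a b :: real
  assumes T: "invariant_closed T"
  shows "\<exists>m. (\<forall>G\<in>T. \<alpha> * G a + \<beta> * G b \<le> m) \<and>
    invariant_closed {G \<in> T. \<forall>s. \<alpha> * G (s + a) + \<beta> * G (s + b) = m * G s} \<and>
    (\<forall>G\<in>T. \<alpha> * G a + \<beta> * G b = m \<longrightarrow> (\<forall>s. \<alpha> * G (s + a) + \<beta> * G (s + b) = m * G s))"
proof -
  have sol: "solution G" if "G \<in> T" for G using T that by (auto simp: invariant_closed_def)
  have sh: "(\<lambda>s. G (s + u) / G u) \<in> T" if "G \<in> T" for G u using T that by (auto simp: invariant_closed_def)
  have cl: "G \<in> T" if "\<And>n::nat. F n \<in> T" "\<And>s. (\<lambda>n. F n s) \<longlonglongrightarrow> G s" for F G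
    using T that unfolding invariant_closed_def by blast
  let ?l = "\<lambda>G::real\<Rightarrow>real. \<alpha> * G a + \<beta> * G b"
  define m where "m = Sup (?l ` T)"
  have bd: "\<bar>G s\<bar> \<le> B s" if "G \<in> T" for G s
  proof -
    have "0 \<le> G s" "G (0 + s) \<le> B s * G 0" "G 0 = 1" using sol[OF that] unfolding solution_def by blast+
    then show ?thesis by simp
  qed
  have bdd: "bdd_above (?l ` T)"
  proof (rule bdd_aboveI2)
    fix G assume G: "G \<in> T"
    have *: "x * G y \<le> \<bar>x\<bar> * B y" for x y :: real
    proof -
      have "x * G y \<le> \<bar>x\<bar> * \<bar>G y\<bar>" by (metis abs_ge_self abs_mult)
      also have "\<dots> \<le> \<bar>x\<bar> * B y" by (rule mult_left_mono[OF bd[OF G]]) simp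
      finally show ?thesis .
    qed
    show "?l G \<le> \<bar>\<alpha>\<bar> * B a + \<bar>\<beta>\<bar> * B b" using *[of \<alpha> a] *[of \<beta> b] by simp
  qed
  have ne: "T \<noteq> {}" using T by (auto simp: invariant_closed_def)
  have le: "?l G \<le> m" if "G \<in> T" for G
    unfolding m_def using that bdd by (intro cSUP_upper)
  have max_imp: "\<forall>s. \<alpha> * G (s + a) + \<beta> * G (s + b) = m * G s" if G: "G \<in> T" and eq: "?l G = m" for G
  proof -
    define D where "D s = m * G s - (\<alpha> * G (s + a) + \<beta> * G (s + b))" for s
    have Gs: "solution G" by (rule sol[OF G])
    have nn: "D s \<ge> 0" for s
    proof -
      have p: "G s > 0" by (rule solution_pos[OF Gs])
      have "\<alpha> * (G (a + s) / G s) + \<beta> * (G (b + s) / G s) \<le> m" using le[OF sh[OF G, of s]] by simp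
      then have "(\<alpha> * G (a + s) + \<beta> * G (b + s)) / G s \<le> m" by (simp add: add_divide_distrib)
      then have "\<alpha> * G (a + s) + \<beta> * G (b + s) \<le> m * G s" using p by (simp add: pos_divide_le_eq)
      then show ?thesis by (simp add: D_def add.commute)
    qed
    have i: "integrable \<kappa> (\<lambda>v. G v)" "integrable \<kappa> (\<lambda>v. G (v + a))" "integrable \<kappa> (\<lambda>v. G (v + b))"
      using solution_integrable[OF Gs, of 0] solution_integrable[OF Gs, of a] solution_integrable[OF Gs, of b]
      by (simp_all add: add.commute)
    have e: "(\<integral>v. G v \<partial>\<kappa>) = G 0" "(\<integral>v. G (v + a) \<partial>\<kappa>) = G a" "(\<integral>v. G (v + b) \<partial>\<kappa>) = G b"
    proof -
      have *: "\<And>s. G s = (\<integral>v. G (s + v) \<partial>\<kappa>)" using Gs unfolding solution_def by blast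
      show "(\<integral>v. G v \<partial>\<kappa>) = G 0" using *[of 0] by simp
      show "(\<integral>v. G (v + a) \<partial>\<kappa>) = G a" using *[of a] by (simp add: add.commute)
      show "(\<integral>v. G (v + b) \<partial>\<kappa>) = G b" using *[of b] by (simp add: add.commute)
    qed
    have "(\<integral>v. D v \<partial>\<kappa>) = m * (\<integral>v. G v \<partial>\<kappa>) - (\<alpha> * (\<integral>v. G (v + a) \<partial>\<kappa>) + \<beta> * (\<integral>v. G (v + b) \<partial>\<kappa>))"
      unfolding D_def using i by simp
    also have "\<dots> = 0" using eq by (simp add: e solutionD(1)[OF Gs])
    finally have z: "(\<integral>v. D v \<partial>\<kappa>) = 0" .
    have cG: "isCont (\<lambda>s. G (s + x)) s" for s x
      by (rule isCont_o2[where f = "\<lambda>s. s + x"]) (simp_all add: solution_continuous[OF Gs])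
    have c: "isCont D s" for s
      unfolding D_def using cG[of s 0] cG by (intro continuous_intros) simp_all
    have "integrable \<kappa> D" unfolding D_def using i by simp
    then have "D s = 0" for s using nonneg_zero_integral_imp_zero[of D, OF c nn _ z] by blast
    then show ?thesis by (simp add: D_def)
  qed
  have "\<exists>G\<in>T. ?l G > m - 1 / Suc n" for n
  proof -
    have "m - 1 / Suc n < Sup (?l ` T)" by (simp add: m_def)
    then show ?thesis using less_cSup_iff[of "?l ` T"] ne bdd by auto
  qed
  then obtain F where F: "\<And>n. F n \<in> T" "\<And>n. ?l (F n) > m - 1 / Suc n" by metis
  obtain r G where r: "strict_mono (r::nat\<Rightarrow>nat)" "solution G" "\<And>s. (\<lambda>n. F (r n) s) \<longlonglongrightarrow> G s"
    using solution_compact[of F] sol[OF F(1)] by blast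
  have GT: "G \<in> T" by (rule cl[OF _ r(3)]) (rule F(1))
  have "(\<lambda>n. ?l (F (r n))) \<longlonglongrightarrow> ?l G" by (intro tendsto_intros r(3))
  moreover have "(\<lambda>n. m - 1 / Suc (r n)) \<longlonglongrightarrow> m - 0"
    by (intro tendsto_diff tendsto_const LIMSEQ_subseq_LIMSEQ[OF _ r(1), unfolded o_def])
       (rule LIMSEQ_Suc[OF lim_1_over_n])
  ultimately have "m - 0 \<le> ?l G"
    using F(2) by (intro LIMSEQ_le) (auto intro: less_imp_le)
  then have lG: "?l G = m" using le[OF GT] by simp
  have "invariant_closed {G \<in> T. \<forall>s. \<alpha> * G (s + a) + \<beta> * G (s + b) = m * G s}"
    unfolding invariant_closed_def
  proof (intro conjI ballI allI impI)
    show "{G \<in> T. \<forall>s. \<alpha> * G (s + a) + \<beta> * G (s + b) = m * G s} \<noteq> {}" using GT max_imp[OF GT lG] by blast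
    show "{G \<in> T. \<forall>s. \<alpha> * G (s + a) + \<beta> * G (s + b) = m * G s} \<subseteq> Collect solution" using sol by auto
  next
    fix G u assume "G \<in> {G \<in> T. \<forall>s. \<alpha> * G (s + a) + \<beta> * G (s + b) = m * G s}"
    then have G: "G \<in> T" "\<And>s. \<alpha> * G (s + a) + \<beta> * G (s + b) = m * G s" by auto
    have "\<alpha> * (G (s + a + u) / G u) + \<beta> * (G (s + b + u) / G u) = m * (G (s + u) / G u)" for s
    proof -
      have "\<alpha> * G (s + a + u) + \<beta> * G (s + b + u) = m * G (s + u)"
        using G(2)[of "s + u"] by (simp add: add.commute add.left_commute)
      then show ?thesis by (simp add: add_divide_distrib[symmetric])
    qed
    then show "(\<lambda>s. G (s + u) / G u) \<in> {G \<in> T. \<forall>s. \<alpha> * G (s + a) + \<beta> * G (s + b) = m * G s}"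
      using sh[OF G(1)] by auto
  next
    fix F G assume *: "(\<forall>n::nat. F n \<in> {G \<in> T. \<forall>s. \<alpha> * G (s + a) + \<beta> * G (s + b) = m * G s}) \<and>
       (\<forall>s. (\<lambda>n. F n s) \<longlonglongrightarrow> G s)"
    then have lim: "\<And>s. (\<lambda>n. F n s) \<longlonglongrightarrow> G s" by blast
    have "\<alpha> * G (s + a) + \<beta> * G (s + b) = m * G s" for s
    proof (rule LIMSEQ_unique)
      show "(\<lambda>n. \<alpha> * F n (s + a) + \<beta> * F n (s + b)) \<longlonglongrightarrow> \<alpha> * G (s + a) + \<beta> * G (s + b)"
        by (intro tendsto_intros lim)
      show "(\<lambda>n. \<alpha> * F n (s + a) + \<beta> * F n (s + b)) \<longlonglongrightarrow> m * G s"
        using * tendsto_mult_left[OF lim, of m s] by simp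
    qed
    then show "G \<in> {G \<in> T. \<forall>s. \<alpha> * G (s + a) + \<beta> * G (s + b) = m * G s}"
      using cl[of F G] * by blast
  qed
  then show ?thesis using le max_imp by (intro exI[of _ m] conjI ballI impI)
qed

lemma invariant_closedD:
  assumes "invariant_closed T"
  shows "T \<noteq> {}" "G \<in> T \<Longrightarrow> solution G" "G \<in> T \<Longrightarrow> (\<lambda>s. G (s + u) / G u) \<in> T"
    "(\<And>n::nat. F n \<in> T) \<Longrightarrow> (\<And>s. (\<lambda>n. F n s) \<longlonglongrightarrow> G s) \<Longrightarrow> G \<in> T"
proof -
  have a: "T \<noteq> {}" "T \<subseteq> Collect solution" "\<forall>G\<in>T. \<forall>u. (\<lambda>s. G (s + u) / G u) \<in> T"
    and b: "\<forall>F G. (\<forall>n::nat. F n \<in> T) \<and> (\<forall>s. (\<lambda>n. F n s) \<longlonglongrightarrow> G s) \<longrightarrow> G \<in> T"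
    using assms unfolding invariant_closed_def by blast+
  show "T \<noteq> {}" by (rule a)
  show "solution G" if "G \<in> T" using a(2) that by blast
  show "(\<lambda>s. G (s + u) / G u) \<in> T" if "G \<in> T" using a(3) that by blast
  show "G \<in> T" if "\<And>n::nat. F n \<in> T" "\<And>s. (\<lambda>n. F n s) \<longlonglongrightarrow> G s" using b that by blast
qed

lemma periodic_ratio_subset:
  assumes "invariant_closed T"
  obtains m where "invariant_closed {G \<in> T. \<forall>s. G (s + a) = m * G s}"
proof -
  obtain m where "invariant_closed {G \<in> T. \<forall>s. 1 * G (s + a) + 0 * G (s + a) = m * G s}"
    using maximal_face[OF assms, of 1 a 0 a] by (elim exE conjE)
  then show ?thesis using that[of m] by simp
qed

text \<open>Maximising \<open>G(1/2\<^sup>n)\<close> for \<open>n = 0, 1, 2, \<dots>\<close> in turn produces a decreasing sequence of invariant closed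
sets. A common element satisfies \<open>G(s + 1/2\<^sup>n) = m\<^sub>n G(s)\<close> for every \<open>n\<close>, hence is exponential on the
dyadic rationals, and on the whole line by continuity.\<close>

lemma exponential_in_invariant_closed:
  assumes T: "invariant_closed T"
  obtains \<rho> where "(\<lambda>s. exp (\<rho> * s)) \<in> T"
proof -
  define P where "P n T' \<longleftrightarrow> invariant_closed T' \<and> T' \<subseteq> T" for n :: nat and T' :: "(real \<Rightarrow> real) set"
  define Q where "Q n T' T'' \<longleftrightarrow> (\<exists>m. T'' = {G \<in> T'. \<forall>s. G (s + 1 / 2 ^ n) = m * G s})" for n :: nat and T' T'' :: "(real \<Rightarrow> real) set"
  have step: "\<exists>T''. P (Suc n) T'' \<and> Q n T' T''" if P: "P n T'" for n T'
  proof -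
    have ic: "invariant_closed T'" and sub: "T' \<subseteq> T" using P by (auto simp: P_def)
    obtain m where m: "invariant_closed {G \<in> T'. \<forall>s. G (s + 1 / 2 ^ n) = m * G s}"
      using periodic_ratio_subset[OF ic] by blast
    have "{G \<in> T'. \<forall>s. G (s + 1 / 2 ^ n) = m * G s} \<subseteq> T" using sub by blast
    with m show ?thesis unfolding P_def Q_def by blast
  qed
  have P0: "P 0 T" using T by (simp add: P_def)
  have "\<exists>U. \<forall>n. (P n (U n) \<and> (n = 0 \<longrightarrow> U n = T)) \<and> Q n (U n) (U (Suc n))"
  proof (rule dependent_nat_choice)
    show "\<exists>x. P 0 x \<and> (0 = (0::nat) \<longrightarrow> x = T)" using P0 by blast
    show "\<exists>y. (P (Suc n) y \<and> (Suc n = 0 \<longrightarrow> y = T)) \<and> Q n x y" if "P n x \<and> (n = 0 \<longrightarrow> x = T)" for x n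
      using step[of n x] that by (elim conjE exE) blast
  qed
  then obtain U where U': "\<forall>n. (P n (U n) \<and> (n = 0 \<longrightarrow> U n = T)) \<and> Q n (U n) (U (Suc n))" ..
  have U: "U 0 = T" "\<And>n. P n (U n)" "\<And>n. Q n (U n) (U (Suc n))" using U' by blast+
  have ic: "invariant_closed (U n)" for n using U(2)[of n] by (simp add: P_def)
  have dec: "U (n + k) \<subseteq> U n" for n k
  proof (induction k)
    case (Suc k)
    have "U (Suc (n + k)) \<subseteq> U (n + k)" using U(3)[of "n + k"] by (auto simp: Q_def)
    then show ?case using Suc by auto
  qed simp
  have "\<forall>n. \<exists>G. G \<in> U n" using invariant_closedD(1)[OF ic] by auto
  then obtain F where F: "\<And>n. F n \<in> U n" by metis
  obtain r G where r: "strict_mono (r::nat\<Rightarrow>nat)" "solution G" "\<And>s. (\<lambda>n. F (r n) s) \<longlonglongrightarrow> G s"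
    using solution_compact[of F] invariant_closedD(2)[OF ic F] by metis
  have GU: "G \<in> U n" for n
  proof (rule invariant_closedD(4)[OF ic])
    show "F (r (k + n)) \<in> U n" for k
    proof -
      have "r (k + n) \<ge> n" using seq_suble[OF r(1), of "k + n"] by simp
      then have "U (r (k + n)) \<subseteq> U n" using dec[of n "r (k + n) - n"] by simp
      then show ?thesis using F by blast
    qed
    show "(\<lambda>k. F (r (k + n)) s) \<longlonglongrightarrow> G s" for s
      by (rule LIMSEQ_ignore_initial_segment[OF r(3)])
  qed
  have pos: "G s > 0" for s by (rule solution_pos[OF r(2)])
  have G0: "G 0 = 1" by (rule solutionD(1)[OF r(2)])
  have per: "G (s + 1 / 2 ^ n) = G (1 / 2 ^ n) * G s" for s n
  proof -
    obtain m where m: "\<forall>s. G (s + 1 / 2 ^ n) = m * G s"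
      using GU[of "Suc n"] U(3)[of n] by (auto simp: Q_def)
    have "G (1 / 2 ^ n) = m" using m[rule_format, of 0] G0 by simp
    then show ?thesis using m by simp
  qed
  have perk: "G (real k * (1 / 2 ^ n)) = G (1 / 2 ^ n) ^ k" for k n
  proof (induction k)
    case (Suc k)
    have "real (Suc k) * (1 / 2 ^ n) = real k * (1 / 2 ^ n) + 1 / 2 ^ n" by (simp add: field_simps)
    then show ?case using per[of "real k * (1 / 2 ^ n)" n] Suc by simp
  qed (simp add: G0)
  define \<rho> where "\<rho> = ln (G 1)"
  have root: "G (1 / 2 ^ n) = exp (\<rho> * (1 / 2 ^ n))" for n
  proof -
    have "G (1 / 2 ^ n) ^ (2 ^ n) = G 1" using perk[of "2 ^ n" n] by simp
    then have "\<rho> = 2 ^ n * ln (G (1 / 2 ^ n))"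
      using ln_realpow[of "G (1 / 2 ^ n)" "2 ^ n"] by (simp add: \<rho>_def)
    then have "\<rho> * (1 / 2 ^ n) = ln (G (1 / 2 ^ n))" by simp
    then show ?thesis using pos[of "1 / 2 ^ n"] by (simp only: exp_ln)
  qed
  have dyadic: "G (of_int k * (1 / 2 ^ n)) = exp (\<rho> * (of_int k * (1 / 2 ^ n)))" for k n
  proof (induction k rule: int_induct[of _ 0])
    case base then show ?case by (simp add: G0)
  next
    case (step1 i)
    have e: "of_int (i + 1) * (1 / 2 ^ n) = of_int i * (1 / 2 ^ n) + (1 / 2 ^ n :: real)" by (simp add: field_simps)
    show ?case unfolding e per root step1(2) by (simp add: exp_add[symmetric] distrib_left)
  next
    case (step2 i)
    have e: "of_int (i - 1) * (1 / 2 ^ n) + 1 / 2 ^ n = (of_int i * (1 / 2 ^ n) :: real)" by (simp add: field_simps)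
    define y where "y = of_int (i - 1) * (1 / 2 ^ n :: real)"
    have "exp (\<rho> * (1 / 2 ^ n)) * G y = G (y + 1 / 2 ^ n)" using per[of y n] root[of n] by simp
    also have "\<dots> = exp (\<rho> * (y + 1 / 2 ^ n))" unfolding y_def e by (rule step2(2))
    also have "\<dots> = exp (\<rho> * (1 / 2 ^ n)) * exp (\<rho> * y)" by (simp only: distrib_left exp_add mult.commute)
    finally show ?case unfolding y_def[symmetric] by (simp only: mult_cancel_left exp_not_eq_zero simp_thms)
  qed
  have "G s = exp (\<rho> * s)" for s
  proof -
    define x where "x n = of_int \<lfloor>s * 2 ^ n\<rfloor> * (1 / 2 ^ n :: real)" for n
    have x: "x \<longlonglongrightarrow> s"
    proof (rule LIM_zero_cancel, rule tendsto_rabs_zero_cancel, rule tendsto_sandwich)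
      show "eventually (\<lambda>n. 0 \<le> \<bar>x n - s\<bar>) sequentially" by simp
      show "eventually (\<lambda>n. \<bar>x n - s\<bar> \<le> (1 / 2) ^ n) sequentially"
      proof (intro always_eventually allI)
        fix n
        have "x n - s = (of_int \<lfloor>s * 2 ^ n\<rfloor> - s * 2 ^ n) / 2 ^ n" by (simp add: x_def field_simps)
        also have "\<bar>\<dots>\<bar> \<le> 1 / 2 ^ n"
          unfolding abs_divide by (intro divide_mono) (auto simp: abs_le_iff, linarith+)
        finally show "\<bar>x n - s\<bar> \<le> (1 / 2) ^ n" by (simp add: power_one_over)
      qed
      show "(\<lambda>n. (1 / 2) ^ n :: real) \<longlonglongrightarrow> 0" by (rule LIMSEQ_power_zero) simp
    qed simp
    have "(\<lambda>n. G (x n)) \<longlonglongrightarrow> G s" by (rule isCont_tendsto_compose[OF solution_continuous[OF r(2)] x])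
    moreover have "(\<lambda>n. exp (\<rho> * x n)) \<longlonglongrightarrow> exp (\<rho> * s)" by (intro tendsto_intros x)
    moreover have "G (x n) = exp (\<rho> * x n)" for n unfolding x_def by (rule dyadic)
    ultimately show ?thesis using LIMSEQ_unique by (simp only:)
  qed
  then have "G = (\<lambda>s. exp (\<rho> * s))" by (rule ext)
  then show ?thesis using that GU[of 0] U(1) by simp
qed

text \<open>By strict convexity of \<open>\<rho> \<mapsto> e\<^sup>\<rho>\<^sup>s\<close> the combination \<open>D\<close> of the three exponentials is
nonnegative and not identically zero, but it has integral 0.\<close>

lemma no_three_exponentials:
  assumes "a < b" "b < c" "solution (\<lambda>s. exp (a * s))" "solution (\<lambda>s. exp (b * s))" "solution (\<lambda>s. exp (c * s))"
  shows False
proof -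
  define D where "D s = (c - b) * exp (a * s) + (b - a) * exp (c * s) - (c - a) * exp (b * s)" for s
  have i: "integrable \<kappa> (\<lambda>s. exp (x * s))" "(\<integral>s. exp (x * s) \<partial>\<kappa>) = 1" if "solution (\<lambda>s. exp (x * s))" for x
    using solution_integrable[OF that, of 0] solutionD(5)[OF that, of 0] by simp_all
  have Deq: "D s = exp (b * s) * ((c - b) * (exp ((a - b) * s) - 1 - (a - b) * s) + (b - a) * (exp ((c - b) * s) - 1 - (c - b) * s))" for s
  proof -
    have "exp (a * s) = exp (b * s) * exp ((a - b) * s)" "exp (c * s) = exp (b * s) * exp ((c - b) * s)"
      by (simp_all add: exp_add[symmetric] algebra_simps)
    then show ?thesis unfolding D_def by (simp only:) (simp add: algebra_simps)
  qed
  have "D 1 = 0"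
  proof (rule nonneg_zero_integral_imp_zero[where D = D])
    show "isCont D s" for s unfolding D_def by (intro continuous_intros)
    show "0 \<le> D s" for s unfolding Deq
      using assms(1,2) exp_ge_add_one_self[of "(a - b) * s"] exp_ge_add_one_self[of "(c - b) * s"]
      by (intro mult_nonneg_nonneg add_nonneg_nonneg) (simp_all del: exp_ge_add_one_self add: algebra_simps)
    show "integrable \<kappa> D" unfolding D_def using i(1) assms(3-5) by simp
    show "(\<integral>v. D v \<partial>\<kappa>) = 0" unfolding D_def using i[OF assms(3)] i[OF assms(4)] i[OF assms(5)] by simp
  qed
  moreover have "D 1 > 0"
  proof -
    have "exp (c - b) \<ge> 1 + (c - b) + (c - b)\<^sup>2 / 2" using assms by (intro exp_lower_Taylor_quadratic) simp
    moreover have "(c - b)\<^sup>2 > 0" using assms by simp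
    ultimately have 1: "exp (c - b) - 1 - (c - b) > 0" by linarith
    have 2: "exp (a - b) - 1 - (a - b) \<ge> 0" using exp_ge_add_one_self[of "a - b"] by linarith
    show ?thesis unfolding Deq using 1 2 assms(1,2)
      by (intro mult_pos_pos add_nonneg_pos mult_nonneg_nonneg) auto
  qed
  ultimately show False by simp
qed

text \<open>The set of maximisers contains an exponential.\<close>

lemma linear_bound_from_exponentials:
  assumes G: "solution G"
    and exps: "\<And>\<rho>. solution (\<lambda>s. exp (\<rho> * s)) \<Longrightarrow> \<alpha> * exp (\<rho> * a) + \<beta> * exp (\<rho> * b) \<le> M"
  shows "\<alpha> * G a + \<beta> * G b \<le> M"
proof -
  obtain m where m: "\<forall>G\<in>Collect solution. \<alpha> * G a + \<beta> * G b \<le> m"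
    "invariant_closed {G \<in> Collect solution. \<forall>s. \<alpha> * G (s + a) + \<beta> * G (s + b) = m * G s}"
    using maximal_face[OF invariant_closed_solutions[OF G], of \<alpha> a \<beta> b] by (elim exE conjE)
  obtain \<rho> where \<rho>: "(\<lambda>s. exp (\<rho> * s)) \<in> {G \<in> Collect solution. \<forall>s. \<alpha> * G (s + a) + \<beta> * G (s + b) = m * G s}"
    using exponential_in_invariant_closed[OF m(2)] by blast
  then have s: "solution (\<lambda>s. exp (\<rho> * s))" and "\<forall>s. \<alpha> * exp (\<rho> * (s + a)) + \<beta> * exp (\<rho> * (s + b)) = m * exp (\<rho> * s)"
    by auto
  from this(2)[rule_format, of 0] have "\<alpha> * exp (\<rho> * a) + \<beta> * exp (\<rho> * b) = m" by simp
  with bspec[OF m(1), of G] G exps[OF s] show ?thesis by simp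
qed

text \<open>The sign \<open>\<sigma>\<close> selects between the largest and the smallest exponent. Solutions with the extremal
value at 1 form an invariant closed set that contains only one exponential, so each value
\<open>G(s)\<close> has the same maximum and minimum on it.\<close>

lemma extremal_solution_is_exponential:
  assumes G: "solution G" and \<sigma>: "\<sigma> = 1 \<or> \<sigma> = - 1"
    and exps: "\<And>\<rho>'. solution (\<lambda>s. exp (\<rho>' * s)) \<Longrightarrow> \<sigma> * \<rho>' \<le> \<sigma> * \<rho>"
    and G1: "G 1 = exp \<rho>"
  shows "G s = exp (\<rho> * s)"
proof -
  obtain m where m: "\<forall>G\<in>Collect solution. \<sigma> * G 1 + 0 * G 0 \<le> m"
    "invariant_closed {G \<in> Collect solution. \<forall>s. \<sigma> * G (s + 1) + 0 * G (s + 0) = m * G s}"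
    "\<forall>G\<in>Collect solution. \<sigma> * G 1 + 0 * G 0 = m \<longrightarrow> (\<forall>s. \<sigma> * G (s + 1) + 0 * G (s + 0) = m * G s)"
    using maximal_face[OF invariant_closed_solutions[OF G], of \<sigma> 1 0 0] by (elim exE conjE)
  define T where "T = {G \<in> Collect solution. \<forall>s. \<sigma> * G (s + 1) = m * G s}"
  have T: "invariant_closed T" using m(2) by (simp add: T_def)
  have mono: "\<sigma> * exp x \<le> \<sigma> * exp y \<longleftrightarrow> \<sigma> * x \<le> \<sigma> * y" for x y :: real using \<sigma> by auto
  obtain \<rho>1 where "(\<lambda>s. exp (\<rho>1 * s)) \<in> T" using exponential_in_invariant_closed[OF T] by blast
  then have s1: "solution (\<lambda>s. exp (\<rho>1 * s))" and "\<forall>s. \<sigma> * exp (\<rho>1 * (s + 1)) = m * exp (\<rho>1 * s)"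
    by (auto simp: T_def)
  from this(2)[rule_format, of 0] have m1: "m = \<sigma> * exp \<rho>1" by simp
  have "\<sigma> * exp \<rho> \<le> m" using bspec[OF m(1), of G] G G1 by simp
  moreover have "m \<le> \<sigma> * exp \<rho>" unfolding m1 mono by (rule exps[OF s1])
  ultimately have meq: "m = \<sigma> * exp \<rho>" by simp
  have GT: "G \<in> T" using bspec[OF m(3), of G] G G1 meq by (simp add: T_def)
  have only: "\<rho>' = \<rho>" if "(\<lambda>s. exp (\<rho>' * s)) \<in> T" for \<rho>'
  proof -
    have "\<forall>s. \<sigma> * exp (\<rho>' * (s + 1)) = m * exp (\<rho>' * s)" using that by (simp add: T_def)
    from this[rule_format, of 0] have "\<sigma> * exp \<rho>' = \<sigma> * exp \<rho>" using meq by simp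
    then show ?thesis using \<sigma> by auto
  qed
  have bound: "\<tau> * G s \<le> \<tau> * exp (\<rho> * s)" for \<tau> :: real
  proof -
    obtain m' where m': "\<forall>G\<in>T. \<tau> * G s + 0 * G 0 \<le> m'"
      "invariant_closed {G \<in> T. \<forall>u. \<tau> * G (u + s) + 0 * G (u + 0) = m' * G u}"
      using maximal_face[OF T, of \<tau> s 0 0] by (elim exE conjE)
    obtain \<rho>' where "(\<lambda>s. exp (\<rho>' * s)) \<in> {G \<in> T. \<forall>u. \<tau> * G (u + s) + 0 * G (u + 0) = m' * G u}"
      using exponential_in_invariant_closed[OF m'(2)] by blast
    then have "(\<lambda>s. exp (\<rho>' * s)) \<in> T" and e: "\<forall>u. \<tau> * exp (\<rho>' * (u + s)) = m' * exp (\<rho>' * u)" by auto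
    then have "\<rho>' = \<rho>" using only by blast
    with e[rule_format, of 0] have "m' = \<tau> * exp (\<rho> * s)" by simp
    with bspec[OF m'(1) GT] show ?thesis by simp
  qed
  show ?thesis using bound[of 1] bound[of "-1"] by simp
qed

text \<open>A function whose rescaled limits at \<open>-\<infinity>\<close> all solve the convolution equation is asymptotically
exponential there. This is the Drasin-Shea theorem in additive notation. It is not enough to know the
solutions: mixtures of the two exponentials solve the equation, and have to be excluded as
limits by following the ratios \<open>f(u+1)/f(u)\<close> along \<open>u = 0, -1, -2, \<dots>\<close>.\<close>

theorem asymptotic_solution_tendsto_exponential:
  fixes f C :: "real \<Rightarrow> real"
  assumes pos: "\<And>u. f u > 0"
    and bound: "\<And>s u. f (u + s) \<le> C s * f u"
    and equicont: "\<And>s u. u \<le> u0 \<Longrightarrow> \<bar>f (u + s) - f u\<bar> \<le> \<omega> s * f u"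
    and limits: "\<And>(u::nat\<Rightarrow>real) G. filterlim u at_bot sequentially \<Longrightarrow>
      (\<And>s. (\<lambda>n. f (u n + s) / f (u n)) \<longlonglongrightarrow> G s) \<Longrightarrow> solution G"
  shows "\<exists>\<rho>. solution (\<lambda>s. exp (\<rho> * s)) \<and> (\<forall>s. ((\<lambda>u. f (u + s) / f u) \<longlongrightarrow> exp (\<rho> * s)) at_bot)"
proof -
  have compact: "\<exists>r G. strict_mono (r::nat\<Rightarrow>nat) \<and> solution G \<and> (\<forall>s. (\<lambda>n. f (u (r n) + s) / f (u (r n))) \<longlonglongrightarrow> G s)"
    if u: "filterlim u at_bot sequentially" for u :: "nat \<Rightarrow> real"
  proof -
    have le: "eventually (\<lambda>n. u n + s \<le> u0) sequentially" for s
      using u by (simp add: filterlim_at_bot le_diff_eq[symmetric])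
    have nn: "\<bar>f (u n + s) / f (u n)\<bar> \<le> C s" for n s
      using bound[of "u n" s] pos[of "u n"] pos[of "u n + s"] by (simp add: abs_of_pos pos_divide_le_eq)
    have ev: "eventually (\<lambda>n. \<bar>f (u n + s) / f (u n)\<bar> \<le> C s) sequentially" for s using nn by simp
    have eq: "\<exists>d>0. \<forall>h. \<bar>h\<bar> < d \<longrightarrow> eventually (\<lambda>n. \<bar>f (u n + (s + h)) / f (u n) - f (u n + s) / f (u n)\<bar> \<le> e) sequentially"
      if e: "e > 0" for s e
    proof -
      have p: "1 + \<bar>C s\<bar> > 0" by (rule add_pos_nonneg) auto
      then have "e / (1 + \<bar>C s\<bar>) > 0" using e by (rule divide_pos_pos[rotated])
      from modulus_small[OF this] obtain d
        where d: "d > 0" "\<forall>h. \<bar>h\<bar> < d \<and> h \<noteq> 0 \<longrightarrow> \<bar>\<omega> h\<bar> < e / (1 + \<bar>C s\<bar>)"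
        by (elim exE conjE)
      have main: "eventually (\<lambda>n. \<bar>f (u n + (s + h)) / f (u n) - f (u n + s) / f (u n)\<bar> \<le> e) sequentially" if h: "\<bar>h\<bar> < d" for h
        using le[of s]
      proof eventually_elim
        case (elim n)
        show ?case
        proof (cases "h = 0")
          case False
          have "f (u n + (s + h)) / f (u n) - f (u n + s) / f (u n) = (f (u n + s + h) - f (u n + s)) / f (u n)"
            by (simp add: diff_divide_distrib add.assoc)
          then have "\<bar>f (u n + (s + h)) / f (u n) - f (u n + s) / f (u n)\<bar> = \<bar>f (u n + s + h) - f (u n + s)\<bar> / f (u n)"
            using pos[of "u n"] by (simp add: abs_divide)
          also have "\<dots> \<le> \<omega> h * f (u n + s) / f (u n)"
            using equicont[OF elim, of h] pos[of "u n"] by (intro divide_right_mono) auto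
          also have "\<dots> = \<omega> h * (f (u n + s) / f (u n))" by simp
          also have "\<dots> \<le> \<bar>\<omega> h\<bar> * \<bar>f (u n + s) / f (u n)\<bar>" by (metis abs_ge_self abs_mult)
          also have "\<dots> \<le> (e / (1 + \<bar>C s\<bar>)) * (1 + \<bar>C s\<bar>)"
          proof (rule mult_mono)
            show "\<bar>\<omega> h\<bar> \<le> e / (1 + \<bar>C s\<bar>)" using d(2) h False by (simp add: less_imp_le)
            show "\<bar>f (u n + s) / f (u n)\<bar> \<le> 1 + \<bar>C s\<bar>" using nn[of n s] by linarith
          qed (use e in auto)
          also have "\<dots> = e" using p by simp
          finally show ?thesis .
        qed (use e in simp)
      qed
      then have "\<forall>h. \<bar>h\<bar> < d \<longrightarrow> eventually (\<lambda>n. \<bar>f (u n + (s + h)) / f (u n) - f (u n + s) / f (u n)\<bar> \<le> e) sequentially"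
        by (intro allI impI) 
      with d(1) show ?thesis by (intro exI[of _ d] conjI)
    qed
    obtain r G where r: "strict_mono (r::nat\<Rightarrow>nat)" "\<And>s. (\<lambda>n. f (u (r n) + s) / f (u (r n))) \<longlonglongrightarrow> G s"
      using pointwise_convergent_subsequence[of "\<lambda>n s. f (u n + s) / f (u n)" C, OF ev eq] by metis
    have "filterlim (\<lambda>n. u (r n)) at_bot sequentially"
      by (rule filterlim_compose[OF u filterlim_subseq[OF r(1)]])
    then have "solution G" using r(2) by (rule limits)
    with r show ?thesis by (intro exI[of _ r] exI[of _ G] conjI allI)
  qed
  \<comment> \<open>Only the integers are followed first; the ratios \<open>x\<close> below refer to them.\<close>
  define N where "N n = - real n" for n
  have N: "filterlim N at_bot sequentially"
    unfolding N_def using filterlim_real_sequentially by (simp add: filterlim_uminus_at_top)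
  obtain r0 :: "nat \<Rightarrow> nat" and G0 where G0: "solution G0" using compact[OF N] by blast
  define E where "E = {\<rho>. solution (\<lambda>s. exp (\<rho> * s))}"
  have Ene: "E \<noteq> {}"
    using exponential_in_invariant_closed[OF invariant_closed_solutions[OF G0]] by (auto simp: E_def)
  obtain \<rho>1 \<rho>2 where \<rho>: "\<rho>1 \<le> \<rho>2" "\<rho>1 \<in> E" "\<rho>2 \<in> E" "\<And>\<rho>. \<rho> \<in> E \<Longrightarrow> \<rho> = \<rho>1 \<or> \<rho> = \<rho>2"
  proof -
    obtain a where a: "a \<in> E" using Ene by blast
    show ?thesis
    proof (cases "\<exists>b\<in>E. b \<noteq> a")
      case False
      then show ?thesis using that[of a a] a by blast
    next
      case True
      then obtain b where b: "b \<in> E" "b \<noteq> a" by blast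
      have third: "c = a \<or> c = b" if c: "c \<in> E" for c
      proof (rule ccontr)
        assume "\<not> (c = a \<or> c = b)"
        moreover have "\<not> (x < y \<and> y < z)" if "x \<in> E" "y \<in> E" "z \<in> E" for x y z
          using no_three_exponentials[of x y z] that by (auto simp: E_def)
        ultimately show False using a b c by (metis linorder_neqE_linordered_idom)
      qed
      show ?thesis
      proof (cases "a \<le> b")
        case True then show ?thesis using that[of a b] a b third by blast
      next
        case False then show ?thesis using that[of b a] a b third by (metis linear)
      qed
    qed
  qed
  define q1 q2 where "q1 = exp \<rho>1" and "q2 = exp \<rho>2"
  have q: "0 < q1" "q1 \<le> q2" using \<rho>(1) by (auto simp: q1_def q2_def)
  have lo: "q1 \<le> G 1" and up: "G 1 \<le> q2" and rel: "G 2 - (q1 + q2) * G 1 + q1 * q2 = 0" if G: "solution G" for G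
  proof -
    have e2: "exp (x * 2) = exp x * exp x" for x :: real by (metis exp_add mult_2_right)
    have "-1 * G 1 + 0 * G 0 \<le> - q1"
      by (rule linear_bound_from_exponentials[OF G]) (use \<rho>(4) q in \<open>force simp: E_def q1_def q2_def\<close>)
    then show "q1 \<le> G 1" by simp
    have "1 * G 1 + 0 * G 0 \<le> q2"
      by (rule linear_bound_from_exponentials[OF G]) (use \<rho>(4) q in \<open>force simp: E_def q1_def q2_def\<close>)
    then show "G 1 \<le> q2" by simp
    have val: "exp (x * 2) - (q1 + q2) * exp (x * 1) = - (q1 * q2)" if "solution (\<lambda>s. exp (x * s))" for x
      using \<rho>(4)[of x] that by (auto simp: E_def q1_def q2_def e2 algebra_simps)
    have "1 * G 2 + (- (q1 + q2)) * G 1 \<le> - (q1 * q2)"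
      by (rule linear_bound_from_exponentials[OF G]) (use val in \<open>simp add: algebra_simps\<close>)
    moreover have "(-1) * G 2 + (q1 + q2) * G 1 \<le> q1 * q2"
      by (rule linear_bound_from_exponentials[OF G]) (use val in \<open>simp add: algebra_simps\<close>)
    ultimately show "G 2 - (q1 + q2) * G 1 + q1 * q2 = 0" by (simp add: algebra_simps)
  qed
  have sub: "filterlim (\<lambda>n. N (r n)) at_bot sequentially" if "strict_mono (r :: nat \<Rightarrow> nat)" for r
    by (rule filterlim_compose[OF N filterlim_subseq[OF that]])
  define x where "x n = f (N n + 1) / f (N n)" for n
  \<comment> \<open>Every property of the values \<open>G(1)\<close> that is inherited by nearby values holds eventually for \<open>x\<close>.\<close>
  have bad: False if ev: "\<not> eventually (\<lambda>n. P (x n)) sequentially"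
    and imp: "\<And>r G. solution G \<Longrightarrow> (\<lambda>n. x (r n)) \<longlonglongrightarrow> G 1 \<Longrightarrow> eventually (\<lambda>n. P (x (r n))) sequentially" for P
  proof -
    obtain r :: "nat \<Rightarrow> nat" where r: "strict_mono r" "\<And>n. \<not> P (x (r n))"
      using not_eventually_sequentiallyD[OF ev] by blast
    obtain r' G where r': "strict_mono (r' :: nat \<Rightarrow> nat)" "solution G"
      "\<forall>s. (\<lambda>n. f (N (r (r' n)) + s) / f (N (r (r' n)))) \<longlonglongrightarrow> G s"
      using compact[OF sub[OF r(1)]] by blast
    have "(\<lambda>n. x (r (r' n))) \<longlonglongrightarrow> G 1" using r'(3) by (simp add: x_def)
    from imp[OF r'(2) this] r(2) show False by simp
  qed
  have "x \<longlonglongrightarrow> q1 \<or> x \<longlonglongrightarrow> q2"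
  proof (rule asymptotic_Moebius_recursion[OF q])
    show "eventually (\<lambda>n. x n < b) sequentially" if b: "b > q2" for b
      by (rule ccontr, erule bad) (erule order_tendstoD(2), rule le_less_trans[OF up b])
    show "eventually (\<lambda>n. x n > b) sequentially" if b: "b < q1" for b
      by (rule ccontr, erule bad) (erule order_tendstoD(1), rule less_le_trans[OF b lo])
    show "(\<lambda>n. x n * x (Suc n) - (q1 + q2) * x (Suc n) + q1 * q2) \<longlonglongrightarrow> 0"
    proof (rule LIMSEQ_subsequence_principle)
      fix r :: "nat \<Rightarrow> nat" assume r: "strict_mono r"
      have r1: "strict_mono (\<lambda>n. Suc (r n))" using r by (simp add: strict_mono_def)
      obtain r' G where r': "strict_mono (r' :: nat \<Rightarrow> nat)" "solution G"
        and lim: "\<forall>s. (\<lambda>n. f (N (Suc (r (r' n))) + s) / f (N (Suc (r (r' n))))) \<longlonglongrightarrow> G s"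
        using compact[OF sub[OF r1]] by blast
      have "(\<lambda>n. f (N (Suc (r (r' n))) + 2) / f (N (Suc (r (r' n)))) - (q1 + q2) * x (Suc (r (r' n))) + q1 * q2)
          \<longlonglongrightarrow> G 2 - (q1 + q2) * G 1 + q1 * q2"
        unfolding x_def by (intro tendsto_intros lim[rule_format])
      moreover have "x n * x (Suc n) = f (N (Suc n) + 2) / f (N (Suc n))" for n
      proof -
        have "N (Suc n) + 1 = N n" "N (Suc n) + 2 = N n + 1" by (simp_all add: N_def)
        then show ?thesis using pos[of "N n"] by (simp only: x_def) simp
      qed
      ultimately show "\<exists>r'. strict_mono r' \<and> (\<lambda>n. x (r (r' n)) * x (Suc (r (r' n))) - (q1 + q2) * x (Suc (r (r' n))) + q1 * q2) \<longlonglongrightarrow> 0"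
        using r'(1) rel[OF r'(2)] by auto
    qed
  qed
  then obtain \<rho> where \<rho>E: "\<rho> \<in> E" and x\<rho>: "x \<longlonglongrightarrow> exp \<rho>"
    and ext: "(\<forall>\<rho>'\<in>E. 1 * \<rho>' \<le> 1 * \<rho>) \<or> (\<forall>\<rho>'\<in>E. (-1) * \<rho>' \<le> (-1) * \<rho>)"
  proof
    assume "x \<longlonglongrightarrow> q1"
    moreover have "\<forall>\<rho>'\<in>E. (-1) * \<rho>' \<le> (-1) * \<rho>1" using \<rho> by force
    ultimately show ?thesis using that[of \<rho>1] \<rho>(2) by (simp add: q1_def)
  next
    assume "x \<longlonglongrightarrow> q2"
    moreover have "\<forall>\<rho>'\<in>E. 1 * \<rho>' \<le> 1 * \<rho>2" using \<rho> by force
    ultimately show ?thesis using that[of \<rho>2] \<rho>(3) by (simp add: q2_def)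
  qed
  have isexp: "G s = exp (\<rho> * s)" if G: "solution G" "G 1 = exp \<rho>" for G s
    using ext
  proof
    assume "\<forall>\<rho>'\<in>E. 1 * \<rho>' \<le> 1 * \<rho>"
    then show ?thesis by (intro extremal_solution_is_exponential[OF G(1) _ _ G(2), of 1]) (auto simp: E_def)
  next
    assume "\<forall>\<rho>'\<in>E. (-1) * \<rho>' \<le> (-1) * \<rho>"
    then show ?thesis by (intro extremal_solution_is_exponential[OF G(1) _ _ G(2), of "-1"]) (auto simp: E_def)
  qed
  have convN: "(\<lambda>n. f (N n + s) / f (N n)) \<longlonglongrightarrow> exp (\<rho> * s)" for s
  proof (rule LIMSEQ_subsequence_principle)
    fix r :: "nat \<Rightarrow> nat" assume r: "strict_mono r"
    obtain r' G where r': "strict_mono (r' :: nat \<Rightarrow> nat)" "solution G"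
        and lim: "\<forall>s. (\<lambda>n. f (N (r (r' n)) + s) / f (N (r (r' n)))) \<longlonglongrightarrow> G s"
        using compact[OF sub[OF r]] by blast
    have "(\<lambda>n. x (r (r' n))) \<longlonglongrightarrow> exp \<rho>"
      using LIMSEQ_subseq_LIMSEQ[OF x\<rho> strict_mono_o[OF r r'(1)]] by (simp add: o_def)
    moreover have "(\<lambda>n. x (r (r' n))) \<longlonglongrightarrow> G 1" using lim by (simp add: x_def)
    ultimately have "G 1 = exp \<rho>" by (rule LIMSEQ_unique[symmetric])
    then have "G s = exp (\<rho> * s)" by (rule isexp[OF r'(2)])
    with lim r'(1) show "\<exists>r'. strict_mono r' \<and> (\<lambda>n. f (N (r (r' n)) + s) / f (N (r (r' n)))) \<longlonglongrightarrow> exp (\<rho> * s)"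
      by metis
  qed
  have "((\<lambda>u. f (u + s) / f u) \<longlongrightarrow> exp (\<rho> * s)) at_bot" for s
  proof -
    have seq: "(\<lambda>n. f (u n + s) / f (u n)) \<longlonglongrightarrow> exp (\<rho> * s)" if u: "filterlim u at_bot sequentially" for u :: "nat \<Rightarrow> real"
    proof (rule LIMSEQ_subsequence_principle)
      fix r :: "nat \<Rightarrow> nat" assume r: "strict_mono r"
      \<comment> \<open>Decompose into integer and fractional part, and let the latter converge; the \<open>max\<close> and \<open>min\<close> below only matter for the finitely many positive values of \<open>u\<close>.\<close>
      define k where "k n = nat \<lceil>- u (r n)\<rceil>" for n
      define \<theta> where "\<theta> n = u (r n) + real (k n)" for n
      have ur: "filterlim (\<lambda>n. u (r n)) at_bot sequentially"
        by (rule filterlim_compose[OF u filterlim_subseq[OF r]])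
      have ev0: "eventually (\<lambda>n. u (r n) \<le> 0) sequentially" using ur by (simp add: filterlim_at_bot)
      have "min 1 (max 0 (\<theta> n)) \<in> {0..1}" for n by auto
      then obtain l r' where r': "strict_mono (r' :: nat \<Rightarrow> nat)" and l: "((\<lambda>n. min 1 (max 0 (\<theta> n))) \<circ> r') \<longlonglongrightarrow> l"
        using compact_imp_seq_compact[OF compact_Icc[of 0 "1::real"]] unfolding seq_compact_def by metis
      have "eventually (\<lambda>n. min 1 (max 0 (\<theta> n)) = \<theta> n) sequentially"
        using ev0 unfolding \<theta>_def k_def by eventually_elim (simp add: of_nat_nat, linarith)
      then have "eventually (\<lambda>n. ((\<lambda>n. min 1 (max 0 (\<theta> n))) \<circ> r') n = \<theta> (r' n)) sequentially"
        unfolding o_def by (rule eventually_subseq[OF r'])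
      then have \<theta>l: "(\<lambda>n. \<theta> (r' n)) \<longlonglongrightarrow> l"
        by (rule Lim_transform_eventually[OF l])
      have ktop: "filterlim (\<lambda>n. k (r' n)) sequentially sequentially"
      proof -
        have "filterlim (\<lambda>n. real (k n)) at_top sequentially"
        proof (rule filterlim_at_top_mono)
          show "filterlim (\<lambda>n. - u (r n)) at_top sequentially"
            using ur by (simp add: filterlim_uminus_at_top)
          show "eventually (\<lambda>n. - u (r n) \<le> real (k n)) sequentially"
            by (intro always_eventually allI) (simp add: k_def, linarith)
        qed
        then have "filterlim k sequentially sequentially" by (simp add: filterlim_sequentially_iff_filterlim_real)
        then show ?thesis by (rule filterlim_compose[OF _ filterlim_subseq[OF r']])
      qed
      define M where "M n = N (k (r' n))" for n
      have M: "filterlim M at_bot sequentially" unfolding M_def by (rule filterlim_compose[OF N ktop])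
      have convM: "(\<lambda>n. f (M n + t) / f (M n)) \<longlonglongrightarrow> exp (\<rho> * t)" for t
        unfolding M_def by (rule filterlim_compose[OF convN ktop])
      \<comment> \<open>The modulus may take any value at 0, whereas the oscillation vanishes there.\<close>
      define w where "w h = (if h = 0 then 0 else \<omega> h)" for h
      have w0: "isCont w 0"
        unfolding isCont_def using modulus
        by (subst (asm) tendsto_cong[where g = w]) (auto simp: w_def eventually_at intro: exI[of _ 1])
      have shifted: "(\<lambda>n. f (M n + \<theta> (r' n) + t) / f (M n)) \<longlonglongrightarrow> exp (\<rho> * (l + t))" for t
      proof -
        have "(\<lambda>n. f (M n + \<theta> (r' n) + t) / f (M n) - f (M n + (l + t)) / f (M n)) \<longlonglongrightarrow> 0"
        proof (rule Lim_null_comparison)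
          have le: "eventually (\<lambda>n. M n + (l + t) \<le> u0) sequentially"
            using M by (simp add: filterlim_at_bot le_diff_eq[symmetric])
          show "eventually (\<lambda>n. norm (f (M n + \<theta> (r' n) + t) / f (M n) - f (M n + (l + t)) / f (M n))
              \<le> w (\<theta> (r' n) - l) * (f (M n + (l + t)) / f (M n))) sequentially"
            using le
          proof eventually_elim
            case (elim n)
            have a: "M n + (l + t) + (\<theta> (r' n) - l) = M n + \<theta> (r' n) + t" by simp
            have "\<bar>f (M n + \<theta> (r' n) + t) - f (M n + (l + t))\<bar> \<le> w (\<theta> (r' n) - l) * f (M n + (l + t))"
              using equicont[OF elim, of "\<theta> (r' n) - l"] unfolding a by (auto simp: w_def add.assoc)
            then show ?case using pos[of "M n"]
              by (simp add: diff_divide_distrib[symmetric] abs_divide divide_right_mono)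
          qed
          have "(\<lambda>n. \<theta> (r' n) - l) \<longlonglongrightarrow> 0" using \<theta>l by (simp add: LIM_zero_iff)
          from isCont_tendsto_compose[OF w0 this] have "(\<lambda>n. w (\<theta> (r' n) - l)) \<longlonglongrightarrow> 0" by (simp add: w_def)
          from tendsto_mult[OF this convM[of "l + t"]]
          show "(\<lambda>n. w (\<theta> (r' n) - l) * (f (M n + (l + t)) / f (M n))) \<longlonglongrightarrow> 0" by simp
        qed
        from tendsto_add[OF this convM[of "l + t"]] show ?thesis by simp
      qed
      have "(\<lambda>n. (f (M n + \<theta> (r' n) + s) / f (M n)) / (f (M n + \<theta> (r' n) + 0) / f (M n))) \<longlonglongrightarrow> exp (\<rho> * (l + s)) / exp (\<rho> * (l + 0))"
        by (intro tendsto_divide shifted) simp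
      moreover have "exp (\<rho> * (l + s)) / exp (\<rho> * (l + 0)) = exp (\<rho> * s)"
        by (simp add: exp_diff[symmetric] algebra_simps)
      moreover have "(f (M n + \<theta> (r' n) + s) / f (M n)) / (f (M n + \<theta> (r' n) + 0) / f (M n)) = f (u (r (r' n)) + s) / f (u (r (r' n)))" for n
      proof -
        have "M n + \<theta> (r' n) = u (r (r' n))" by (simp add: M_def N_def \<theta>_def)
        then show ?thesis using pos[of "M n"] by simp
      qed
      ultimately have "(\<lambda>n. f (u (r (r' n)) + s) / f (u (r (r' n)))) \<longlonglongrightarrow> exp (\<rho> * s)" by (simp only:)
      with r' show "\<exists>r'. strict_mono r' \<and> (\<lambda>n. f (u (r (r' n)) + s) / f (u (r (r' n)))) \<longlonglongrightarrow> exp (\<rho> * s)"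
        by (intro exI[of _ r'] conjI)
    qed
    show ?thesis
      by (rule tendsto_at_botI_sequentially[OF seq])
  qed
  with \<rho>E show ?thesis by (auto simp: E_def)
qed

end

section \<open>The standard Gaussian measure\<close>

text \<open>Defined as the law of a vector with independent standard normal coordinates, so that the
characteristic function and the second moment reduce to dimension one.\<close>

definition std_gaussian :: "'a::euclidean_space measure" where
  "std_gaussian = distr (\<Pi>\<^sub>M b\<in>(Basis::'a set). std_normal_distribution) borel (\<lambda>f. \<Sum>b\<in>Basis. f b *\<^sub>R b)"

lemma measurable_sum_Basis [measurable]:
  "(\<lambda>f. \<Sum>b\<in>Basis. f b *\<^sub>R b) \<in> (\<Pi>\<^sub>M b\<in>(Basis::'a::euclidean_space set). std_normal_distribution) \<rightarrow>\<^sub>M borel"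
  by (rule borel_measurable_sum) (auto intro!: borel_measurable_scaleR measurable_component_singleton[THEN measurable_compose] simp: measurable_ident)

lemma sets_std_gaussian [measurable_cong, simp]: "sets std_gaussian = sets borel"
  by (simp add: std_gaussian_def)

lemma space_std_gaussian [simp]: "space std_gaussian = UNIV"
  by (simp add: std_gaussian_def)

lemma prob_space_std_normal_product: "prob_space (\<Pi>\<^sub>M b\<in>(Basis::'a::euclidean_space set). std_normal_distribution)"
proof -
  interpret prob_space std_normal_distribution by (rule prob_space_normal_density) simp
  show ?thesis by (rule prob_space_PiM) unfold_locales
qed

lemma prob_space_std_gaussian: "prob_space (std_gaussian :: 'a::euclidean_space measure)"
  unfolding std_gaussian_def by (rule prob_space.prob_space_distr[OF prob_space_std_normal_product]) measurable

lemma std_gaussian_characteristic_function: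
  fixes y :: "'a::euclidean_space"
  shows "(\<integral>\<xi>. cos (\<xi> \<bullet> y) \<partial>std_gaussian) = exp (- (norm y)\<^sup>2 / 2)"
proof -
  let ?P = "\<Pi>\<^sub>M b\<in>(Basis::'a set). std_normal_distribution"
  interpret N: prob_space std_normal_distribution by (rule prob_space_normal_density) simp
  interpret P: prob_space ?P by (rule prob_space_std_normal_product)
  interpret product_sigma_finite "\<lambda>b::'a. std_normal_distribution" by unfold_locales
  have int: "integrable std_normal_distribution (\<lambda>x. iexp ((y \<bullet> b) * x))" for b
    by (rule N.integrable_const_bound[of _ 1]) auto
  have "(CLINT \<xi>|std_gaussian. iexp (\<xi> \<bullet> y)) = (CLINT f|?P. iexp ((\<Sum>b\<in>Basis. f b *\<^sub>R b) \<bullet> y))"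
    unfolding std_gaussian_def by (subst integral_distr) auto
  also have "\<dots> = (CLINT f|?P. (\<Prod>b\<in>Basis. iexp ((y \<bullet> b) * f b)))"
  proof (rule Bochner_Integration.integral_cong[OF refl])
    fix f
    have "(\<Sum>b\<in>Basis. f b *\<^sub>R b) \<bullet> y = (\<Sum>b\<in>Basis. (y \<bullet> b) * f b)"
      by (simp add: inner_sum_left mult.commute inner_commute[of y])
    then have "iexp ((\<Sum>b\<in>Basis. f b *\<^sub>R b) \<bullet> y) = exp (\<Sum>b\<in>Basis. \<i> * complex_of_real ((y \<bullet> b) * f b))"
      by (simp only: of_real_sum sum_distrib_left)
    also have "\<dots> = (\<Prod>b\<in>Basis. iexp ((y \<bullet> b) * f b))" by (rule exp_sum[OF finite_Basis])
    finally show "iexp ((\<Sum>b\<in>Basis. f b *\<^sub>R b) \<bullet> y) = (\<Prod>b\<in>Basis. iexp ((y \<bullet> b) * f b))" .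
  qed
  also have "\<dots> = (\<Prod>b\<in>Basis. CLINT x|std_normal_distribution. iexp ((y \<bullet> b) * x))"
    by (rule product_integral_prod) (rule finite_Basis, rule int)
  also have "\<dots> = (\<Prod>b\<in>Basis. char std_normal_distribution (y \<bullet> b))"
    by (simp add: char_def)
  also have "\<dots> = (\<Prod>b\<in>Basis. complex_of_real (exp (- (y \<bullet> b)\<^sup>2 / 2)))"
    by (simp add: char_std_normal_distribution)
  also have "\<dots> = complex_of_real (exp (\<Sum>b\<in>Basis. - (y \<bullet> b)\<^sup>2 / 2))"
    by (simp add: exp_sum)
  also have "(\<Sum>b\<in>Basis. - (y \<bullet> b)\<^sup>2 / 2) = - (norm y)\<^sup>2 / 2"
  proof -
    have "(norm y)\<^sup>2 = (\<Sum>b\<in>Basis. (y \<bullet> b)\<^sup>2)"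
      unfolding power2_norm_eq_inner by (subst euclidean_inner) (simp add: power2_eq_square)
    then show ?thesis by (simp add: sum_negf sum_divide_distrib)
  qed
  finally have c: "(CLINT \<xi>|std_gaussian. iexp (\<xi> \<bullet> y)) = complex_of_real (exp (- (norm y)\<^sup>2 / 2))" .
  interpret G: prob_space "std_gaussian :: 'a measure" by (rule prob_space_std_gaussian)
  have "integrable std_gaussian (\<lambda>\<xi>. iexp (\<xi> \<bullet> y))"
    by (rule G.integrable_const_bound[of _ 1]) auto
  then have "(\<integral>\<xi>. Re (iexp (\<xi> \<bullet> y)) \<partial>std_gaussian) = Re (CLINT \<xi>|std_gaussian. iexp (\<xi> \<bullet> y))"
    by (rule integral_Re)
  also have "\<dots> = exp (- (norm y)\<^sup>2 / 2)" unfolding c by simp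
  finally show ?thesis by (simp add: Re_exp)
qed

lemma std_gaussian_integrable_norm_sq: "integrable std_gaussian (\<lambda>\<xi>::'a::euclidean_space. (norm \<xi>)\<^sup>2)"
proof -
  let ?P = "\<Pi>\<^sub>M b\<in>(Basis::'a set). std_normal_distribution"
  interpret N: prob_space std_normal_distribution by (rule prob_space_normal_density) simp
  interpret product_prob_space "\<lambda>b::'a. std_normal_distribution" "Basis :: 'a set" by unfold_locales
  have i1: "integrable std_normal_distribution (\<lambda>x. x\<^sup>2)"
    by (subst integrable_density) (auto intro: integrable_std_normal_moment)
  have "integrable ?P (\<lambda>f. (f b)\<^sup>2)" if "b \<in> Basis" for b
  proof -
    have "distr ?P std_normal_distribution (\<lambda>f. f b) = std_normal_distribution"
      by (rule PiM_component[OF that])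
    then have "integrable (distr ?P std_normal_distribution (\<lambda>f. f b)) (\<lambda>x. x\<^sup>2)" using i1 by simp
    then show ?thesis by (subst (asm) integrable_distr_eq) (use that in auto)
  qed
  then have "integrable ?P (\<lambda>f. \<Sum>b\<in>Basis. (f b)\<^sup>2)" by simp
  moreover have "(norm (\<Sum>b\<in>Basis. f b *\<^sub>R b :: 'a))\<^sup>2 = (\<Sum>b\<in>Basis. (f b)\<^sup>2)" for f
    unfolding power2_norm_eq_inner by (subst euclidean_inner) (simp add: power2_eq_square)
  ultimately show ?thesis unfolding std_gaussian_def
    by (subst integrable_distr_eq) auto
qed

section \<open>The dilation-invariant measure\<close>

lemma nn_integral_lborel_scaleR:
  fixes g :: "'a::euclidean_space \<Rightarrow> ennreal"
  assumes [measurable]: "g \<in> borel_measurable borel" and c: "c > 0"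
  shows "(\<integral>\<^sup>+x. g x \<partial>lborel) = ennreal (c ^ DIM('a)) * (\<integral>\<^sup>+x. g (c *\<^sub>R x) \<partial>lborel)"
  using c by (subst lborel_affine[of c 0]) (simp_all add: nn_integral_density nn_integral_distr nn_integral_cmult)

lemma integral_lborel_scaleR:
  fixes g :: "'a::euclidean_space \<Rightarrow> real"
  assumes [measurable]: "g \<in> borel_measurable borel" and c: "c > 0"
  shows "(\<integral>x. g x \<partial>lborel) = c ^ DIM('a) * (\<integral>x. g (c *\<^sub>R x) \<partial>lborel)"
  using c by (subst lborel_affine[of c 0]) (simp_all add: integral_density integral_distr)

lemma integrable_lborel_scaleR:
  fixes g :: "'a::euclidean_space \<Rightarrow> real"
  assumes [measurable]: "g \<in> borel_measurable borel" and c: "c > 0"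
  shows "integrable lborel g \<longleftrightarrow> integrable lborel (\<lambda>x. g (c *\<^sub>R x))"
  using c by (subst lborel_affine[of c 0]) (simp_all add: integrable_density integrable_distr_eq)

text \<open>The measure \<open>|z|\<^sup>-\<^sup>d dz\<close>. Its mass is infinite near the origin and near infinity.\<close>

definition homogeneous_measure :: "'a::euclidean_space measure" where
  "homogeneous_measure = density lborel (\<lambda>x. ennreal (norm x powr (- real DIM('a))))"

lemma sets_homogeneous_measure [measurable_cong, simp]: "sets homogeneous_measure = sets borel"
  by (simp add: homogeneous_measure_def)

lemma space_homogeneous_measure [simp]: "space homogeneous_measure = UNIV"
  by (simp add: homogeneous_measure_def)

lemma nn_integral_homogeneous_scaleR:
  fixes g :: "'a::euclidean_space \<Rightarrow> ennreal"
  assumes [measurable]: "g \<in> borel_measurable borel" and c: "c > 0"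
  shows "(\<integral>\<^sup>+x. g (c *\<^sub>R x) \<partial>homogeneous_measure) = (\<integral>\<^sup>+x. g x \<partial>homogeneous_measure)"
proof -
  let ?d = "real DIM('a)"
  have e: "norm (c *\<^sub>R x) powr (- ?d) = c powr (- ?d) * norm x powr (- ?d)" for x :: 'a
    using c by (simp add: powr_mult)
  have "c powr (- ?d) * c ^ DIM('a) = 1" using c by (simp add: powr_minus powr_realpow)
  then have 1: "ennreal (c ^ DIM('a)) * ennreal (c powr (- ?d)) = 1"
    using c by (simp add: ennreal_mult[symmetric] mult.commute)
  have "(\<integral>\<^sup>+x. g x \<partial>homogeneous_measure) = (\<integral>\<^sup>+x. ennreal (norm x powr (- ?d)) * g x \<partial>lborel)"
    unfolding homogeneous_measure_def by (simp add: nn_integral_density)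
  also have "\<dots> = ennreal (c ^ DIM('a)) * (\<integral>\<^sup>+x. ennreal (norm (c *\<^sub>R x) powr (- ?d)) * g (c *\<^sub>R x) \<partial>lborel)"
    by (rule nn_integral_lborel_scaleR[OF _ c]) measurable
  also have "\<dots> = ennreal (c ^ DIM('a)) * (ennreal (c powr (- ?d)) * (\<integral>\<^sup>+x. ennreal (norm x powr (- ?d)) * g (c *\<^sub>R x) \<partial>lborel))"
    unfolding e using c by (subst nn_integral_cmult[symmetric]) (auto simp: ennreal_mult mult.assoc)
  also have "\<dots> = (\<integral>\<^sup>+x. g (c *\<^sub>R x) \<partial>homogeneous_measure)"
    unfolding mult.assoc[symmetric] 1 homogeneous_measure_def by (simp add: nn_integral_density)
  finally show ?thesis by simp
qed

lemma distr_homogeneous_scaleR: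
  assumes c: "c > 0"
  shows "distr homogeneous_measure borel (\<lambda>x::'a::euclidean_space. c *\<^sub>R x) = homogeneous_measure"
proof (rule measure_eqI)
  fix A assume "A \<in> sets (distr homogeneous_measure borel (\<lambda>x::'a. c *\<^sub>R x))"
  then have [measurable]: "A \<in> sets borel" by simp
  have "emeasure (distr homogeneous_measure borel (\<lambda>x::'a. c *\<^sub>R x)) A = (\<integral>\<^sup>+x. indicator A x \<partial>distr homogeneous_measure borel (\<lambda>x::'a. c *\<^sub>R x))"
    by simp
  also have "\<dots> = (\<integral>\<^sup>+x. indicator A (c *\<^sub>R x) \<partial>homogeneous_measure)"
    by (rule nn_integral_distr) auto
  also have "\<dots> = (\<integral>\<^sup>+x. indicator A x \<partial>homogeneous_measure)"
    by (rule nn_integral_homogeneous_scaleR[OF _ c]) measurable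
  finally show "emeasure (distr homogeneous_measure borel (\<lambda>x::'a. c *\<^sub>R x)) A = emeasure homogeneous_measure A" by simp
qed simp

lemma integral_homogeneous_scaleR:
  fixes g :: "'a::euclidean_space \<Rightarrow> real"
  assumes [measurable]: "g \<in> borel_measurable borel" and c: "c > 0"
  shows "(\<integral>x. g (c *\<^sub>R x) \<partial>homogeneous_measure) = (\<integral>x. g x \<partial>homogeneous_measure)"
    and "integrable homogeneous_measure (\<lambda>x. g (c *\<^sub>R x)) \<longleftrightarrow> integrable homogeneous_measure g"
proof -
  show "(\<integral>x. g (c *\<^sub>R x) \<partial>homogeneous_measure) = (\<integral>x. g x \<partial>homogeneous_measure)"
    by (subst (2) distr_homogeneous_scaleR[OF c, symmetric]) (simp add: integral_distr)
  show "integrable homogeneous_measure (\<lambda>x. g (c *\<^sub>R x)) \<longleftrightarrow> integrable homogeneous_measure g"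
    by (subst (2) distr_homogeneous_scaleR[OF c, symmetric]) (simp add: integrable_distr_eq)
qed

lemma exists_power_bracket:
  fixes b x :: real assumes b: "1 < b" and x: "1 \<le> x"
  shows "\<exists>j. b ^ j \<le> x \<and> x < b ^ Suc j"
proof -
  obtain n where "x < b ^ n" using real_arch_pow[OF b] by blast
  define m where "m = (LEAST n. x < b ^ n)"
  have m: "x < b ^ m" unfolding m_def by (rule LeastI) fact
  have "m \<noteq> 0" using m x by (intro notI) simp
  then obtain j where j: "m = Suc j" using not0_implies_Suc by blast
  have "\<not> x < b ^ j" using not_less_Least[of j "\<lambda>n. x < b ^ n"] j by (simp add: m_def)
  then show ?thesis using m j by (intro exI[of _ j]) simp
qed

lemma emeasure_homogeneous_annulus_finite:
  "emeasure homogeneous_measure {z::'a::euclidean_space. 1 / 2 < norm z \<and> norm z < 2} < \<infinity>"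
proof -
  let ?A = "{z::'a. 1 / 2 < norm z \<and> norm z < 2}"
  let ?d = "real DIM('a)"
  have [measurable]: "?A \<in> sets borel" by measurable
  have "emeasure homogeneous_measure ?A = (\<integral>\<^sup>+z. ennreal (norm z powr (- ?d)) * indicator ?A z \<partial>lborel)"
    unfolding homogeneous_measure_def by (rule emeasure_density) auto
  also have "\<dots> \<le> (\<integral>\<^sup>+z. ennreal ((1 / 2) powr (- ?d)) * indicator (ball (0::'a) 2) z \<partial>lborel)"
    by (intro nn_integral_mono) (auto simp: indicator_def intro!: ennreal_leI powr_mono2')
  also have "\<dots> < \<infinity>"
    by (subst nn_integral_cmult_indicator) (use emeasure_bounded_finite[OF bounded_ball, of "0::'a" 2] in \<open>auto simp: ennreal_mult_less_top\<close>)
  finally show ?thesis .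
qed

text \<open>The dyadic annuli all have the same mass, so the integral is a geometric series.\<close>

lemma nn_integral_homogeneous_geometric:
  assumes q: "0 \<le> q" "q < 1" and \<sigma>: "\<sigma> > 0"
  shows "(\<integral>\<^sup>+z. (\<Sum>j. ennreal (q ^ j) * indicator {z::'a::euclidean_space. 1 / 2 < norm z \<and> norm z < 2} (\<sigma> ^ j *\<^sub>R z)) \<partial>homogeneous_measure) < \<infinity>"
proof -
  let ?A = "{z::'a. 1 / 2 < norm z \<and> norm z < 2}"
  have [measurable]: "?A \<in> sets borel" by measurable
  have "(\<integral>\<^sup>+z. (\<Sum>j. ennreal (q ^ j) * indicator ?A (\<sigma> ^ j *\<^sub>R z)) \<partial>homogeneous_measure)
      = (\<Sum>j. \<integral>\<^sup>+z. ennreal (q ^ j) * indicator ?A (\<sigma> ^ j *\<^sub>R z) \<partial>homogeneous_measure)"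
    by (rule nn_integral_suminf) measurable
  also have "\<dots> = (\<Sum>j. ennreal (q ^ j) * emeasure homogeneous_measure ?A)"
  proof (rule suminf_cong)
    fix j
    have "(\<integral>\<^sup>+z. ennreal (q ^ j) * indicator ?A (\<sigma> ^ j *\<^sub>R z) \<partial>homogeneous_measure)
      = ennreal (q ^ j) * (\<integral>\<^sup>+z. indicator ?A (\<sigma> ^ j *\<^sub>R z) \<partial>homogeneous_measure)"
      by (rule nn_integral_cmult) measurable
    also have "(\<integral>\<^sup>+z. indicator ?A (\<sigma> ^ j *\<^sub>R z) \<partial>homogeneous_measure) = (\<integral>\<^sup>+z. indicator ?A z \<partial>(homogeneous_measure :: 'a measure))"
      by (rule nn_integral_homogeneous_scaleR) (use \<sigma> in auto)
    finally show "(\<integral>\<^sup>+z. ennreal (q ^ j) * indicator ?A (\<sigma> ^ j *\<^sub>R z) \<partial>homogeneous_measure)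
      = ennreal (q ^ j) * emeasure homogeneous_measure ?A" by simp
  qed
  also have "\<dots> = (\<Sum>j. ennreal (q ^ j)) * emeasure homogeneous_measure ?A"
    by (rule ennreal_suminf_multc)
  also have "(\<Sum>j. ennreal (q ^ j)) = ennreal (\<Sum>j. q ^ j)"
    using q by (intro suminf_ennreal2) (auto simp: summable_geometric_iff)
  also have "ennreal (\<Sum>j. q ^ j) * emeasure homogeneous_measure ?A < \<infinity>"
    using emeasure_homogeneous_annulus_finite[where 'a = 'a] unfolding infinity_ennreal_def ennreal_mult_less_top using ennreal_less_top by blast
  finally show ?thesis .
qed

text \<open>Comparison with two geometric series over dyadic annuli, one towards infinity and one towards the
origin.\<close>

lemma integrable_homogeneous_min_powr:
  assumes a: "0 < a" and b: "0 < b"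
  shows "integrable homogeneous_measure (\<lambda>z::'a::euclidean_space. min (norm z powr a) (norm z powr (- b)))"
proof (rule integrableI_bounded)
  let ?A = "{z::'a. 1 / 2 < norm z \<and> norm z < 2}"
  have [measurable]: "?A \<in> sets borel" by measurable
  define q1 q2 :: real where "q1 = 2 powr (- b)" and "q2 = 2 powr (- a)"
  have q: "0 \<le> q1" "q1 < 1" "0 \<le> q2" "q2 < 1"
    using a b by (auto simp: q1_def q2_def powr_less_one)
  have pw: "(2 powr (- c)) ^ j = (2 ^ j) powr (- c)" for c :: real and j
    by (simp add: powr_power powr_realpow[symmetric] powr_powr mult.commute)
  define F1 where "F1 z = (\<Sum>j. ennreal (q1 ^ j) * indicator ?A ((1 / 2) ^ j *\<^sub>R z))" for z
  define F2 where "F2 z = (\<Sum>j. ennreal (q2 ^ j) * indicator ?A (2 ^ j *\<^sub>R z))" for z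
  have term_le: "g j \<le> suminf g" for g :: "nat \<Rightarrow> ennreal" and j
    using sum_le_suminf[of g "{j}"] by simp
  have term1: "ennreal (q1 ^ j) * indicator ?A ((1 / 2) ^ j *\<^sub>R z) \<le> F1 z" for j z
    unfolding F1_def by (rule term_le)
  have term2: "ennreal (q2 ^ j) * indicator ?A (2 ^ j *\<^sub>R z) \<le> F2 z" for j z
    unfolding F2_def by (rule term_le)
  show "(\<lambda>z::'a. min (norm z powr a) (norm z powr (- b))) \<in> borel_measurable homogeneous_measure" by measurable
  have "(\<integral>\<^sup>+z. ennreal (norm (min (norm z powr a) (norm z powr (- b)))) \<partial>(homogeneous_measure :: 'a measure)) \<le> (\<integral>\<^sup>+z. F1 z + F2 z \<partial>(homogeneous_measure :: 'a measure))"
  proof (rule nn_integral_mono)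
    fix z :: 'a
    have "ennreal (min (norm z powr a) (norm z powr (- b))) \<le> F1 z + F2 z"
    proof (cases "z = 0 \<or> norm z \<ge> 1")
      case True
      show ?thesis
      proof (cases "z = 0")
        case False
        with True have "norm z \<ge> 1" by simp
        then obtain j where j: "2 ^ j \<le> norm z" "norm z < 2 ^ Suc j" using exists_power_bracket[of 2] by auto
        have "(1 / 2) ^ j *\<^sub>R z \<in> ?A" using j by (auto simp: field_simps power_one_over)
        then have "ennreal (q1 ^ j) \<le> F1 z" using term1[of j z] by simp
        moreover have "norm z powr (- b) \<le> q1 ^ j"
          unfolding q1_def pw using j(1) b by (intro powr_mono2') auto
        ultimately have "ennreal (norm z powr (- b)) \<le> F1 z" using ennreal_leI order_trans by blast
        then show ?thesis
          by (meson ennreal_leI min.cobounded2 order_trans add_increasing2 zero_le)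
      qed simp
    next
      case False
      then have z: "0 < norm z" "norm z < 1" by auto
      then have "1 \<le> 1 / norm z" by simp
      then obtain j where j: "2 ^ j \<le> 1 / norm z" "1 / norm z < 2 ^ Suc j" using exists_power_bracket[of 2] by auto
      have "2 ^ j *\<^sub>R z \<in> ?A" using j z by (auto simp: field_simps)
      then have "ennreal (q2 ^ j) \<le> F2 z" using term2[of j z] by simp
      moreover have "norm z powr a \<le> q2 ^ j"
      proof -
        have "norm z \<le> 1 / 2 ^ j" using j z by (simp add: field_simps)
        then have "norm z powr a \<le> (1 / 2 ^ j) powr a" using a by (intro powr_mono2) auto
        then show ?thesis unfolding q2_def pw by (simp add: powr_minus_divide powr_divide)
      qed
      ultimately have "ennreal (norm z powr a) \<le> F2 z" using ennreal_leI order_trans by blast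
      then show ?thesis
        by (meson ennreal_leI min.cobounded1 order_trans add_increasing zero_le)
    qed
    then show "ennreal (norm (min (norm z powr a) (norm z powr (- b)))) \<le> F1 z + F2 z" by simp
  qed
  also have "\<dots> = (\<integral>\<^sup>+z. F1 z \<partial>homogeneous_measure) + (\<integral>\<^sup>+z. F2 z \<partial>(homogeneous_measure :: 'a measure))"
    unfolding F1_def F2_def by (rule nn_integral_add) measurable
  also have "\<dots> < \<infinity>"
    using nn_integral_homogeneous_geometric[OF q(1,2), of "1/2", where 'a = 'a] nn_integral_homogeneous_geometric[OF q(3,4), of 2, where 'a = 'a]
    unfolding F1_def F2_def by simp
  finally show "(\<integral>\<^sup>+z. ennreal (norm (min (norm z powr a) (norm z powr (- b)))) \<partial>(homogeneous_measure :: 'a measure)) < \<infinity>" .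
qed

section \<open>A Tauberian theorem for radially decreasing densities\<close>

text \<open>Weierstrass approximation on the unit interval. The term \<open>\<beta> h(1)\<close> is the contribution of mass that
concentrates at \<open>w = 1\<close> in the limit.\<close>

lemma continuous_test_function_convergence:
  fixes M :: "'a measure" and q w :: "nat \<Rightarrow> 'a \<Rightarrow> real"
  assumes q: "\<And>n. integrable M (q n)" "\<And>n y. 0 \<le> q n y"
    and w: "\<And>n. w n \<in> borel_measurable M" "\<And>n y. w n y \<in> {0..1}"
    and q0: "integrable M q0" "\<And>y. 0 \<le> q0 y"
    and w0: "w0 \<in> borel_measurable M" "\<And>y. w0 y \<in> {0..1}"
    and lim: "\<And>k::nat. (\<lambda>n. \<integral>y. q n y * w n y ^ k \<partial>M) \<longlonglongrightarrow> (\<integral>y. q0 y * w0 y ^ k \<partial>M) + \<beta>"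
    and h: "continuous_on UNIV (h :: real \<Rightarrow> real)"
  shows "(\<lambda>n. \<integral>y. q n y * h (w n y) \<partial>M) \<longlonglongrightarrow> (\<integral>y. q0 y * h (w0 y) \<partial>M) + \<beta> * h 1"
proof -
  have intg: "integrable M (\<lambda>y. Q y * g (W y))"
    if Q: "integrable M Q" and W: "W \<in> borel_measurable M" "\<And>y. W y \<in> {0..1}" and g: "continuous_on UNIV g"
    for Q W :: "'a \<Rightarrow> real" and g :: "real \<Rightarrow> real"
  proof -
    have "bounded (g ` {0..1})"
      by (intro compact_imp_bounded compact_continuous_image continuous_on_subset[OF g]) auto
    then obtain C where C': "\<forall>x\<in>g ` {0..1}. norm x \<le> C" unfolding bounded_iff by blast
    have C: "\<bar>g x\<bar> \<le> C" if "x \<in> {0..1}" for x using C' that by (metis imageI real_norm_def)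
    have [measurable]: "g \<in> borel_measurable borel" "W \<in> borel_measurable M" "Q \<in> borel_measurable M"
      using borel_measurable_continuous_onI[OF g] W Q by auto
    show ?thesis
    proof (rule Bochner_Integration.integrable_bound)
      show "integrable M (\<lambda>y. C * Q y)" using Q by simp
      show "AE y in M. norm (Q y * g (W y)) \<le> norm (C * Q y)"
      proof (rule AE_I2)
        fix y
        have "\<bar>g (W y)\<bar> \<le> \<bar>C\<bar>" using C[OF W(2)[of y]] by linarith
        then have "\<bar>Q y\<bar> * \<bar>g (W y)\<bar> \<le> \<bar>Q y\<bar> * \<bar>C\<bar>" by (rule mult_left_mono) simp
        then show "norm (Q y * g (W y)) \<le> norm (C * Q y)" by (simp add: abs_mult mult.commute)
      qed
    qed measurable
  qed
  have poly_lim: "(\<lambda>n. \<integral>y. q n y * g (w n y) \<partial>M) \<longlonglongrightarrow> (\<integral>y. q0 y * g (w0 y) \<partial>M) + \<beta> * g 1"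
    if g: "g = (\<lambda>x. \<Sum>i\<le>m. a i * x ^ i)" for g and a :: "nat \<Rightarrow> real" and m
  proof -
    have ip: "integrable M (\<lambda>y. Q y * W y ^ i)"
      if "integrable M Q" "W \<in> borel_measurable M" "\<And>y. W y \<in> {0..1}" for Q W :: "'a \<Rightarrow> real" and i
      by (rule intg[where g = "\<lambda>x. x ^ i"]) (use that in \<open>auto intro!: continuous_intros\<close>)
    have e: "(\<integral>y. Q y * g (W y) \<partial>M) = (\<Sum>i\<le>m. a i * (\<integral>y. Q y * W y ^ i \<partial>M))"
      if "integrable M Q" "W \<in> borel_measurable M" "\<And>y. W y \<in> {0..1}" for Q W :: "'a \<Rightarrow> real"
    proof -
      have "(\<integral>y. Q y * g (W y) \<partial>M) = (\<integral>y. (\<Sum>i\<le>m. a i * (Q y * W y ^ i)) \<partial>M)"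
        unfolding g by (simp add: sum_distrib_left mult.left_commute)
      also have "\<dots> = (\<Sum>i\<le>m. \<integral>y. a i * (Q y * W y ^ i) \<partial>M)"
        by (rule Bochner_Integration.integral_sum) (use ip[OF that] in simp)
      finally show ?thesis by simp
    qed
    have "(\<lambda>n. \<Sum>i\<le>m. a i * (\<integral>y. q n y * w n y ^ i \<partial>M)) \<longlonglongrightarrow> (\<Sum>i\<le>m. a i * ((\<integral>y. q0 y * w0 y ^ i \<partial>M) + \<beta>))"
      by (intro tendsto_sum tendsto_mult tendsto_const lim)
    then show ?thesis using e[OF q(1) w] e[OF q0(1) w0]
      by (simp add: g distrib_left sum.distrib sum_distrib_left mult.commute)
  qed
  show ?thesis
  proof (rule metric_LIMSEQ_I)
    fix \<epsilon> :: real assume eps: "\<epsilon> > 0"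
    define K where "K = (\<integral>y. q0 y \<partial>M) + \<bar>\<beta>\<bar> + 1"
    have I0: "0 \<le> (\<integral>y. q0 y \<partial>M)" using q0 by simp
    then have K: "K > 0" by (simp add: K_def)
    define \<delta> where "\<delta> = \<epsilon> / (4 * K)"
    have d: "\<delta> > 0" using K eps by (simp add: \<delta>_def)
    obtain g where g: "real_polynomial_function g" "\<And>x. x \<in> {0..1} \<Longrightarrow> \<bar>h x - g x\<bar> < \<delta>"
      using Stone_Weierstrass_real_polynomial_function[of "{0..1::real}" h, OF _ _ d] continuous_on_subset[OF h] by auto
    obtain a m where gp: "g = (\<lambda>x. \<Sum>i\<le>m. a i * x ^ i)"
      using g(1) unfolding real_polynomial_function_iff_sum by blast
    have gc: "continuous_on UNIV g" unfolding gp by (intro continuous_intros)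
    have close: "\<bar>(\<integral>y. Q y * h (W y) \<partial>M) - (\<integral>y. Q y * g (W y) \<partial>M)\<bar> \<le> \<delta> * (\<integral>y. Q y \<partial>M)"
      if Q: "integrable M Q" "\<And>y. 0 \<le> Q y" and W: "W \<in> borel_measurable M" "\<And>y. W y \<in> {0..1}" for Q W :: "'a \<Rightarrow> real"
    proof -
      note i = intg[OF Q(1) W h] intg[OF Q(1) W gc]
      have "(\<integral>y. Q y * h (W y) \<partial>M) - (\<integral>y. Q y * g (W y) \<partial>M) = (\<integral>y. Q y * h (W y) - Q y * g (W y) \<partial>M)"
        using i by simp
      also have "\<bar>\<dots>\<bar> \<le> (\<integral>y. \<bar>Q y * h (W y) - Q y * g (W y)\<bar> \<partial>M)" by (rule integral_abs_bound)
      also have "\<dots> \<le> (\<integral>y. \<delta> * Q y \<partial>M)"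
      proof (rule integral_mono)
        fix y
        have "\<bar>Q y * h (W y) - Q y * g (W y)\<bar> = Q y * \<bar>h (W y) - g (W y)\<bar>"
          using Q(2)[of y] by (simp add: right_diff_distrib[symmetric] abs_mult)
        also have "\<dots> \<le> Q y * \<delta>" using g(2)[OF W(2)[of y]] Q(2)[of y] by (intro mult_left_mono) auto
        finally show "\<bar>Q y * h (W y) - Q y * g (W y)\<bar> \<le> \<delta> * Q y" by (simp add: mult.commute)
      qed (use i Q in auto)
      finally show ?thesis by simp
    qed
    have l0: "(\<lambda>n. \<integral>y. q n y \<partial>M) \<longlonglongrightarrow> (\<integral>y. q0 y \<partial>M) + \<beta>" using lim[of 0] by simp
    have "(\<integral>y. q0 y \<partial>M) + \<beta> < K" by (simp add: K_def)
    then have "eventually (\<lambda>n. (\<integral>y. q n y \<partial>M) < K) sequentially" by (rule order_tendstoD(2)[OF l0])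
    moreover have "eventually (\<lambda>n. dist (\<integral>y. q n y * g (w n y) \<partial>M) ((\<integral>y. q0 y * g (w0 y) \<partial>M) + \<beta> * g 1) < \<epsilon> / 4) sequentially"
      by (rule tendstoD[OF poly_lim[OF gp]]) (use eps in simp)
    ultimately have "eventually (\<lambda>n. dist (\<integral>y. q n y * h (w n y) \<partial>M) ((\<integral>y. q0 y * h (w0 y) \<partial>M) + \<beta> * h 1) < \<epsilon>) sequentially"
    proof eventually_elim
      case (elim n)
      have dK: "\<delta> * K = \<epsilon> / 4" using K by (simp add: \<delta>_def)
      have "\<delta> * (\<integral>y. q n y \<partial>M) \<le> \<delta> * K" using elim(1) d by (intro mult_left_mono) auto
      then have 1: "\<bar>(\<integral>y. q n y * h (w n y) \<partial>M) - (\<integral>y. q n y * g (w n y) \<partial>M)\<bar> \<le> \<epsilon> / 4"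
        using close[of "q n" "w n", OF q w] dK by simp
      have "\<bar>\<beta> * h 1 - \<beta> * g 1\<bar> = \<bar>\<beta>\<bar> * \<bar>h 1 - g 1\<bar>" by (simp add: right_diff_distrib[symmetric] abs_mult)
      also have "\<dots> \<le> \<bar>\<beta>\<bar> * \<delta>" using g(2)[of 1] by (intro mult_left_mono) auto
      finally have "\<bar>\<beta> * h 1 - \<beta> * g 1\<bar> \<le> \<delta> * \<bar>\<beta>\<bar>" by (simp add: mult.commute)
      moreover have "\<bar>(\<integral>y. q0 y * h (w0 y) \<partial>M) - (\<integral>y. q0 y * g (w0 y) \<partial>M)\<bar> \<le> \<delta> * (\<integral>y. q0 y \<partial>M)"
        by (rule close[OF q0 w0])
      moreover have "\<delta> * (\<integral>y. q0 y \<partial>M) + \<delta> * \<bar>\<beta>\<bar> \<le> \<epsilon> / 4"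
        unfolding dK[symmetric] distrib_left[symmetric] using d by (intro mult_left_mono) (auto simp: K_def)
      ultimately have 2: "\<bar>((\<integral>y. q0 y * h (w0 y) \<partial>M) + \<beta> * h 1) - ((\<integral>y. q0 y * g (w0 y) \<partial>M) + \<beta> * g 1)\<bar> \<le> \<epsilon> / 4"
        by linarith
      show ?case using 1 2 elim(2) eps unfolding dist_real_def by linarith
    qed
    then show "\<exists>no. \<forall>n\<ge>no. dist (\<integral>y. q n y * h (w n y) \<partial>M) ((\<integral>y. q0 y * h (w0 y) \<partial>M) + \<beta> * h 1) < \<epsilon>"
      by (simp add: eventually_sequentially)
  qed
qed

lemma integral_pos_if_pos_on_open:
  fixes g :: "'a::euclidean_space \<Rightarrow> real"
  assumes int: "integrable lborel g" and nn: "\<And>y. 0 \<le> g y" and U: "open U" "U \<noteq> {}" "\<And>y. y \<in> U \<Longrightarrow> 0 < g y"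
  shows "0 < (\<integral>y. g y \<partial>lborel)"
proof (rule ccontr)
  assume "\<not> ?thesis"
  then have "(\<integral>y. g y \<partial>lborel) = 0" using Bochner_Integration.integral_nonneg[of lborel g] nn by (simp add: not_less order_antisym)
  then have "AE y in lborel. g y = 0" using integral_nonneg_eq_0_iff_AE[OF int] nn by simp
  then have "AE y in lborel. y \<notin> U"
  proof eventually_elim
    case (elim y) then show ?case using U(3)[of y] by auto
  qed
  then have "U \<in> null_sets lborel"
    using U(1) by (subst AE_iff_null_sets) (auto intro: borel_open)
  then have "U \<in> null_sets lebesgue" by (rule null_sets_completionI)
  then show False using open_not_negligible[OF U(1,2)] by (simp add: negligible_iff_null_sets)
qed

text \<open>The Tauberian theorem: Laplace transforms in \<open>|y|\<^sup>2\<close> determine the limit of radially nonincreasing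
densities. The functions \<open>\<phi>\<^sub>n\<close> are viewed at scale \<open>r\<^sub>n\<close> with weight \<open>b\<^sub>n\<close>. The weight \<open>1 - exp(-|y|\<^sup>2)\<close>
makes measures with infinite mass at the origin finite, and \<open>\<beta>\<close> accounts for mass which collapses to the
origin; this mass is invisible to test functions supported in an annulus.\<close>

context
  fixes \<phi> :: "nat \<Rightarrow> 'a::euclidean_space \<Rightarrow> real" and f :: "'a \<Rightarrow> real" and b r :: "nat \<Rightarrow> real" and \<beta> :: real
  assumes \<phi>_measurable [measurable]: "\<And>n. \<phi> n \<in> borel_measurable borel"
    and \<phi>_nonneg: "\<And>n y. y \<noteq> 0 \<Longrightarrow> 0 \<le> \<phi> n y"
    and \<phi>_antimono: "\<And>n x y. x \<noteq> 0 \<Longrightarrow> norm x \<le> norm y \<Longrightarrow> \<phi> n y \<le> \<phi> n x"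
    and f_measurable [measurable]: "f \<in> borel_measurable borel"
    and f_nonneg: "\<And>y. y \<noteq> 0 \<Longrightarrow> 0 \<le> f y"
    and f_antimono: "\<And>x y. x \<noteq> 0 \<Longrightarrow> norm x \<le> norm y \<Longrightarrow> f y \<le> f x"
    and r_pos: "\<And>n. 0 < r n" and b_nonneg: "\<And>n. 0 \<le> b n"
    and \<phi>_integrable: "\<And>n. integrable lborel (\<lambda>y. (1 - exp (- (norm (y /\<^sub>R r n))\<^sup>2)) * \<phi> n y)"
    and f_integrable: "integrable lborel (\<lambda>y. (1 - exp (- (norm y)\<^sup>2)) * f y)"
    and laplace: "\<And>k::nat. k > 0 \<Longrightarrow>
      (\<lambda>n. b n * (\<integral>y. (1 - exp (- (real k * (norm (y /\<^sub>R r n))\<^sup>2))) * \<phi> n y \<partial>lborel))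
        \<longlonglongrightarrow> (\<integral>y. (1 - exp (- (real k * (norm y)\<^sup>2))) * f y \<partial>lborel) + \<beta> * real k"
begin

private definition W :: "'a \<Rightarrow> real" where "W y = exp (- (norm y)\<^sup>2)"

private lemma W_range: "W y \<in> {0..1}" "0 < W y" by (auto simp: W_def)
private lemma W_measurable [measurable]: "W \<in> borel_measurable borel" unfolding W_def by measurable
private lemma W_power: "W y ^ k = exp (- (real k * (norm y)\<^sup>2))"
  by (simp add: W_def exp_of_nat_mult[symmetric])

text \<open>Moments with respect to the weight \<open>1 - W\<close> are differences of consecutive Laplace transforms.\<close>

private lemma laplace_differences:
  assumes g0: "\<And>y::'a. y \<noteq> 0 \<Longrightarrow> 0 \<le> g y" and [measurable]: "g \<in> borel_measurable borel"
    and int: "integrable lborel (\<lambda>y. (1 - W (c *\<^sub>R y)) * g y)"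
  shows "integrable lborel (\<lambda>y. (1 - W (c *\<^sub>R y) ^ k) * g y)"
    and "(\<integral>y. (1 - W (c *\<^sub>R y)) * g y * W (c *\<^sub>R y) ^ k \<partial>lborel)
     = (\<integral>y. (1 - W (c *\<^sub>R y) ^ Suc k) * g y \<partial>lborel) - (\<integral>y. (1 - W (c *\<^sub>R y) ^ k) * g y \<partial>lborel)"
proof -
  show i: "integrable lborel (\<lambda>y. (1 - W (c *\<^sub>R y) ^ k) * g y)" for k
  proof (rule Bochner_Integration.integrable_bound)
    show "integrable lborel (\<lambda>y. real k * ((1 - W (c *\<^sub>R y)) * g y))" using int by simp
    show "AE y in lborel. norm ((1 - W (c *\<^sub>R y) ^ k) * g y) \<le> norm (real k * ((1 - W (c *\<^sub>R y)) * g y))"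
      using AE_lborel_singleton[of 0]
    proof eventually_elim
      case (elim y)
      let ?w = "W (c *\<^sub>R y)"
      have w: "0 \<le> ?w" "?w \<le> 1" using W_range(1)[of "c *\<^sub>R y"] by auto
      have "1 + real k * (?w - 1) \<le> (1 + (?w - 1)) ^ k" by (rule Bernoulli_inequality) (use w in simp)
      then have "1 - ?w ^ k \<le> real k * (1 - ?w)" by (simp add: algebra_simps)
      moreover have "0 \<le> 1 - ?w ^ k" using w by (simp add: power_le_one)
      ultimately have "(1 - ?w ^ k) * g y \<le> real k * (1 - ?w) * g y" "0 \<le> (1 - ?w ^ k) * g y"
        using g0[OF elim] by (auto intro: mult_right_mono)
      then show ?case using w g0[OF elim] by (simp add: mult.assoc)
    qed
  qed measurable
  have "(\<integral>y. (1 - W (c *\<^sub>R y) ^ Suc k) * g y \<partial>lborel) - (\<integral>y. (1 - W (c *\<^sub>R y) ^ k) * g y \<partial>lborel)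
    = (\<integral>y. (1 - W (c *\<^sub>R y) ^ Suc k) * g y - (1 - W (c *\<^sub>R y) ^ k) * g y \<partial>lborel)"
    by (rule Bochner_Integration.integral_diff[OF i i, symmetric])
  also have "\<dots> = (\<integral>y. (1 - W (c *\<^sub>R y)) * g y * W (c *\<^sub>R y) ^ k \<partial>lborel)"
    by (rule Bochner_Integration.integral_cong[OF refl]) (simp add: algebra_simps)
  finally show "(\<integral>y. (1 - W (c *\<^sub>R y)) * g y * W (c *\<^sub>R y) ^ k \<partial>lborel)
     = (\<integral>y. (1 - W (c *\<^sub>R y) ^ Suc k) * g y \<partial>lborel) - (\<integral>y. (1 - W (c *\<^sub>R y) ^ k) * g y \<partial>lborel)" by simp
qed

private lemma test_function_convergence:
  assumes h: "continuous_on UNIV (h :: real \<Rightarrow> real)"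
  shows "(\<lambda>n. b n * (\<integral>y. (1 - W (y /\<^sub>R r n)) * h (W (y /\<^sub>R r n)) * \<phi> n y \<partial>lborel))
     \<longlonglongrightarrow> (\<integral>y. (1 - W y) * h (W y) * f y \<partial>lborel) + \<beta> * h 1"
proof -
  \<comment> \<open>Signs at the origin are unknown, but the weight vanishes there.\<close>
  define \<phi>' where "\<phi>' n y = (if y = 0 then 0 else \<phi> n y)" for n y
  define f' where "f' y = (if y = 0 then 0 else f y)" for y
  have W0: "W 0 = 1" by (simp add: W_def)
  have e\<phi>: "(1 - W (y /\<^sub>R r n)) * z * \<phi> n y = (1 - W (y /\<^sub>R r n)) * z * \<phi>' n y" for n y z
    by (simp add: \<phi>'_def W0)
  have ef: "(1 - W y) * z * f y = (1 - W y) * z * f' y" for y z by (simp add: f'_def W0)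
  have L: "(\<lambda>n. b n * (\<integral>y. (1 - W (y /\<^sub>R r n) ^ k) * \<phi> n y \<partial>lborel))
        \<longlonglongrightarrow> (\<integral>y. (1 - W y ^ k) * f y \<partial>lborel) + \<beta> * real k" for k
    using laplace[of k] by (cases "k = 0") (auto simp: W_power)
  have i\<phi>: "integrable lborel (\<lambda>y. (1 - W (inverse (r n) *\<^sub>R y)) * \<phi> n y)" for n
    using \<phi>_integrable[of n] by (simp add: W_def)
  have i_f: "integrable lborel (\<lambda>y. (1 - W (1 *\<^sub>R y)) * f y)"
    using f_integrable by (simp add: W_def)
  have d1: "(\<integral>y. (1 - W (y /\<^sub>R r n)) * \<phi> n y * W (y /\<^sub>R r n) ^ k \<partial>lborel)
     = (\<integral>y. (1 - W (y /\<^sub>R r n) ^ Suc k) * \<phi> n y \<partial>lborel) - (\<integral>y. (1 - W (y /\<^sub>R r n) ^ k) * \<phi> n y \<partial>lborel)" for n k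
    by (rule laplace_differences(2)[OF \<phi>_nonneg \<phi>_measurable i\<phi>])
  have d2: "(\<integral>y. (1 - W y) * f y * W y ^ k \<partial>lborel)
     = (\<integral>y. (1 - W y ^ Suc k) * f y \<partial>lborel) - (\<integral>y. (1 - W y ^ k) * f y \<partial>lborel)" for k
    using laplace_differences(2)[OF f_nonneg f_measurable i_f, of k] by simp
  have "(\<lambda>n. \<integral>y. (b n * ((1 - W (y /\<^sub>R r n)) * \<phi>' n y)) * h (W (y /\<^sub>R r n)) \<partial>lborel)
     \<longlonglongrightarrow> (\<integral>y. ((1 - W y) * f' y) * h (W y) \<partial>lborel) + \<beta> * h 1"
  proof (rule continuous_test_function_convergence[OF _ _ _ _ _ _ _ _ _ h])
    show "integrable lborel (\<lambda>y. b n * ((1 - W (y /\<^sub>R r n)) * \<phi>' n y))" for n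
    proof -
      have "integrable lborel (\<lambda>y. (1 - W (y /\<^sub>R r n)) * \<phi>' n y)"
        using i\<phi>[of n] by (simp only: e\<phi>[of n _ 1, unfolded mult_1_right])
      then show ?thesis by simp
    qed
    show "0 \<le> b n * ((1 - W (y /\<^sub>R r n)) * \<phi>' n y)" for n y
      using b_nonneg[of n] \<phi>_nonneg[of y n] W_range(1)[of "y /\<^sub>R r n"] by (auto simp: \<phi>'_def)
    show "integrable lborel (\<lambda>y. (1 - W y) * f' y)" 
      using f_integrable unfolding W_def[symmetric] ef[of _ 1, unfolded mult_1_right] .
    show "0 \<le> (1 - W y) * f' y" for y
      using f_nonneg[of y] W_range(1)[of y] by (auto simp: f'_def)
    fix k
    have eq: "(\<integral>y. (b n * ((1 - W (y /\<^sub>R r n)) * \<phi>' n y)) * W (y /\<^sub>R r n) ^ k \<partial>lborel) =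
      b n * (\<integral>y. (1 - W (y /\<^sub>R r n) ^ Suc k) * \<phi> n y \<partial>lborel) - b n * (\<integral>y. (1 - W (y /\<^sub>R r n) ^ k) * \<phi> n y \<partial>lborel)" for n
    proof -
      have "(\<integral>y. (b n * ((1 - W (y /\<^sub>R r n)) * \<phi>' n y)) * W (y /\<^sub>R r n) ^ k \<partial>lborel)
        = (\<integral>y. b n * ((1 - W (y /\<^sub>R r n)) * \<phi> n y * W (y /\<^sub>R r n) ^ k) \<partial>lborel)"
        by (rule Bochner_Integration.integral_cong[OF refl]) (simp only: e\<phi>[of n _ 1, unfolded mult_1_right] mult.assoc)
      then show ?thesis using d1[of n k] by (simp add: right_diff_distrib)
    qed
    have eq0: "(\<integral>y. (1 - W y) * f' y * W y ^ k \<partial>lborel) = (\<integral>y. (1 - W y ^ Suc k) * f y \<partial>lborel) - (\<integral>y. (1 - W y ^ k) * f y \<partial>lborel)"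
      using d2[of k] unfolding ef[of _ 1, unfolded mult_1_right] .
    show "(\<lambda>n. \<integral>y. (b n * ((1 - W (y /\<^sub>R r n)) * \<phi>' n y)) * W (y /\<^sub>R r n) ^ k \<partial>lborel)
      \<longlonglongrightarrow> (\<integral>y. (1 - W y) * f' y * W y ^ k \<partial>lborel) + \<beta>"
      unfolding eq eq0 using tendsto_diff[OF L[of "Suc k"] L[of k]] by (simp add: algebra_simps)
  qed (use W_range in auto)
  moreover have "(\<integral>y. (b n * ((1 - W (y /\<^sub>R r n)) * \<phi>' n y)) * h (W (y /\<^sub>R r n)) \<partial>lborel) =
     b n * (\<integral>y. (1 - W (y /\<^sub>R r n)) * h (W (y /\<^sub>R r n)) * \<phi> n y \<partial>lborel)" for n
    unfolding e\<phi> by (subst integral_mult_right_zero[symmetric]) (simp add: mult_ac)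
  moreover have "(\<integral>y. ((1 - W y) * f' y) * h (W y) \<partial>lborel) = (\<integral>y. (1 - W y) * h (W y) * f y \<partial>lborel)"
    unfolding ef by (simp add: mult_ac)
  ultimately show ?thesis by simp
qed

text \<open>In the variable \<open>W\<close> the annulus is an interval that avoids 1, and \<open>h\<close> is a truncated parabola over it.\<close>

private lemma annular_test_function:
  assumes "0 \<le> s" "s < S"
  obtains h where "continuous_on UNIV (h :: real \<Rightarrow> real)" "h 1 = 0" "\<And>w. 0 \<le> h w" "\<forall>w\<in>{0..1}. h w \<le> 1"
    "\<And>y. 0 \<le> (1 - W y) * h (W y)"
    "\<And>y. 0 < (1 - W y) * h (W y) \<longleftrightarrow> s < norm y \<and> norm y < S"
    "integrable lborel (\<lambda>y. (1 - W y) * h (W y))" "0 < (\<integral>y. (1 - W y) * h (W y) \<partial>lborel)"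
proof -
  define h where "h w = max 0 ((w - exp (- S\<^sup>2)) * (exp (- s\<^sup>2) - w))" for w :: real
  let ?g = "\<lambda>y. (1 - W y) * h (W y)"
  have cont: "continuous_on UNIV h" unfolding h_def by (intro continuous_intros)
  have h1: "h 1 = 0"
    unfolding h_def by (auto intro!: max_absorb1 mult_nonneg_nonpos)
  have S: "0 < S" using assms by simp
  have hpos: "0 < h (W y) \<longleftrightarrow> s < norm y \<and> norm y < S" for y
  proof -
    have a: "exp (- S\<^sup>2) < W y \<longleftrightarrow> norm y < S"
      using S power_mono_iff[of S "norm y" 2] by (simp add: W_def not_le[symmetric])
    have b: "W y < exp (- s\<^sup>2) \<longleftrightarrow> s < norm y"
      using assms(1) power_mono_iff[of "norm y" s 2] by (simp add: W_def not_le[symmetric])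
    have lt: "exp (- S\<^sup>2) < exp (- s\<^sup>2)" using assms by (simp add: power_strict_mono)
    have "0 < h (W y) \<longleftrightarrow> 0 < (W y - exp (- S\<^sup>2)) * (exp (- s\<^sup>2) - W y)" by (auto simp: h_def)
    also have "\<dots> \<longleftrightarrow> exp (- S\<^sup>2) < W y \<and> W y < exp (- s\<^sup>2)"
      using lt unfolding zero_less_mult_iff by linarith
    finally show ?thesis using a b by blast
  qed
  have hnn: "0 \<le> h w" for w by (simp add: h_def)
  have nn: "0 \<le> ?g y" for y using W_range(1)[of y] hnn by simp
  have pos: "0 < ?g y \<longleftrightarrow> s < norm y \<and> norm y < S" for y
  proof -
    have "W y < 1" if "s < norm y" using that assms(1) by (auto simp: W_def)
    then show ?thesis using hpos[of y] hnn[of "W y"] W_range(1)[of y] by (auto simp: zero_less_mult_iff)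
  qed
  have hb: "h w \<le> 1" if "w \<in> {0..1}" for w
  proof -
    have "(w - exp (- S\<^sup>2)) * (exp (- s\<^sup>2) - w) \<le> \<bar>w - exp (- S\<^sup>2)\<bar> * \<bar>exp (- s\<^sup>2) - w\<bar>"
      by (metis abs_ge_self abs_mult)
    also have "\<dots> \<le> 1 * 1"
    proof (rule mult_mono)
      have "0 < exp (- S\<^sup>2)" "exp (- S\<^sup>2) \<le> 1" "0 < exp (- s\<^sup>2)" "exp (- s\<^sup>2) \<le> 1" by auto
      moreover have "0 \<le> w" "w \<le> 1" using that by auto
      ultimately show "\<bar>w - exp (- S\<^sup>2)\<bar> \<le> 1" "\<bar>exp (- s\<^sup>2) - w\<bar> \<le> 1" unfolding abs_le_iff by linarith+
    qed auto
    finally show ?thesis by (simp add: h_def)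
  qed
  have [measurable]: "h \<in> borel_measurable borel" by (rule borel_measurable_continuous_onI[OF cont])
  have int: "integrable lborel ?g"
  proof (rule Bochner_Integration.integrable_bound)
    show "integrable lborel (indicator (ball (0::'a) S) :: 'a \<Rightarrow> real)"
      by (subst integrable_indicator_iff) (use emeasure_bounded_finite[OF bounded_ball, of "0::'a" S] in auto)
    show "AE y in lborel. norm (?g y) \<le> norm (indicator (ball (0::'a) S) y :: real)"
    proof (rule AE_I2)
      fix y :: 'a
      have "?g y \<le> 1 * 1" using W_range(1)[of y] hb[of "W y"] hnn by (intro mult_mono) auto
      moreover have "?g y = 0" if "\<not> norm y < S" using that pos[of y] nn[of y] by linarith
      ultimately show "norm (?g y) \<le> norm (indicator (ball (0::'a) S) y :: real)"
        using nn[of y] by (auto simp: indicator_def)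
    qed
  qed measurable
  have "0 < (\<integral>y. ?g y \<partial>lborel)"
  proof (rule integral_pos_if_pos_on_open[OF int nn])
    let ?U = "{y::'a. s < norm y \<and> norm y < S}"
    show "open ?U" by (intro open_Collect_conj open_Collect_less continuous_intros)
    obtain e :: 'a where e: "norm e = 1" using vector_choose_size[of 1] by auto
    have "((s + S) / 2) *\<^sub>R e \<in> ?U" using assms e by simp
    then show "?U \<noteq> {}" by blast
    show "0 < ?g y" if "y \<in> ?U" for y using that pos[of y] by simp
  qed
  with that[OF cont h1 hnn ballI[OF hb] nn pos int] show ?thesis by blast
qed

private lemma integrable_test_function:
  assumes [measurable]: "h \<in> borel_measurable borel" "g \<in> borel_measurable borel"
    and h: "\<And>w. 0 \<le> h w" "\<forall>w\<in>{0..1}. h w \<le> (1::real)"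
    and int: "integrable lborel (\<lambda>y. (1 - W (c *\<^sub>R y)) * g y)"
  shows "integrable lborel (\<lambda>y. (1 - W (c *\<^sub>R y)) * h (W (c *\<^sub>R y)) * g y)"
proof (rule Bochner_Integration.integrable_bound[OF int])
  show "AE y in lborel. norm ((1 - W (c *\<^sub>R y)) * h (W (c *\<^sub>R y)) * g y) \<le> norm ((1 - W (c *\<^sub>R y)) * g y)"
  proof (rule AE_I2)
    fix y
    have "\<bar>h (W (c *\<^sub>R y))\<bar> * \<bar>(1 - W (c *\<^sub>R y)) * g y\<bar> \<le> 1 * \<bar>(1 - W (c *\<^sub>R y)) * g y\<bar>"
      using h(1)[of "W (c *\<^sub>R y)"] bspec[OF h(2) W_range(1)[of "c *\<^sub>R y"]] by (intro mult_right_mono) auto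
    then show "norm ((1 - W (c *\<^sub>R y)) * h (W (c *\<^sub>R y)) * g y) \<le> norm ((1 - W (c *\<^sub>R y)) * g y)"
      by (simp add: abs_mult mult_ac)
  qed
qed measurable

text \<open>Bounds for the density on the support of the test function become bounds for the integrals; the factor
\<open>r\<^sub>n\<^sup>d\<close> comes from dilating Lebesgue measure.\<close>

private lemma density_bounds_by_test_function:
  assumes h: "continuous_on UNIV (h :: real \<Rightarrow> real)" "h 1 = 0" "\<And>w. 0 \<le> h w" "\<forall>w\<in>{0..1}. h w \<le> 1"
    and nn: "\<And>y. 0 \<le> (1 - W y) * h (W y)"
    and int: "integrable lborel (\<lambda>y. (1 - W y) * h (W y))"
  shows "(\<lambda>n. b n * (\<integral>y. (1 - W (y /\<^sub>R r n)) * h (W (y /\<^sub>R r n)) * \<phi> n y \<partial>lborel)) \<longlonglongrightarrow> (\<integral>y. (1 - W y) * h (W y) * f y \<partial>lborel)"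
    and "(\<And>y. 0 < (1 - W y) * h (W y) \<Longrightarrow> \<phi> n (r n *\<^sub>R y) \<le> m) \<Longrightarrow>
      b n * (\<integral>y. (1 - W (y /\<^sub>R r n)) * h (W (y /\<^sub>R r n)) * \<phi> n y \<partial>lborel) \<le> b n * r n ^ DIM('a) * m * (\<integral>y. (1 - W y) * h (W y) \<partial>lborel)"
    and "(\<And>y. 0 < (1 - W y) * h (W y) \<Longrightarrow> m \<le> \<phi> n (r n *\<^sub>R y)) \<Longrightarrow>
      b n * r n ^ DIM('a) * m * (\<integral>y. (1 - W y) * h (W y) \<partial>lborel) \<le> b n * (\<integral>y. (1 - W (y /\<^sub>R r n)) * h (W (y /\<^sub>R r n)) * \<phi> n y \<partial>lborel)"
    and "(\<And>y. 0 < (1 - W y) * h (W y) \<Longrightarrow> f y \<le> m) \<Longrightarrow>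
      (\<integral>y. (1 - W y) * h (W y) * f y \<partial>lborel) \<le> m * (\<integral>y. (1 - W y) * h (W y) \<partial>lborel)"
    and "(\<And>y. 0 < (1 - W y) * h (W y) \<Longrightarrow> m \<le> f y) \<Longrightarrow>
      m * (\<integral>y. (1 - W y) * h (W y) \<partial>lborel) \<le> (\<integral>y. (1 - W y) * h (W y) * f y \<partial>lborel)"
proof -
  let ?g = "\<lambda>y. (1 - W y) * h (W y)"
  have [measurable]: "h \<in> borel_measurable borel" by (rule borel_measurable_continuous_onI[OF h(1)])
  show "(\<lambda>n. b n * (\<integral>y. ?g (y /\<^sub>R r n) * \<phi> n y \<partial>lborel)) \<longlonglongrightarrow> (\<integral>y. ?g y * f y \<partial>lborel)"
    using test_function_convergence[OF h(1)] h(2) by simp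
  have sc: "integrable lborel (\<lambda>y. ?g (y /\<^sub>R r n))" "(\<integral>y. ?g (y /\<^sub>R r n) \<partial>lborel) = r n ^ DIM('a) * (\<integral>y. ?g y \<partial>lborel)"
    using integrable_lborel_scaleR[of "\<lambda>y. ?g (y /\<^sub>R r n)" "r n"] integral_lborel_scaleR[of "\<lambda>y. ?g (y /\<^sub>R r n)" "r n"] int r_pos[of n]
    by auto
  have i\<phi>: "integrable lborel (\<lambda>y. ?g (y /\<^sub>R r n) * \<phi> n y)"
    by (rule integrable_test_function[where h = h, OF _ _ h(3,4)]) (use \<phi>_integrable[of n] in \<open>auto simp: W_def\<close>)
  have i_f: "integrable lborel (\<lambda>y. ?g y * f y)"
    using integrable_test_function[where h = h and g = f and c = 1, OF _ _ h(3,4)] f_integrable by (auto simp: W_def)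
  have sp: "0 < ?g (y /\<^sub>R r n) \<Longrightarrow> r n *\<^sub>R (y /\<^sub>R r n) = y" for y using r_pos[of n] by simp
  {
    assume *: "\<And>y. 0 < ?g y \<Longrightarrow> \<phi> n (r n *\<^sub>R y) \<le> m"
    have "(\<integral>y. ?g (y /\<^sub>R r n) * \<phi> n y \<partial>lborel) \<le> (\<integral>y. m * ?g (y /\<^sub>R r n) \<partial>lborel)"
    proof (rule integral_mono)
      fix y
      show "?g (y /\<^sub>R r n) * \<phi> n y \<le> m * ?g (y /\<^sub>R r n)"
      proof (cases "0 < ?g (y /\<^sub>R r n)")
        case True
        then have "\<phi> n y \<le> m" using *[OF True] sp[OF True] by simp
        then show ?thesis using mult_left_mono[OF _ nn[of "y /\<^sub>R r n"]] by (simp only: mult.commute[of m])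
      next
        case False
        then have "?g (y /\<^sub>R r n) = 0" using nn[of "y /\<^sub>R r n"] by linarith
        then show ?thesis by (simp only: mult_zero_left mult_zero_right order_refl)
      qed
    qed (use i\<phi> sc(1) in auto)
    also have "\<dots> = m * (r n ^ DIM('a) * (\<integral>y. ?g y \<partial>lborel))" using sc by simp
    finally have "(\<integral>y. ?g (y /\<^sub>R r n) * \<phi> n y \<partial>lborel) \<le> m * (r n ^ DIM('a) * (\<integral>y. ?g y \<partial>lborel))" .
    from mult_left_mono[OF this b_nonneg[of n]]
    show "b n * (\<integral>y. ?g (y /\<^sub>R r n) * \<phi> n y \<partial>lborel) \<le> b n * r n ^ DIM('a) * m * (\<integral>y. ?g y \<partial>lborel)"
      by (simp only: mult_ac)
  }
  {
    assume *: "\<And>y. 0 < ?g y \<Longrightarrow> m \<le> \<phi> n (r n *\<^sub>R y)"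
    have "(\<integral>y. m * ?g (y /\<^sub>R r n) \<partial>lborel) \<le> (\<integral>y. ?g (y /\<^sub>R r n) * \<phi> n y \<partial>lborel)"
    proof (rule integral_mono)
      fix y
      show "m * ?g (y /\<^sub>R r n) \<le> ?g (y /\<^sub>R r n) * \<phi> n y"
      proof (cases "0 < ?g (y /\<^sub>R r n)")
        case True
        then have "m \<le> \<phi> n y" using *[OF True] sp[OF True] by simp
        then show ?thesis using mult_left_mono[OF _ nn[of "y /\<^sub>R r n"]] by (simp only: mult.commute[of m])
      next
        case False
        then have "?g (y /\<^sub>R r n) = 0" using nn[of "y /\<^sub>R r n"] by linarith
        then show ?thesis by (simp only: mult_zero_left mult_zero_right order_refl)
      qed
    qed (use i\<phi> sc(1) in auto)
    also have "(\<integral>y. m * ?g (y /\<^sub>R r n) \<partial>lborel) = m * (r n ^ DIM('a) * (\<integral>y. ?g y \<partial>lborel))" using sc by simp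
    finally have "m * (r n ^ DIM('a) * (\<integral>y. ?g y \<partial>lborel)) \<le> (\<integral>y. ?g (y /\<^sub>R r n) * \<phi> n y \<partial>lborel)" .
    from mult_left_mono[OF this b_nonneg[of n]]
    show "b n * r n ^ DIM('a) * m * (\<integral>y. ?g y \<partial>lborel) \<le> b n * (\<integral>y. ?g (y /\<^sub>R r n) * \<phi> n y \<partial>lborel)"
      by (simp only: mult_ac)
  }
  {
    assume *: "\<And>y. 0 < ?g y \<Longrightarrow> f y \<le> m"
    have "(\<integral>y. ?g y * f y \<partial>lborel) \<le> (\<integral>y. m * ?g y \<partial>lborel)"
    proof (rule integral_mono)
      show "?g y * f y \<le> m * ?g y" for y
        using *[of y] nn[of y] by (cases "0 < ?g y") (auto simp: mult.commute[of m] mult_left_mono)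
    qed (use i_f int in auto)
    then show "(\<integral>y. ?g y * f y \<partial>lborel) \<le> m * (\<integral>y. ?g y \<partial>lborel)" by simp
  }
  {
    assume *: "\<And>y. 0 < ?g y \<Longrightarrow> m \<le> f y"
    have "(\<integral>y. m * ?g y \<partial>lborel) \<le> (\<integral>y. ?g y * f y \<partial>lborel)"
    proof (rule integral_mono)
      show "m * ?g y \<le> ?g y * f y" for y
        using *[of y] nn[of y] by (cases "0 < ?g y") (auto simp: mult.commute[of m] mult_left_mono)
    qed (use i_f int in auto)
    then show "m * (\<integral>y. ?g y \<partial>lborel) \<le> (\<integral>y. ?g y * f y \<partial>lborel)" by simp
  }
qed

text \<open>A test function supported in the annulus between \<open>x\<close> and \<open>z\<close> sees only values of \<open>\<phi>\<^sub>n\<close> that are at most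
its value at \<open>x\<close>, and values of \<open>f\<close> that are at least \<open>f z\<close>. Two radii are compared because
\<open>f\<close> may jump.\<close>

lemma eventually_density_greater:
  assumes x: "x \<noteq> 0" and xz: "norm x < norm z" and A: "A < f z"
  shows "eventually (\<lambda>n. A < b n * r n ^ DIM('a) * \<phi> n (r n *\<^sub>R x)) sequentially"
proof -
  obtain h where h: "continuous_on UNIV (h :: real \<Rightarrow> real)" "h 1 = 0" "\<And>w. 0 \<le> h w" "\<forall>w\<in>{0..1}. h w \<le> 1"
    and nn: "\<And>y. 0 \<le> (1 - W y) * h (W y)"
    and pos: "\<And>y. 0 < (1 - W y) * h (W y) \<longleftrightarrow> norm x < norm y \<and> norm y < norm z"
    and int: "integrable lborel (\<lambda>y. (1 - W y) * h (W y))" and G: "0 < (\<integral>y. (1 - W y) * h (W y) \<partial>lborel)"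
    using annular_test_function[OF norm_ge_zero xz] by blast
  note bounds = density_bounds_by_test_function[OF h nn int]
  have "A * (\<integral>y. (1 - W y) * h (W y) \<partial>lborel) < f z * (\<integral>y. (1 - W y) * h (W y) \<partial>lborel)"
    using A G by simp
  also have "\<dots> \<le> (\<integral>y. (1 - W y) * h (W y) * f y \<partial>lborel)"
  proof (rule bounds(5))
    fix y assume "0 < (1 - W y) * h (W y)"
    then have "norm x < norm y" "norm y < norm z" using pos by blast+
    then show "f z \<le> f y" by (intro f_antimono) auto
  qed
  finally have "eventually (\<lambda>n. A * (\<integral>y. (1 - W y) * h (W y) \<partial>lborel) < b n * (\<integral>y. (1 - W (y /\<^sub>R r n)) * h (W (y /\<^sub>R r n)) * \<phi> n y \<partial>lborel)) sequentially"
    by (rule order_tendstoD(1)[OF bounds(1)])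
  then show ?thesis
  proof eventually_elim
    case (elim n)
    also have "b n * (\<integral>y. (1 - W (y /\<^sub>R r n)) * h (W (y /\<^sub>R r n)) * \<phi> n y \<partial>lborel)
        \<le> b n * r n ^ DIM('a) * \<phi> n (r n *\<^sub>R x) * (\<integral>y. (1 - W y) * h (W y) \<partial>lborel)"
    proof (rule bounds(2))
      fix y assume "0 < (1 - W y) * h (W y)"
      then have "norm x < norm y" using pos by blast
      then show "\<phi> n (r n *\<^sub>R y) \<le> \<phi> n (r n *\<^sub>R x)" using x r_pos[of n] by (intro \<phi>_antimono) auto
    qed
    finally show ?case using G by simp
  qed
qed

lemma eventually_density_less:
  assumes z: "z \<noteq> 0" and zx: "norm z < norm x" and A: "f z < A"
  shows "eventually (\<lambda>n. b n * r n ^ DIM('a) * \<phi> n (r n *\<^sub>R x) < A) sequentially"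
proof -
  obtain h where h: "continuous_on UNIV (h :: real \<Rightarrow> real)" "h 1 = 0" "\<And>w. 0 \<le> h w" "\<forall>w\<in>{0..1}. h w \<le> 1"
    and nn: "\<And>y. 0 \<le> (1 - W y) * h (W y)"
    and pos: "\<And>y. 0 < (1 - W y) * h (W y) \<longleftrightarrow> norm z < norm y \<and> norm y < norm x"
    and int: "integrable lborel (\<lambda>y. (1 - W y) * h (W y))" and G: "0 < (\<integral>y. (1 - W y) * h (W y) \<partial>lborel)"
    using annular_test_function[OF norm_ge_zero zx] by blast
  note bounds = density_bounds_by_test_function[OF h nn int]
  have "(\<integral>y. (1 - W y) * h (W y) * f y \<partial>lborel) \<le> f z * (\<integral>y. (1 - W y) * h (W y) \<partial>lborel)"
  proof (rule bounds(4))
    fix y assume "0 < (1 - W y) * h (W y)"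
    then have "norm z < norm y" using pos by blast
    then show "f y \<le> f z" using z by (intro f_antimono) auto
  qed
  also have "\<dots> < A * (\<integral>y. (1 - W y) * h (W y) \<partial>lborel)" using A G by simp
  finally have "eventually (\<lambda>n. b n * (\<integral>y. (1 - W (y /\<^sub>R r n)) * h (W (y /\<^sub>R r n)) * \<phi> n y \<partial>lborel) < A * (\<integral>y. (1 - W y) * h (W y) \<partial>lborel)) sequentially"
    by (rule order_tendstoD(2)[OF bounds(1)])
  then show ?thesis
  proof eventually_elim
    case (elim n)
    have "b n * r n ^ DIM('a) * \<phi> n (r n *\<^sub>R x) * (\<integral>y. (1 - W y) * h (W y) \<partial>lborel)
        \<le> b n * (\<integral>y. (1 - W (y /\<^sub>R r n)) * h (W (y /\<^sub>R r n)) * \<phi> n y \<partial>lborel)"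
    proof (rule bounds(3))
      fix y assume "0 < (1 - W y) * h (W y)"
      then have "norm z < norm y" "norm y < norm x" using pos by blast+
      then show "\<phi> n (r n *\<^sub>R x) \<le> \<phi> n (r n *\<^sub>R y)" using r_pos[of n] by (intro \<phi>_antimono) auto
    qed
    also note elim
    finally show ?case using G by simp
  qed
qed

end

section \<open>Exponents with a unimodal Levy measure\<close>

lemma one_minus_cos_eq: "1 - cos u = 2 * (sin (u / 2))\<^sup>2" for u :: real
  using cos_double_sin[of "u / 2"] by simp

lemma one_minus_cos_le: "1 - cos u \<le> min 2 (u\<^sup>2 / 2)" for u :: real
proof -
  have "(sin (u / 2))\<^sup>2 \<le> (u / 2)\<^sup>2"
    using abs_sin_x_le_abs_x[of "u / 2"] by (simp only: abs_le_square_iff)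
  then have "2 * (sin (u / 2))\<^sup>2 \<le> u\<^sup>2 / 2" by (simp add: power_divide)
  moreover have "1 - cos u \<le> 2" using cos_ge_minus_one[of u] by simp
  ultimately show ?thesis using one_minus_cos_eq[of u] by simp
qed

lemma one_minus_cos_add_le:
  fixes a b \<epsilon> :: real assumes "\<epsilon> > 0"
  shows "1 - cos (a + b) \<le> (1 + \<epsilon>) * (1 - cos a) + (1 + 1 / \<epsilon>) * (1 - cos b)"
proof -
  define x where "x = \<bar>sin (a / 2)\<bar>"
  define y where "y = \<bar>sin (b / 2)\<bar>"
  have "\<bar>sin ((a + b) / 2)\<bar> \<le> x + y"
  proof -
    have "sin ((a + b) / 2) = sin (a / 2) * cos (b / 2) + cos (a / 2) * sin (b / 2)"
      by (simp add: sin_add add_divide_distrib)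
    also have "\<bar>\<dots>\<bar> \<le> \<bar>sin (a / 2) * cos (b / 2)\<bar> + \<bar>cos (a / 2) * sin (b / 2)\<bar>"
      by (rule abs_triangle_ineq)
    also have "\<dots> \<le> x * 1 + 1 * y"
      unfolding abs_mult x_def y_def by (intro add_mono mult_mono) auto
    finally show ?thesis by simp
  qed
  then have "(sin ((a + b) / 2))\<^sup>2 \<le> (x + y)\<^sup>2"
    by (metis abs_ge_zero power2_abs power_mono)
  also have "(x + y)\<^sup>2 \<le> (1 + \<epsilon>) * x\<^sup>2 + (1 + 1 / \<epsilon>) * y\<^sup>2"
  proof -
    have "0 \<le> (\<epsilon> * x - y)\<^sup>2 / \<epsilon>" using assms by simp
    also have "\<dots> = \<epsilon> * x\<^sup>2 - 2 * x * y + y\<^sup>2 / \<epsilon>"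
      using assms by (simp add: field_simps power2_eq_square)
    finally show ?thesis by (simp add: field_simps power2_eq_square)
  qed
  finally show ?thesis unfolding one_minus_cos_eq x_def y_def power2_abs by (simp add: algebra_simps)
qed

lemma one_minus_cos_mult_le: "1 - cos (real n * u) \<le> (real n)\<^sup>2 * (1 - cos u)"
proof -
  have s: "\<bar>sin (real n * x)\<bar> \<le> real n * \<bar>sin x\<bar>" for x
  proof (induction n)
    case (Suc n)
    have "real (Suc n) * x = real n * x + x" by (simp add: algebra_simps)
    then have "\<bar>sin (real (Suc n) * x)\<bar> = \<bar>sin (real n * x) * cos x + cos (real n * x) * sin x\<bar>"
      by (simp only: sin_add)
    also have "\<dots> \<le> \<bar>sin (real n * x)\<bar> * \<bar>cos x\<bar> + \<bar>cos (real n * x)\<bar> * \<bar>sin x\<bar>"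
      by (metis abs_mult abs_triangle_ineq)
    also have "\<dots> \<le> \<bar>sin (real n * x)\<bar> * 1 + 1 * \<bar>sin x\<bar>"
      by (intro add_mono mult_mono) auto
    finally show ?case using Suc by (simp add: algebra_simps)
  qed simp
  have "(sin (real n * (u / 2)))\<^sup>2 \<le> (real n * \<bar>sin (u / 2)\<bar>)\<^sup>2"
    using s[of "u / 2"] by (metis abs_ge_zero power2_abs power_mono)
  then show ?thesis unfolding one_minus_cos_eq[of u] one_minus_cos_eq[of "real n * u"]
    by (simp add: power_mult_distrib)
qed

lemma square_le_one_minus_cos:
  fixes u :: real assumes "\<bar>u\<bar> \<le> pi / 2"
  shows "u\<^sup>2 / 2 \<le> 4 * (1 - cos u)"
proof -
  define x where "x = \<bar>u\<bar> / 2"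
  have x: "0 \<le> x" "x \<le> pi / 4" using assms by (auto simp: x_def)
  have "sin 0 - 0 / 2 \<le> sin x - x / 2"
  proof (rule DERIV_nonneg_imp_nondecreasing[OF x(1)])
    fix y assume y: "0 \<le> y" "y \<le> x"
    have "cos (pi / 3) \<le> cos y" using y x pi_gt_zero by (intro cos_monotone_0_pi_le) auto
    then have "cos y - 1 / 2 \<ge> 0" by (simp add: cos_60)
    moreover have "((\<lambda>y. sin y - y / 2) has_real_derivative (cos y - 1 / 2)) (at y)"
      by (auto intro!: derivative_eq_intros)
    ultimately show "\<exists>z. ((\<lambda>y. sin y - y / 2) has_real_derivative z) (at y) \<and> 0 \<le> z" by blast
  qed
  then have "x / 2 \<le> sin x" by simp
  then have "(x / 2)\<^sup>2 \<le> (sin x)\<^sup>2" using x by (intro power_mono) auto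
  moreover have "(sin x)\<^sup>2 = (sin (u / 2))\<^sup>2" by (cases "u \<ge> 0") (auto simp: x_def)
  ultimately show ?thesis unfolding one_minus_cos_eq by (simp add: x_def power_divide)
qed

lemma integral_lborel_translate:
  fixes g :: "'a::euclidean_space \<Rightarrow> real"
  assumes [measurable]: "g \<in> borel_measurable borel"
  shows "(\<integral>x. g (h + x) \<partial>lborel) = (\<integral>x. g x \<partial>lborel)"
    and "integrable lborel (\<lambda>x. g (h + x)) \<longleftrightarrow> integrable lborel g"
proof -
  show "(\<integral>x. g (h + x) \<partial>lborel) = (\<integral>x. g x \<partial>lborel)"
    by (subst (2) lborel_distr_plus[of h, symmetric]) (simp add: integral_distr)
  show "integrable lborel (\<lambda>x. g (h + x)) \<longleftrightarrow> integrable lborel g"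
    by (subst (2) lborel_distr_plus[of h, symmetric]) (simp add: integrable_distr_eq)
qed

text \<open>The Levy-Khintchine formula with a unimodal Levy density, written as an integral with respect to
Lebesgue measure.\<close>

locale unimodal_exponent =
  fixes \<psi> :: "'a::euclidean_space \<Rightarrow> real" and \<eta> :: real and \<nu> :: "'a \<Rightarrow> real"
  assumes gauss_nonneg: "0 \<le> \<eta>"
    and density_measurable [measurable]: "\<nu> \<in> borel_measurable borel"
    and density_nonneg: "x \<noteq> 0 \<Longrightarrow> 0 \<le> \<nu> x"
    and density_antimono: "x \<noteq> 0 \<Longrightarrow> norm x \<le> norm y \<Longrightarrow> \<nu> y \<le> \<nu> x"
    and levy_integrable: "integrable lborel (\<lambda>x. min 1 ((norm x)\<^sup>2) * \<nu> x)"
    and exponent_eq: "\<psi> \<xi> = (\<integral>x. (1 - cos (\<xi> \<bullet> x)) * \<nu> x \<partial>lborel) + \<eta> * (norm \<xi>)\<^sup>2"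
    and exponent_radial: "norm \<xi> = norm \<zeta> \<Longrightarrow> \<psi> \<xi> = \<psi> \<zeta>"
begin

lemma integrable_levy:
  assumes [measurable]: "g \<in> borel_measurable borel"
    and g: "\<And>x. \<bar>g x\<bar> \<le> C * min 1 ((norm x)\<^sup>2)"
  shows "integrable lborel (\<lambda>x. g x * \<nu> x)"
proof (rule Bochner_Integration.integrable_bound)
  show "integrable lborel (\<lambda>x. C * (min 1 ((norm x)\<^sup>2) * \<nu> x))" using levy_integrable by simp
  show "AE x in lborel. norm (g x * \<nu> x) \<le> norm (C * (min 1 ((norm x)\<^sup>2) * \<nu> x))"
  proof (rule AE_I2)
    fix x :: 'a
    have C: "0 \<le> C * min 1 ((norm x)\<^sup>2)" using g[of x] by (meson abs_ge_zero order_trans)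
    have "\<bar>g x\<bar> * \<bar>\<nu> x\<bar> \<le> (C * min 1 ((norm x)\<^sup>2)) * \<bar>\<nu> x\<bar>" by (intro mult_right_mono g) auto
    also have "\<dots> = \<bar>C * min 1 ((norm x)\<^sup>2) * \<nu> x\<bar>" using C by (simp only: abs_mult[of _ "\<nu> x"] abs_of_nonneg)
    finally show "norm (g x * \<nu> x) \<le> norm (C * (min 1 ((norm x)\<^sup>2) * \<nu> x))" by (simp add: abs_mult mult.assoc)
  qed
qed measurable

lemma min_square_le: "min 2 ((\<xi> \<bullet> x)\<^sup>2 / 2) \<le> (2 + (norm \<xi>)\<^sup>2) * min 1 ((norm x)\<^sup>2)"
proof -
  have "\<bar>\<xi> \<bullet> x\<bar> \<le> norm \<xi> * norm x" by (rule Cauchy_Schwarz_ineq2)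
  then have a: "(\<xi> \<bullet> x)\<^sup>2 \<le> (norm \<xi>)\<^sup>2 * (norm x)\<^sup>2"
    by (metis abs_ge_zero power2_abs power_mono power_mult_distrib)
  show ?thesis
  proof (cases "(norm x)\<^sup>2 \<le> 1")
    case True
    have "(\<xi> \<bullet> x)\<^sup>2 / 2 \<le> (\<xi> \<bullet> x)\<^sup>2" by simp
    also have "\<dots> \<le> (2 + (norm \<xi>)\<^sup>2) * (norm x)\<^sup>2" using a zero_le_power2[of "norm x"] unfolding distrib_right by linarith
    finally show ?thesis using True by (simp add: min_absorb2 min.coboundedI2)
  qed (simp add: min.coboundedI1)
qed

lemma integrable_min: "integrable lborel (\<lambda>x. min 2 ((\<xi> \<bullet> x)\<^sup>2 / 2) * \<nu> x)"
  by (rule integrable_levy[where C = "2 + (norm \<xi>)\<^sup>2"]) (use min_square_le[of \<xi>] in auto)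

lemma integrable_one_minus_cos: "integrable lborel (\<lambda>x. (1 - cos (\<xi> \<bullet> x)) * \<nu> x)"
proof (rule integrable_levy[where C = "2 + (norm \<xi>)\<^sup>2"])
  show "\<bar>1 - cos (\<xi> \<bullet> x)\<bar> \<le> (2 + (norm \<xi>)\<^sup>2) * min 1 ((norm x)\<^sup>2)" for x
    using order_trans[OF one_minus_cos_le min_square_le, of \<xi> x] by simp
qed measurable

lemma AE_nonneg: "AE x in lborel. 0 \<le> \<nu> x"
  using AE_lborel_singleton[of 0] by eventually_elim (rule density_nonneg)

lemma jump_part_nonneg: "0 \<le> (\<integral>x. (1 - cos (\<xi> \<bullet> x)) * \<nu> x \<partial>lborel)"
  by (rule integral_nonneg_AE) (use AE_nonneg in eventually_elim, simp)

lemma exponent_nonneg: "0 \<le> \<psi> \<xi>"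
  unfolding exponent_eq using jump_part_nonneg gauss_nonneg by simp

lemma jump_part_le_exponent: "(\<integral>x. (1 - cos (\<xi> \<bullet> x)) * \<nu> x \<partial>lborel) \<le> \<psi> \<xi>"
  unfolding exponent_eq using gauss_nonneg by simp

lemma exponent_zero: "\<psi> 0 = 0"
  unfolding exponent_eq by simp

lemma exponent_multiple_le: "\<psi> (real n *\<^sub>R \<xi>) \<le> (real n)\<^sup>2 * \<psi> \<xi>"
proof -
  have "(\<integral>x. (1 - cos ((real n *\<^sub>R \<xi>) \<bullet> x)) * \<nu> x \<partial>lborel) \<le> (\<integral>x. (real n)\<^sup>2 * ((1 - cos (\<xi> \<bullet> x)) * \<nu> x) \<partial>lborel)"
  proof (rule integral_mono_AE)
    show "AE x in lborel. (1 - cos ((real n *\<^sub>R \<xi>) \<bullet> x)) * \<nu> x \<le> (real n)\<^sup>2 * ((1 - cos (\<xi> \<bullet> x)) * \<nu> x)"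
      using AE_nonneg
    proof eventually_elim
      case (elim x)
      show ?case using mult_right_mono[OF one_minus_cos_mult_le[of n "\<xi> \<bullet> x"] elim] by (simp add: mult.assoc)
    qed
  qed (use integrable_one_minus_cos[of "real n *\<^sub>R \<xi>"] integrable_one_minus_cos[of \<xi>] in simp_all)
  also have "\<dots> = (real n)\<^sup>2 * (\<integral>x. (1 - cos (\<xi> \<bullet> x)) * \<nu> x \<partial>lborel)" by simp
  finally have "(\<integral>x. (1 - cos ((real n *\<^sub>R \<xi>) \<bullet> x)) * \<nu> x \<partial>lborel) \<le> \<dots>" .
  then show ?thesis unfolding exponent_eq distrib_left by (simp add: power_mult_distrib)
qed

text \<open>A parametrised form of the subadditivity of the square root of \<open>\<psi>\<close>; choosing \<open>\<epsilon>\<close> yields continuity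
estimates.\<close>

lemma exponent_add_le:
  assumes \<epsilon>: "\<epsilon> > 0"
  shows "\<psi> (\<xi> + \<zeta>) \<le> (1 + \<epsilon>) * \<psi> \<xi> + (1 + 1 / \<epsilon>) * \<psi> \<zeta>"
proof -
  note i = integrable_one_minus_cos
  have "(\<integral>x. (1 - cos ((\<xi> + \<zeta>) \<bullet> x)) * \<nu> x \<partial>lborel)
     \<le> (\<integral>x. (1 + \<epsilon>) * ((1 - cos (\<xi> \<bullet> x)) * \<nu> x) + (1 + 1 / \<epsilon>) * ((1 - cos (\<zeta> \<bullet> x)) * \<nu> x) \<partial>lborel)"
  proof (rule integral_mono_AE)
    show "AE x in lborel. (1 - cos ((\<xi> + \<zeta>) \<bullet> x)) * \<nu> x \<le> (1 + \<epsilon>) * ((1 - cos (\<xi> \<bullet> x)) * \<nu> x) + (1 + 1 / \<epsilon>) * ((1 - cos (\<zeta> \<bullet> x)) * \<nu> x)"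
      using AE_nonneg
    proof eventually_elim
      case (elim x)
      show ?case using mult_right_mono[OF one_minus_cos_add_le[OF \<epsilon>, of "\<xi> \<bullet> x" "\<zeta> \<bullet> x"] elim]
        by (simp add: inner_add_left algebra_simps)
    qed
  qed (use i in simp_all)
  also have "\<dots> = (1 + \<epsilon>) * (\<integral>x. (1 - cos (\<xi> \<bullet> x)) * \<nu> x \<partial>lborel) + (1 + 1 / \<epsilon>) * (\<integral>x. (1 - cos (\<zeta> \<bullet> x)) * \<nu> x \<partial>lborel)"
    using i by simp
  finally have 1: "(\<integral>x. (1 - cos ((\<xi> + \<zeta>) \<bullet> x)) * \<nu> x \<partial>lborel) \<le> \<dots>" .
  have "(norm (\<xi> + \<zeta>))\<^sup>2 \<le> (norm \<xi> + norm \<zeta>)\<^sup>2"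
    by (intro power_mono norm_triangle_ineq) auto
  also have "\<dots> \<le> (1 + \<epsilon>) * (norm \<xi>)\<^sup>2 + (1 + 1 / \<epsilon>) * (norm \<zeta>)\<^sup>2"
  proof -
    have "0 \<le> (\<epsilon> * norm \<xi> - norm \<zeta>)\<^sup>2 / \<epsilon>" using assms by simp
    also have "\<dots> = \<epsilon> * (norm \<xi>)\<^sup>2 - 2 * norm \<xi> * norm \<zeta> + (norm \<zeta>)\<^sup>2 / \<epsilon>"
      using assms by (simp add: field_simps power2_eq_square)
    finally show ?thesis by (simp add: field_simps power2_eq_square)
  qed
  finally have "\<eta> * (norm (\<xi> + \<zeta>))\<^sup>2 \<le> \<eta> * ((1 + \<epsilon>) * (norm \<xi>)\<^sup>2 + (1 + 1 / \<epsilon>) * (norm \<zeta>)\<^sup>2)"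
    by (rule mult_left_mono[OF _ gauss_nonneg])
  with 1 show ?thesis unfolding exponent_eq by (simp add: algebra_simps)
qed

text \<open>Shift the half-space by \<open>h = \<pi>\<xi>/|\<xi>|\<^sup>2\<close>, half a period of the cosine. The values of \<open>1 - cos \<langle>\<xi>, \<sqdot>\<rangle>\<close> at \<open>x\<close>
and \<open>x + h\<close> add up to 2, and \<open>x + h\<close> is closer to the origin than \<open>x\<close>, so that the density there is
at least \<open>\<nu>(x)\<close>. Hence points where the cosine is close to 1 cannot carry more than their share of the
mass.\<close>

lemma half_space_mass_le:
  assumes \<xi>: "\<xi> \<noteq> 0"
  shows "integrable lborel (\<lambda>x. indicator {x. \<xi> \<bullet> x \<le> - (pi / 2)} x * \<nu> x)"
    and "(\<integral>x. indicator {x. \<xi> \<bullet> x \<le> - (pi / 2)} x * \<nu> x \<partial>lborel) \<le> (\<integral>x. (1 - cos (\<xi> \<bullet> x)) * \<nu> x \<partial>lborel)"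
proof -
  let ?H = "{x. \<xi> \<bullet> x \<le> - (pi / 2)}"
  define h where "h = (pi / (norm \<xi>)\<^sup>2) *\<^sub>R \<xi>"
  have n: "norm \<xi> > 0" using \<xi> by simp
  have h\<xi>: "\<xi> \<bullet> h = pi" using n by (simp add: h_def power2_norm_eq_inner)
  have hh: "h \<bullet> h = pi * (pi / (norm \<xi>)\<^sup>2)" using n by (simp add: h_def power2_norm_eq_inner)
  have H [measurable]: "?H \<in> sets borel" by measurable
  show iH: "integrable lborel (\<lambda>x. indicator ?H x * \<nu> x)"
  proof (rule integrable_levy[where C = "1 + (norm \<xi>)\<^sup>2"])
    show "\<bar>indicator ?H x\<bar> \<le> (1 + (norm \<xi>)\<^sup>2) * min 1 ((norm x)\<^sup>2)" for x
    proof (cases "x \<in> ?H")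
      case True
      have "1 \<le> pi / 2" using pi_ge_two by simp
      also have "\<dots> \<le> \<bar>\<xi> \<bullet> x\<bar>" using True by simp
      also have "\<dots> \<le> norm \<xi> * norm x" by (rule Cauchy_Schwarz_ineq2)
      finally have "1 \<le> (norm \<xi> * norm x)\<^sup>2" by (simp add: one_le_power)
      then have "1 \<le> (1 + (norm \<xi>)\<^sup>2) * (norm x)\<^sup>2"
        by (simp add: power_mult_distrib distrib_right add_increasing)
      moreover have "1 \<le> (1 + (norm \<xi>)\<^sup>2) * 1" by simp
      ultimately show ?thesis using True by (simp add: min_def)
    qed simp
  qed measurable
  let ?f = "\<lambda>x. (1 - cos (\<xi> \<bullet> x)) * \<nu> x"
  have ish: "integrable lborel (\<lambda>x. ?f (h + x))" "(\<integral>x. ?f (h + x) \<partial>lborel) = (\<integral>x. ?f x \<partial>lborel)"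
    using integral_lborel_translate[of ?f h] integrable_one_minus_cos[of \<xi>] by simp_all
  have "(\<integral>x. 2 * (indicator ?H x * \<nu> x) \<partial>lborel) \<le> (\<integral>x. ?f x + ?f (h + x) \<partial>lborel)"
  proof (rule integral_mono_AE)
    show "AE x in lborel. 2 * (indicator ?H x * \<nu> x) \<le> ?f x + ?f (h + x)"
      using AE_nonneg AE_lborel_singleton[of "- h"]
    proof eventually_elim
      case (elim x)
      have hx: "h + x \<noteq> 0" using elim(2) by (metis add_eq_0_iff)
      have nn: "0 \<le> ?f x" "0 \<le> ?f (h + x)" using elim(1) density_nonneg[OF hx] by auto
      show ?case
      proof (cases "x \<in> ?H")
        case True
        then have "\<xi> \<bullet> x \<le> - (pi / 2)" by simp
        have "(norm (h + x))\<^sup>2 = (norm x)\<^sup>2 + (2 * (h \<bullet> x) + h \<bullet> h)"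
          unfolding power2_norm_eq_inner by (simp add: inner_add_left inner_add_right inner_commute)
        also have "2 * (h \<bullet> x) + h \<bullet> h = (pi / (norm \<xi>)\<^sup>2) * (2 * (\<xi> \<bullet> x) + pi)"
          unfolding hh by (simp add: h_def distrib_left mult.commute)
        finally have "(norm (h + x))\<^sup>2 = (norm x)\<^sup>2 + (pi / (norm \<xi>)\<^sup>2) * (2 * (\<xi> \<bullet> x) + pi)" by simp
        moreover have "(pi / (norm \<xi>)\<^sup>2) * (2 * (\<xi> \<bullet> x) + pi) \<le> 0"
          using True by (intro mult_nonneg_nonpos) auto
        ultimately have "(norm (h + x))\<^sup>2 \<le> (norm x)\<^sup>2" by linarith
        then have "norm (h + x) \<le> norm x" by (rule power2_le_imp_le) simp
        then have "\<nu> x \<le> \<nu> (h + x)" by (rule density_antimono[OF hx])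
        then have "(1 + cos (\<xi> \<bullet> x)) * \<nu> x \<le> (1 + cos (\<xi> \<bullet> x)) * \<nu> (h + x)"
          using cos_ge_minus_one[of "\<xi> \<bullet> x"] by (intro mult_left_mono) linarith+
        moreover have "cos (\<xi> \<bullet> (h + x)) = - cos (\<xi> \<bullet> x)"
          by (simp add: inner_add_right h\<xi> cos_add)
        ultimately show ?thesis using True by (simp add: algebra_simps)
      next
        case False
        then show ?thesis using nn by simp
      qed
    qed
    show "integrable lborel (\<lambda>x. 2 * (indicator ?H x * \<nu> x))" using iH by simp
    show "integrable lborel (\<lambda>x. ?f x + ?f (h + x))" using ish(1) integrable_one_minus_cos[of \<xi>] by simp
  qed
  also have "\<dots> = 2 * (\<integral>x. ?f x \<partial>lborel)" using ish integrable_one_minus_cos[of \<xi>] by simp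
  finally show "(\<integral>x. indicator ?H x * \<nu> x \<partial>lborel) \<le> (\<integral>x. ?f x \<partial>lborel)" using iH by simp
qed

text \<open>On the slab \<open>|\<langle>\<xi>,x\<rangle>| \<le> \<pi>/2\<close> the square is comparable with \<open>1 - cos\<close>; the two half-spaces outside are
covered by \<open>half_space_mass_le\<close>.\<close>

lemma truncated_square_le_jump_part:
  "(\<integral>x. min 2 ((\<xi> \<bullet> x)\<^sup>2 / 2) * \<nu> x \<partial>lborel) \<le> 8 * (\<integral>x. (1 - cos (\<xi> \<bullet> x)) * \<nu> x \<partial>lborel)"
proof (cases "\<xi> = 0")
  case False
  then have m: "- \<xi> \<noteq> 0" by simp
  let ?J = "\<integral>x. (1 - cos (\<xi> \<bullet> x)) * \<nu> x \<partial>lborel"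
  note A = half_space_mass_le[OF False] and B = half_space_mass_le[OF m]
  note i = integrable_one_minus_cos[of \<xi>]
  have "(\<integral>x. min 2 ((\<xi> \<bullet> x)\<^sup>2 / 2) * \<nu> x \<partial>lborel)
     \<le> (\<integral>x. 4 * ((1 - cos (\<xi> \<bullet> x)) * \<nu> x) + (2 * (indicator {x. \<xi> \<bullet> x \<le> - (pi / 2)} x * \<nu> x)
        + 2 * (indicator {x. - \<xi> \<bullet> x \<le> - (pi / 2)} x * \<nu> x)) \<partial>lborel)"
  proof (rule integral_mono_AE)
    show "AE x in lborel. min 2 ((\<xi> \<bullet> x)\<^sup>2 / 2) * \<nu> x \<le> 4 * ((1 - cos (\<xi> \<bullet> x)) * \<nu> x) + (2 * (indicator {x. \<xi> \<bullet> x \<le> - (pi / 2)} x * \<nu> x)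
        + 2 * (indicator {x. - \<xi> \<bullet> x \<le> - (pi / 2)} x * \<nu> x))"
      using AE_nonneg
    proof eventually_elim
      case (elim x)
      have "min 2 ((\<xi> \<bullet> x)\<^sup>2 / 2) \<le> 4 * (1 - cos (\<xi> \<bullet> x)) + (2 * indicator {x. \<xi> \<bullet> x \<le> - (pi / 2)} x
        + 2 * indicator {x. - \<xi> \<bullet> x \<le> - (pi / 2)} x)"
      proof (cases "\<bar>\<xi> \<bullet> x\<bar> \<le> pi / 2")
        case True
        have "min 2 ((\<xi> \<bullet> x)\<^sup>2 / 2) \<le> 4 * (1 - cos (\<xi> \<bullet> x))"
          using square_le_one_minus_cos[OF True] by simp
        then show ?thesis by (auto simp: indicator_def)
      next
        case False
        then have "\<xi> \<bullet> x \<le> - (pi / 2) \<or> - \<xi> \<bullet> x \<le> - (pi / 2)" by (auto simp: abs_le_iff not_le)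
        then have "2 \<le> 2 * indicator {x. \<xi> \<bullet> x \<le> - (pi / 2)} x + 2 * (indicator {x. - \<xi> \<bullet> x \<le> - (pi / 2)} x :: real)"
          by (auto simp: indicator_def)
        moreover have "0 \<le> 4 * (1 - cos (\<xi> \<bullet> x))" using cos_le_one[of "\<xi> \<bullet> x"] by simp
        ultimately show ?thesis using min.cobounded1[of 2 "(\<xi> \<bullet> x)\<^sup>2 / 2"] by linarith
      qed
      from mult_right_mono[OF this elim] show ?case by (simp add: algebra_simps)
    qed
  qed (use A(1) B(1) i integrable_min in simp_all)
  also have "\<dots> = 4 * ?J + (2 * (\<integral>x. indicator {x. \<xi> \<bullet> x \<le> - (pi / 2)} x * \<nu> x \<partial>lborel)
        + 2 * (\<integral>x. indicator {x. - \<xi> \<bullet> x \<le> - (pi / 2)} x * \<nu> x \<partial>lborel))"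
    using A(1) B(1) i by simp
  also have "\<dots> \<le> 4 * ?J + (2 * ?J + 2 * ?J)" using A(2) B(2) by simp
  finally show ?thesis by simp
qed simp

lemma exponent_scaleR_le_of_le_one:
  assumes "0 \<le> l" "l \<le> 1"
  shows "\<psi> (l *\<^sub>R \<xi>) \<le> 8 * \<psi> \<xi>"
proof -
  have l2: "l\<^sup>2 \<le> 1" using assms by (simp add: power_le_one)
  have "(\<integral>x. (1 - cos ((l *\<^sub>R \<xi>) \<bullet> x)) * \<nu> x \<partial>lborel) \<le> (\<integral>x. min 2 ((\<xi> \<bullet> x)\<^sup>2 / 2) * \<nu> x \<partial>lborel)"
  proof (rule integral_mono_AE)
    show "AE x in lborel. (1 - cos ((l *\<^sub>R \<xi>) \<bullet> x)) * \<nu> x \<le> min 2 ((\<xi> \<bullet> x)\<^sup>2 / 2) * \<nu> x"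
      using AE_nonneg
    proof eventually_elim
      case (elim x)
      have "1 - cos ((l *\<^sub>R \<xi>) \<bullet> x) \<le> min 2 ((l * (\<xi> \<bullet> x))\<^sup>2 / 2)"
        using one_minus_cos_le[of "l * (\<xi> \<bullet> x)"] by simp
      also have "\<dots> \<le> min 2 ((\<xi> \<bullet> x)\<^sup>2 / 2)"
        using mult_right_mono[OF l2, of "(\<xi> \<bullet> x)\<^sup>2"] by (intro min.mono) (simp_all add: power_mult_distrib)
      finally show ?case by (rule mult_right_mono[OF _ elim])
    qed
  qed (rule integrable_one_minus_cos integrable_min)+
  also have "\<dots> \<le> 8 * (\<integral>x. (1 - cos (\<xi> \<bullet> x)) * \<nu> x \<partial>lborel)" by (rule truncated_square_le_jump_part)
  finally have 1: "(\<integral>x. (1 - cos ((l *\<^sub>R \<xi>) \<bullet> x)) * \<nu> x \<partial>lborel) \<le> 8 * (\<integral>x. (1 - cos (\<xi> \<bullet> x)) * \<nu> x \<partial>lborel)" .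
  have "\<eta> * (norm (l *\<^sub>R \<xi>))\<^sup>2 = (\<eta> * (norm \<xi>)\<^sup>2) * l\<^sup>2" using assms by (simp add: power_mult_distrib)
  also have "\<dots> \<le> (\<eta> * (norm \<xi>)\<^sup>2) * 8" using l2 gauss_nonneg by (intro mult_left_mono) auto
  finally show ?thesis using 1 unfolding exponent_eq by simp
qed

text \<open>A factor \<open>l > 1\<close> is an integer times a factor below 1.\<close>

lemma exponent_scaleR_le:
  assumes l: "0 \<le> l"
  shows "\<psi> (l *\<^sub>R \<xi>) \<le> 8 * (1 + l)\<^sup>2 * \<psi> \<xi>"
proof -
  obtain n :: nat where n: "n > 0" "l \<le> real n" "real n \<le> 1 + l"
  proof (cases "l = 0")
    case True then show ?thesis using that[of 1] by simp
  next
    case False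
    then have "l > 0" using l by simp
    then show ?thesis using that[of "nat \<lceil>l\<rceil>"] by (simp add: of_nat_nat) linarith
  qed
  have "l *\<^sub>R \<xi> = real n *\<^sub>R ((l / real n) *\<^sub>R \<xi>)" using n by simp
  then have "\<psi> (l *\<^sub>R \<xi>) \<le> (real n)\<^sup>2 * \<psi> ((l / real n) *\<^sub>R \<xi>)" using exponent_multiple_le by metis
  also have "\<dots> \<le> (real n)\<^sup>2 * (8 * \<psi> \<xi>)"
    using n l by (intro mult_left_mono exponent_scaleR_le_of_le_one) auto
  also have "\<dots> \<le> (1 + l)\<^sup>2 * (8 * \<psi> \<xi>)"
    using n l exponent_nonneg[of \<xi>] by (intro mult_right_mono power_mono) auto
  finally show ?thesis by (simp add: algebra_simps)
qed

lemma exponent_continuous: "isCont \<psi> \<xi>"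
  unfolding continuous_at_sequentially
proof (intro allI impI)
  fix X :: "nat \<Rightarrow> 'a" assume "X \<longlonglongrightarrow> \<xi>"
  then have X: "X \<longlonglongrightarrow> \<xi>" .
  then have "convergent X" by (auto simp: convergent_def)
  then obtain R where R: "\<And>n. norm (X n) \<le> R" using convergent_imp_Bseq BseqE by metis
  have "(\<lambda>n. \<integral>x. (1 - cos (X n \<bullet> x)) * \<nu> x \<partial>lborel) \<longlonglongrightarrow> (\<integral>x. (1 - cos (\<xi> \<bullet> x)) * \<nu> x \<partial>lborel)"
  proof (rule integral_dominated_convergence)
    show "integrable lborel (\<lambda>x. (2 + R\<^sup>2) * (min 1 ((norm x)\<^sup>2) * \<nu> x))" using levy_integrable by simp
    show "AE x in lborel. norm ((1 - cos (X n \<bullet> x)) * \<nu> x) \<le> (2 + R\<^sup>2) * (min 1 ((norm x)\<^sup>2) * \<nu> x)" for n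
      using AE_nonneg
    proof eventually_elim
      case (elim x)
      have "1 - cos (X n \<bullet> x) \<le> (2 + (norm (X n))\<^sup>2) * min 1 ((norm x)\<^sup>2)"
        by (rule order_trans[OF one_minus_cos_le min_square_le])
      also have "\<dots> \<le> (2 + R\<^sup>2) * min 1 ((norm x)\<^sup>2)"
        using R[of n] by (intro mult_right_mono add_left_mono power_mono) auto
      finally have "(1 - cos (X n \<bullet> x)) * \<nu> x \<le> (2 + R\<^sup>2) * min 1 ((norm x)\<^sup>2) * \<nu> x" by (rule mult_right_mono[OF _ elim])
      then show ?case using elim by (simp add: mult.assoc abs_mult)
    qed
    show "AE x in lborel. (\<lambda>n. (1 - cos (X n \<bullet> x)) * \<nu> x) \<longlonglongrightarrow> (1 - cos (\<xi> \<bullet> x)) * \<nu> x"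
      by (intro AE_I2 tendsto_intros X)
  qed measurable
  then show "(\<psi> \<circ> X) \<longlonglongrightarrow> \<psi> \<xi>"
    unfolding o_def exponent_eq[abs_def] by (intro tendsto_intros X)
qed

lemma exponent_measurable [measurable]: "\<psi> \<in> borel_measurable borel"
  by (intro borel_measurable_continuous_onI continuous_at_imp_continuous_on ballI exponent_continuous)

end

lemma norm_radial_profile_choice:
  assumes "0 \<le> r" shows "norm (SOME x::'a::euclidean_space. norm x = r) = r"
proof -
  obtain x :: 'a where "norm x = r" using vector_choose_size[OF assms] by blast
  then show ?thesis by (rule someI[where P = "\<lambda>x. norm x = r"])
qed

context unimodal_exponent
begin

abbreviation "P \<equiv> radial_profile \<psi>"

lemma exponent_eq_profile: "\<psi> \<xi> = P (norm \<xi>)"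
  unfolding radial_profile_def by (rule exponent_radial) (simp add: norm_radial_profile_choice)

lemma profile_eq_exponent:
  assumes "norm e = 1" "0 \<le> r" shows "P r = \<psi> (r *\<^sub>R e)"
  using assms by (simp add: exponent_eq_profile)

lemma obtain_unit: obtains e :: 'a where "norm e = 1"
proof -
  obtain x :: 'a where "norm x = 1" using vector_choose_size[of 1] zero_le_one by blast
  then show ?thesis by (rule that)
qed

lemma profile_nonneg: "0 \<le> P r"
  unfolding radial_profile_def by (rule exponent_nonneg)

lemma profile_mult_le:
  assumes "0 \<le> l" "0 \<le> r" shows "P (l * r) \<le> 8 * (1 + l)\<^sup>2 * P r"
proof -
  obtain e :: 'a where e: "norm e = 1" by (rule obtain_unit)
  show ?thesis using exponent_scaleR_le[OF assms(1), of "r *\<^sub>R e"] assms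
    by (simp add: exponent_eq_profile e)
qed

lemma profile_mono_up_to_constant:
  assumes "0 \<le> s" "s \<le> r" shows "P s \<le> 8 * P r"
proof (cases "r = 0")
  case False
  obtain e :: 'a where e: "norm e = 1" by (rule obtain_unit)
  have "\<psi> ((s / r) *\<^sub>R (r *\<^sub>R e)) \<le> 8 * \<psi> (r *\<^sub>R e)"
    by (rule exponent_scaleR_le_of_le_one) (use assms False in auto)
  then show ?thesis using assms False by (simp add: exponent_eq_profile e)
qed (use assms profile_nonneg[of 0] in auto)

lemma profile_continuous: assumes "0 < r" shows "isCont P r"
proof -
  obtain e :: 'a where e: "norm e = 1" by (rule obtain_unit)
  have "isCont (\<lambda>r. \<psi> (r *\<^sub>R e)) r"
    by (rule isCont_o2[where f = "\<lambda>r. r *\<^sub>R e" and g = \<psi>]) (auto intro: exponent_continuous)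
  moreover have "eventually (\<lambda>s. \<psi> (s *\<^sub>R e) = P s) (nhds r)"
    using eventually_nhds_in_open[of "{0<..}" r] assms
    by (auto elim!: eventually_mono simp: profile_eq_exponent[OF e])
  ultimately show ?thesis using isCont_cong[of "\<lambda>s. \<psi> (s *\<^sub>R e)" P r] by simp
qed

lemma gaussian_square_integrable:
  "integrable std_gaussian (\<lambda>\<xi>::'a. (1 + c * norm \<xi>)\<^sup>2)"
proof (rule Bochner_Integration.integrable_bound)
  interpret prob_space "std_gaussian :: 'a measure" by (rule prob_space_std_gaussian)
  show "integrable std_gaussian (\<lambda>\<xi>::'a. 2 + 2 * c\<^sup>2 * (norm \<xi>)\<^sup>2)"
    by (intro Bochner_Integration.integrable_add integrable_const Bochner_Integration.integrable_mult_right std_gaussian_integrable_norm_sq)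
  have "(1 + c * x)\<^sup>2 \<le> 2 + 2 * c\<^sup>2 * x\<^sup>2" for x :: real
    using zero_le_power2[of "1 - c * x"] by (simp add: power2_eq_square algebra_simps)
  then show "AE \<xi> in (std_gaussian :: 'a measure). norm ((1 + c * norm \<xi>)\<^sup>2) \<le> norm (2 + 2 * c\<^sup>2 * (norm \<xi>)\<^sup>2)"
    by (intro AE_I2) (simp add: abs_of_nonneg)
qed measurable

lemma exponent_le_profile_one: "\<psi> (c *\<^sub>R \<xi>) \<le> 8 * P 1 * (1 + \<bar>c\<bar> * norm \<xi>)\<^sup>2"
  using profile_mult_le[of "\<bar>c\<bar> * norm \<xi>" 1] by (simp add: exponent_eq_profile mult_ac)

lemma exponent_gaussian_integrable: "integrable std_gaussian (\<lambda>\<xi>. \<psi> (c *\<^sub>R \<xi>))"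
proof (rule Bochner_Integration.integrable_bound)
  show "integrable std_gaussian (\<lambda>\<xi>::'a. 8 * P 1 * (1 + \<bar>c\<bar> * norm \<xi>)\<^sup>2)"
    using gaussian_square_integrable[of "\<bar>c\<bar>"] by simp
  show "AE \<xi> in std_gaussian. norm (\<psi> (c *\<^sub>R \<xi>)) \<le> norm (8 * P 1 * (1 + \<bar>c\<bar> * norm \<xi>)\<^sup>2)"
  proof (rule AE_I2)
    fix \<xi> :: 'a
    have "0 \<le> 8 * P 1 * (1 + \<bar>c\<bar> * norm \<xi>)\<^sup>2" using profile_nonneg by simp
    then show "norm (\<psi> (c *\<^sub>R \<xi>)) \<le> norm (8 * P 1 * (1 + \<bar>c\<bar> * norm \<xi>)\<^sup>2)"
      using exponent_le_profile_one[of c \<xi>] exponent_nonneg[of "c *\<^sub>R \<xi>"] by simp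
  qed
qed measurable

end

lemma gaussian_average_one_minus_cos:
  fixes y :: "'a::euclidean_space"
  assumes s: "0 \<le> s"
  shows "(\<integral>\<xi>. 1 - cos ((sqrt (2 * s) *\<^sub>R \<xi>) \<bullet> y) \<partial>std_gaussian) = 1 - exp (- (s * (norm y)\<^sup>2))"
proof -
  interpret prob_space "std_gaussian :: 'a measure" by (rule prob_space_std_gaussian)
  have "integrable (std_gaussian :: 'a measure) (\<lambda>\<xi>. cos (\<xi> \<bullet> (sqrt (2 * s) *\<^sub>R y)))"
    by (rule integrable_const_bound[of _ 1]) auto
  then have "(\<integral>\<xi>. 1 - cos (\<xi> \<bullet> (sqrt (2 * s) *\<^sub>R y)) \<partial>std_gaussian) = 1 - exp (- (norm (sqrt (2 * s) *\<^sub>R y))\<^sup>2 / 2)"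
    using prob_space by (subst Bochner_Integration.integral_diff) (simp_all add: std_gaussian_characteristic_function del: inner_scaleR_right norm_scaleR)
  then show ?thesis using s by (simp add: power_mult_distrib)
qed

lemma one_minus_exp_le_min:
  fixes s u :: real assumes "0 \<le> s" "0 \<le> u"
  shows "1 - exp (- (s * u)) \<le> (1 + s) * min 1 u"
proof -
  have "1 - exp (- (s * u)) \<le> s * u" using exp_ge_add_one_self[of "- (s * u)"] by simp
  also have "\<dots> \<le> (1 + s) * u" using assms by (simp add: mult_right_mono)
  finally have 1: "1 - exp (- (s * u)) \<le> (1 + s) * u" .
  have "1 - exp (- (s * u)) \<le> 1" by simp
  then have 2: "1 - exp (- (s * u)) \<le> (1 + s) * 1" using assms(1) by (simp add: add_increasing2)
  show ?thesis using 1 2 by (cases "u \<le> 1") (simp_all only: min_absorb1 min_absorb2 not_le less_imp_le)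
qed

context unimodal_exponent
begin

lemma laplace_integrable:
  assumes "0 \<le> s" shows "integrable lborel (\<lambda>y. (1 - exp (- (s * (norm y)\<^sup>2))) * \<nu> y)"
proof (rule integrable_levy[where C = "1 + s"])
  fix y :: 'a
  have "0 \<le> 1 - exp (- (s * (norm y)\<^sup>2))" using assms by simp
  then show "\<bar>1 - exp (- (s * (norm y)\<^sup>2))\<bar> \<le> (1 + s) * min 1 ((norm y)\<^sup>2)"
    using one_minus_exp_le_min[OF assms, of "(norm y)\<^sup>2"] by simp
qed measurable

text \<open>Tonelli's theorem for the jump part. The Gaussian coefficient contributes a term linear in \<open>s\<close>.\<close>

lemma exponent_gaussian_average:
  assumes s: "0 \<le> s"
  shows "(\<integral>\<xi>. \<psi> (sqrt (2 * s) *\<^sub>R \<xi>) \<partial>std_gaussian)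
    = (\<integral>y. (1 - exp (- (s * (norm y)\<^sup>2))) * \<nu> y \<partial>lborel) + 2 * \<eta> * (\<integral>\<xi>. (norm (\<xi>::'a))\<^sup>2 \<partial>std_gaussian) * s"
proof -
  interpret G: prob_space "std_gaussian :: 'a measure" by (rule prob_space_std_gaussian)
  interpret pair_sigma_finite "std_gaussian :: 'a measure" "lborel :: 'a measure" by unfold_locales
  let ?c = "sqrt (2 * s)"
  define J where "J \<xi> = (\<integral>y. (1 - cos ((?c *\<^sub>R \<xi>) \<bullet> y)) * \<nu> y \<partial>lborel)" for \<xi>
  have \<psi>J: "\<psi> (?c *\<^sub>R \<xi>) = J \<xi> + 2 * \<eta> * s * (norm \<xi>)\<^sup>2" for \<xi>
    unfolding exponent_eq J_def using s by (simp add: power_mult_distrib)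
  have Jeq: "J = (\<lambda>\<xi>. \<psi> (?c *\<^sub>R \<xi>) - 2 * \<eta> * s * (norm \<xi>)\<^sup>2)" using \<psi>J by (intro ext) simp
  have iJ: "integrable std_gaussian J"
    unfolding Jeq using exponent_gaussian_integrable[of ?c] std_gaussian_integrable_norm_sq[where 'a = 'a] by simp
  have J0: "0 \<le> J \<xi>" for \<xi> unfolding J_def by (rule jump_part_nonneg)
  have "ennreal (\<integral>\<xi>. J \<xi> \<partial>std_gaussian) = (\<integral>\<^sup>+\<xi>. ennreal (J \<xi>) \<partial>std_gaussian)"
    using nn_integral_eq_integral[OF iJ] J0 by simp
  also have "\<dots> = (\<integral>\<^sup>+\<xi>. (\<integral>\<^sup>+y. ennreal ((1 - cos ((?c *\<^sub>R \<xi>) \<bullet> y)) * \<nu> y) \<partial>lborel) \<partial>std_gaussian)"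
  proof (rule nn_integral_cong)
    fix \<xi> :: 'a
    have "AE y in lborel. 0 \<le> (1 - cos ((?c *\<^sub>R \<xi>) \<bullet> y)) * \<nu> y" using AE_nonneg by eventually_elim simp
    then show "ennreal (J \<xi>) = (\<integral>\<^sup>+y. ennreal ((1 - cos ((?c *\<^sub>R \<xi>) \<bullet> y)) * \<nu> y) \<partial>lborel)"
      unfolding J_def by (rule nn_integral_eq_integral[OF integrable_one_minus_cos, symmetric])
  qed
  also have "\<dots> = (\<integral>\<^sup>+y. (\<integral>\<^sup>+\<xi>. ennreal ((1 - cos ((?c *\<^sub>R \<xi>) \<bullet> y)) * \<nu> y) \<partial>std_gaussian) \<partial>lborel)"
    by (rule Fubini'[symmetric]) measurable
  also have "\<dots> = (\<integral>\<^sup>+y. ennreal ((1 - exp (- (s * (norm y)\<^sup>2))) * \<nu> y) \<partial>lborel)"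
  proof (rule nn_integral_cong_AE)
    show "AE y in lborel. (\<integral>\<^sup>+\<xi>. ennreal ((1 - cos ((?c *\<^sub>R \<xi>) \<bullet> y)) * \<nu> y) \<partial>std_gaussian) = ennreal ((1 - exp (- (s * (norm y)\<^sup>2))) * \<nu> y)"
      using AE_nonneg
    proof eventually_elim
      case (elim y)
      have "integrable (std_gaussian :: 'a measure) (\<lambda>\<xi>. 1 - cos ((?c *\<^sub>R \<xi>) \<bullet> y))"
      proof (rule G.integrable_const_bound[of _ 2])
        have "\<bar>1 - cos x\<bar> \<le> 2" for x :: real using cos_ge_minus_one[of x] cos_le_one[of x] by linarith
        then show "AE \<xi> in (std_gaussian :: 'a measure). norm (1 - cos ((?c *\<^sub>R \<xi>) \<bullet> y)) \<le> 2" by simp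
      qed measurable
      then have "(\<integral>\<^sup>+\<xi>. ennreal ((1 - cos ((?c *\<^sub>R \<xi>) \<bullet> y)) * \<nu> y) \<partial>std_gaussian) = ennreal (\<integral>\<xi>. (1 - cos ((?c *\<^sub>R \<xi>) \<bullet> y)) * \<nu> y \<partial>std_gaussian)"
        by (intro nn_integral_eq_integral) (use elim in auto)
      then show ?case using gaussian_average_one_minus_cos[OF s, of y] by simp
    qed
  qed
  also have "\<dots> = ennreal (\<integral>y. (1 - exp (- (s * (norm y)\<^sup>2))) * \<nu> y \<partial>lborel)"
  proof (rule nn_integral_eq_integral[OF laplace_integrable[OF s]])
    show "AE y in lborel. 0 \<le> (1 - exp (- (s * (norm y)\<^sup>2))) * \<nu> y"
      using AE_nonneg by eventually_elim (use s in simp)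
  qed
  finally have "(\<integral>\<xi>. J \<xi> \<partial>std_gaussian) = (\<integral>y. (1 - exp (- (s * (norm y)\<^sup>2))) * \<nu> y \<partial>lborel)"
  proof (subst (asm) ennreal_inj)
    show "0 \<le> (\<integral>y. (1 - exp (- (s * (norm y)\<^sup>2))) * \<nu> y \<partial>lborel)"
    proof (rule integral_nonneg_AE)
      show "AE y in lborel. 0 \<le> (1 - exp (- (s * (norm y)\<^sup>2))) * \<nu> y"
        using AE_nonneg by eventually_elim (use s in simp)
    qed
    show "0 \<le> (\<integral>\<xi>. J \<xi> \<partial>std_gaussian)" using J0 by simp
  qed simp
  then show ?thesis unfolding \<psi>J using iJ std_gaussian_integrable_norm_sq[where 'a = 'a] by simp
qed

end

section \<open>Asymptotics of the transition densities\<close>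

text \<open>The process enters through the Gaussian form of the Laplace transforms of its marginal laws and the
monotonicity of their densities.\<close>

locale unimodal_semigroup = unimodal_exponent \<psi> \<eta> \<nu>
  for \<psi> :: "'a::euclidean_space \<Rightarrow> real" and \<eta> \<nu> +
  fixes p :: "real \<Rightarrow> 'a \<Rightarrow> real"
  assumes p_measurable: "0 < t \<Longrightarrow> p t \<in> borel_measurable borel"
    and p_nonneg: "0 < t \<Longrightarrow> x \<noteq> 0 \<Longrightarrow> 0 \<le> p t x"
    and p_antimono: "0 < t \<Longrightarrow> x \<noteq> 0 \<Longrightarrow> norm x \<le> norm y \<Longrightarrow> p t y \<le> p t x"
    and p_integrable: "0 < t \<Longrightarrow> 0 < s \<Longrightarrow> integrable lborel (\<lambda>y. (1 - exp (- (s * (norm y)\<^sup>2))) * p t y)"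
    and p_laplace: "0 < t \<Longrightarrow> 0 < s \<Longrightarrow> (\<integral>y. (1 - exp (- (s * (norm y)\<^sup>2))) * p t y \<partial>lborel)
        = (\<integral>\<xi>. 1 - exp (- (t * \<psi> (sqrt (2 * s) *\<^sub>R \<xi>))) \<partial>std_gaussian)"
begin

text \<open>The measures \<open>p(t,x)/t dx\<close> converge to \<open>\<nu>(x) dx\<close> away from the origin, and the Gaussian part collapses
to the origin, where test functions with support in an annulus do not see it. Monotonicity turns this into bounds on the densities.\<close>

lemma small_time_density:
  assumes x: "x \<noteq> 0"
    and t: "\<And>n. 0 < t n" "t \<longlonglongrightarrow> 0"
  shows "norm x < norm z \<Longrightarrow> A < \<nu> z \<Longrightarrow> eventually (\<lambda>n. A < p (t n) x / t n) sequentially"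
    and "z \<noteq> 0 \<Longrightarrow> norm z < norm x \<Longrightarrow> \<nu> z < A \<Longrightarrow> eventually (\<lambda>n. p (t n) x / t n < A) sequentially"
proof -
  let ?\<beta> = "2 * \<eta> * (\<integral>\<xi>. (norm (\<xi>::'a))\<^sup>2 \<partial>std_gaussian)"
  have L: "(\<lambda>n. (1 / t n) * (\<integral>y. (1 - exp (- (real k * (norm (y /\<^sub>R 1))\<^sup>2))) * p (t n) y \<partial>lborel))
        \<longlonglongrightarrow> (\<integral>y. (1 - exp (- (real k * (norm y)\<^sup>2))) * \<nu> y \<partial>lborel) + ?\<beta> * real k" if k: "k > 0" for k
  proof -
    let ?c = "sqrt (2 * real k)"
    have "(\<lambda>n. \<integral>\<xi>. (1 - exp (- (t n * \<psi> (?c *\<^sub>R \<xi>)))) / t n \<partial>std_gaussian) \<longlonglongrightarrow> (\<integral>\<xi>. \<psi> (?c *\<^sub>R \<xi>) \<partial>std_gaussian)"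
    proof (rule integral_dominated_convergence)
      show "integrable std_gaussian (\<lambda>\<xi>. \<psi> (?c *\<^sub>R \<xi>))" by (rule exponent_gaussian_integrable)
      show "AE \<xi> in std_gaussian. norm ((1 - exp (- (t n * \<psi> (?c *\<^sub>R \<xi>)))) / t n) \<le> \<psi> (?c *\<^sub>R \<xi>)" for n
      proof (rule AE_I2)
        fix \<xi> :: 'a
        have "0 \<le> t n * \<psi> (?c *\<^sub>R \<xi>)" using t(1)[of n] exponent_nonneg by simp
        moreover have "1 - exp (- (t n * \<psi> (?c *\<^sub>R \<xi>))) \<le> t n * \<psi> (?c *\<^sub>R \<xi>)"
          using exp_ge_add_one_self[of "- (t n * \<psi> (?c *\<^sub>R \<xi>))"] by simp
        ultimately show "norm ((1 - exp (- (t n * \<psi> (?c *\<^sub>R \<xi>)))) / t n) \<le> \<psi> (?c *\<^sub>R \<xi>)"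
          using t(1)[of n] by (simp add: pos_divide_le_eq mult.commute)
      qed
      show "AE \<xi> in std_gaussian. (\<lambda>n. (1 - exp (- (t n * \<psi> (?c *\<^sub>R \<xi>)))) / t n) \<longlonglongrightarrow> \<psi> (?c *\<^sub>R \<xi>)"
      proof (rule AE_I2)
        fix \<xi> :: 'a
        have "((\<lambda>h. 1 - exp (- (h * \<psi> (?c *\<^sub>R \<xi>)))) has_real_derivative \<psi> (?c *\<^sub>R \<xi>)) (at 0)"
          by (auto intro!: derivative_eq_intros)
        then have "((\<lambda>h. (1 - exp (- (h * \<psi> (?c *\<^sub>R \<xi>)))) / h) \<longlongrightarrow> \<psi> (?c *\<^sub>R \<xi>)) (at 0)"
          by (simp add: DERIV_def)
        moreover have "filterlim t (at 0) sequentially"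
          unfolding filterlim_at using t(2) less_imp_neq[OF t(1), symmetric] by simp
        ultimately show "(\<lambda>n. (1 - exp (- (t n * \<psi> (?c *\<^sub>R \<xi>)))) / t n) \<longlonglongrightarrow> \<psi> (?c *\<^sub>R \<xi>)"
          by (rule filterlim_compose)
      qed
    qed measurable
    also have "(\<integral>\<xi>. \<psi> (?c *\<^sub>R \<xi>) \<partial>std_gaussian) = (\<integral>y. (1 - exp (- (real k * (norm y)\<^sup>2))) * \<nu> y \<partial>lborel) + ?\<beta> * real k"
      by (rule exponent_gaussian_average) simp
    finally show ?thesis using t(1) k by (simp add: p_laplace)
  qed
  have "integrable lborel (\<lambda>y. (1 - exp (- (norm (y /\<^sub>R 1))\<^sup>2)) * p (t n) y)" for n
    using p_integrable[OF t(1), of 1 n] by simp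
  moreover have "integrable lborel (\<lambda>y. (1 - exp (- (norm y)\<^sup>2)) * \<nu> y)"
    using laplace_integrable[of 1] by simp
  ultimately have *: "norm x < norm z \<Longrightarrow> A < \<nu> z \<Longrightarrow> eventually (\<lambda>n. A < 1 / t n * 1 ^ DIM('a) * p (t n) (1 *\<^sub>R x)) sequentially"
    "z \<noteq> 0 \<Longrightarrow> norm z < norm x \<Longrightarrow> \<nu> z < A \<Longrightarrow> eventually (\<lambda>n. 1 / t n * 1 ^ DIM('a) * p (t n) (1 *\<^sub>R x) < A) sequentially"
    using eventually_density_greater[of "\<lambda>n. p (t n)" \<nu> "\<lambda>n. 1" "\<lambda>n. 1 / t n" ?\<beta>, OF p_measurable[OF t(1)] p_nonneg[OF t(1)] p_antimono[OF t(1)] density_measurable density_nonneg density_antimono _ _ _ _ L x]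
     eventually_density_less[of "\<lambda>n. p (t n)" \<nu> "\<lambda>n. 1" "\<lambda>n. 1 / t n" ?\<beta>, OF p_measurable[OF t(1)] p_nonneg[OF t(1)] p_antimono[OF t(1)] density_measurable density_nonneg density_antimono _ _ _ _ L]
      less_imp_le[OF t(1)] by (simp_all add: less_imp_le[OF t(1)])
  show "norm x < norm z \<Longrightarrow> A < \<nu> z \<Longrightarrow> eventually (\<lambda>n. A < p (t n) x / t n) sequentially"
    and "z \<noteq> 0 \<Longrightarrow> norm z < norm x \<Longrightarrow> \<nu> z < A \<Longrightarrow> eventually (\<lambda>n. p (t n) x / t n < A) sequentially"
    using * by simp_all
qed

end

context unimodal_semigroup
begin

text \<open>For fixed \<open>x\<close> the condition \<open>t \<psi>(1/|x|) \<le> \<delta>\<close> holds for small \<open>t\<close>. Letting \<open>t\<close> tend to zero compares \<open>\<nu>(x)\<close>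
with the asymptotic expression \<open>Q\<close> at slightly smaller and slightly larger radii, and \<open>Q\<close> is
continuous.\<close>

lemma levy_density_asymptotics:
  assumes c: "c > 0"
    and joint: "\<forall>\<epsilon>>0. \<exists>\<delta>>0. \<forall>t>0. \<forall>x.
         norm x \<ge> inverse \<delta> \<and> t * P (inverse (norm x)) \<le> \<delta> \<longrightarrow>
         \<bar>p t x / (norm x powr (- real DIM('a)) * t * P (inverse (norm x))) - c\<bar> < \<epsilon>"
  shows "((\<lambda>x. \<nu> x / (norm x powr (- real DIM('a)) * P (inverse (norm x)))) \<longlongrightarrow> c) at_infinity"
proof (rule tendstoI)
  fix \<epsilon>0 :: real assume \<epsilon>0: "\<epsilon>0 > 0"
  define \<epsilon> where "\<epsilon> = min (\<epsilon>0 / 2) (c / 2)"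
  have \<epsilon>: "0 < \<epsilon>" "\<epsilon> < \<epsilon>0" "\<epsilon> < c" using \<epsilon>0 c by (auto simp: \<epsilon>_def min_def)
  define Q where "Q x = norm x powr (- real DIM('a)) * P (inverse (norm x))" for x :: 'a
  obtain \<delta> where \<delta>: "\<delta> > 0" and near: "\<forall>t>0. \<forall>x.
         norm x \<ge> inverse \<delta> \<and> t * P (inverse (norm x)) \<le> \<delta> \<longrightarrow>
         \<bar>p t x / (norm x powr (- real DIM('a)) * t * P (inverse (norm x))) - c\<bar> < \<epsilon>"
    using joint[rule_format, OF \<epsilon>(1)] by (elim exE conjE)
  have quot: "\<bar>p t x / (Q x * t) - c\<bar> < \<epsilon>" if "0 < t" "inverse \<delta> \<le> norm x" "t * P (inverse (norm x)) \<le> \<delta>" for t x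
    using near[rule_format, of t x] that by (simp add: Q_def mult_ac)
  have Qpos: "Q x > 0" if x: "inverse \<delta> \<le> norm x" for x
  proof -
    define t where "t = \<delta> / (P (inverse (norm x)) + 1)"
    have pos: "P (inverse (norm x)) + 1 > 0" using profile_nonneg[of "inverse (norm x)"] by linarith
    have t: "t > 0" using \<delta> pos by (simp add: t_def)
    have "t * P (inverse (norm x)) \<le> t * (P (inverse (norm x)) + 1)" using t by (intro mult_left_mono) auto
    also have "\<dots> = \<delta>" using pos by (simp add: t_def)
    finally have "\<bar>p t x / (Q x * t) - c\<bar> < \<epsilon>" by (rule quot[OF t x])
    then have "Q x \<noteq> 0" using \<epsilon> by (intro notI) simp
    moreover have "0 \<le> Q x" unfolding Q_def using profile_nonneg by simp
    ultimately show ?thesis by simp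
  qed
  define t where "t n = 1 / real (Suc n)" for n
  have t: "\<And>n. 0 < t n" "t \<longlonglongrightarrow> 0"
    unfolding t_def by (simp, rule LIMSEQ_Suc[OF lim_1_over_n])
  have small: "eventually (\<lambda>n. (c - \<epsilon>) * Q x < p (t n) x / t n \<and> p (t n) x / t n < (c + \<epsilon>) * Q x) sequentially"
    if x: "inverse \<delta> \<le> norm x" for x
  proof -
    have "(\<lambda>n. t n * P (inverse (norm x))) \<longlonglongrightarrow> 0 * P (inverse (norm x))" by (intro tendsto_intros t)
    then have "eventually (\<lambda>n. t n * P (inverse (norm x)) < \<delta>) sequentially"
      using \<delta> by (intro order_tendstoD(2)[of _ 0]) auto
    then show ?thesis
    proof eventually_elim
      case (elim n)
      have "\<bar>p (t n) x / (Q x * t n) - c\<bar> < \<epsilon>" by (rule quot[OF t(1) x]) (use elim in simp)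
      moreover have "p (t n) x / (Q x * t n) = (p (t n) x / t n) / Q x" by simp
      ultimately have "\<bar>(p (t n) x / t n) / Q x - c\<bar> < \<epsilon>" by (simp only:)
      then have "c - \<epsilon> < (p (t n) x / t n) / Q x" "(p (t n) x / t n) / Q x < c + \<epsilon>"
        unfolding abs_less_iff by linarith+
      then show ?case using Qpos[OF x] by (simp only: pos_less_divide_eq pos_divide_less_eq)
    qed
  qed
  have Qcont: "((\<lambda>l. k * Q (l *\<^sub>R x)) \<longlongrightarrow> k * Q x) (at 1 within S)" if x: "x \<noteq> 0" for x :: 'a and S and k :: real
  proof -
    have "isCont (\<lambda>l. k * ((l * norm x) powr (- real DIM('a)) * P (inverse (l * norm x)))) 1"
    proof -
      have "isCont (\<lambda>l. inverse (l * norm x)) 1" using x by (intro continuous_intros) auto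
      moreover have "isCont P (inverse (1 * norm x))" using x by (intro profile_continuous) auto
      ultimately have "isCont (\<lambda>l. P (inverse (l * norm x))) 1" by (rule isCont_o2)
      moreover have "isCont (\<lambda>l. (l * norm x) powr (- real DIM('a))) 1" using x by (intro continuous_intros) auto
      ultimately show ?thesis by (intro isCont_mult continuous_const)
    qed
    then have "((\<lambda>l. k * ((l * norm x) powr (- real DIM('a)) * P (inverse (l * norm x)))) \<longlongrightarrow> k * Q x) (at 1 within S)"
      using tendsto_within_subset[where S = UNIV and x = "1::real" and T = S] unfolding isCont_def Q_def by force
    moreover have "eventually (\<lambda>l. k * ((l * norm x) powr (- real DIM('a)) * P (inverse (l * norm x))) = k * Q (l *\<^sub>R x)) (at 1 within S)"
      unfolding eventually_at by (rule exI[of _ 1]) (auto simp: Q_def dist_real_def abs_less_iff abs_if split: if_splits)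
    ultimately show ?thesis by (rule Lim_transform_eventually)
  qed
  have "dist (\<nu> x / Q x) c < \<epsilon>0" if x: "norm x > inverse \<delta>" for x
  proof -
    have np: "norm x > 0" using x \<delta> by (meson inverse_positive_iff_positive less_trans)
    then have x0: "x \<noteq> 0" by auto
    have up: "\<nu> x \<le> (c + \<epsilon>) * Q y" if y: "norm y < norm x" "inverse \<delta> \<le> norm y" for y
    proof (rule ccontr)
      assume "\<not> \<nu> x \<le> (c + \<epsilon>) * Q y"
      then have A: "(c + \<epsilon>) * Q y < \<nu> x" by simp
      have y0: "y \<noteq> 0" using y \<delta> by auto
      have "eventually (\<lambda>n. (c + \<epsilon>) * Q y < p (t n) y / t n) sequentially"
        by (rule small_time_density(1)[OF y0 t y(1) A])
      with small[OF y(2)] have "eventually (\<lambda>n. False) sequentially" by eventually_elim auto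
      then show False by simp
    qed
    have lo: "(c - \<epsilon>) * Q y \<le> \<nu> x" if y: "norm x < norm y" for y
    proof (rule ccontr)
      assume "\<not> (c - \<epsilon>) * Q y \<le> \<nu> x"
      then have A: "\<nu> x < (c - \<epsilon>) * Q y" by simp
      have y0: "y \<noteq> 0" and y1: "inverse \<delta> \<le> norm y" using y x by auto
      have "eventually (\<lambda>n. p (t n) y / t n < (c - \<epsilon>) * Q y) sequentially"
        by (rule small_time_density(2)[OF y0 t x0 y A])
      with small[OF y1] have "eventually (\<lambda>n. False) sequentially" by eventually_elim auto
      then show False by simp
    qed
    have "\<nu> x \<le> (c + \<epsilon>) * Q x"
    proof (rule tendsto_lowerbound[OF Qcont[OF x0]])
      have "inverse \<delta> / norm x < 1" using x np by simp
      then have "eventually (\<lambda>l. l \<in> {inverse \<delta> / norm x<..<1}) (at_left (1::real))"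
        by (intro eventually_at_leftI[where a = "inverse \<delta> / norm x"]) auto
      then show "eventually (\<lambda>l. \<nu> x \<le> (c + \<epsilon>) * Q (l *\<^sub>R x)) (at_left 1)"
      proof eventually_elim
        case (elim l)
        have "inverse \<delta> / norm x > 0" using \<delta> np by simp
        moreover have "inverse \<delta> / norm x < l" using elim by simp
        ultimately have "0 < l" by (rule less_trans)
        moreover have "inverse \<delta> \<le> l * norm x" "l < 1" using elim np by (auto simp: pos_divide_less_eq)
        ultimately have l: "0 < l" "l < 1" "inverse \<delta> \<le> l * norm x" by blast+
        show ?case by (rule up) (use l np in auto)
      qed
    qed simp
    moreover have "(c - \<epsilon>) * Q x \<le> \<nu> x"
    proof (rule tendsto_upperbound[OF Qcont[OF x0]])
      have "eventually (\<lambda>l. l \<in> {1<..<2}) (at_right (1::real))"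
        by (rule eventually_at_rightI[of _ 2]) auto
      then show "eventually (\<lambda>l. (c - \<epsilon>) * Q (l *\<^sub>R x) \<le> \<nu> x) (at_right 1)"
        by eventually_elim (rule lo, use np in auto)
    qed simp
    ultimately have "c - \<epsilon> \<le> \<nu> x / Q x" "\<nu> x / Q x \<le> c + \<epsilon>"
      using Qpos[of x] x by (simp_all add: pos_le_divide_eq pos_divide_le_eq)
    then show ?thesis using \<epsilon>(2) by (simp add: dist_real_def abs_less_iff)
  qed
  then show "eventually (\<lambda>x. dist (\<nu> x / (norm x powr (- real DIM('a)) * P (inverse (norm x)))) c < \<epsilon>0) at_infinity"
    unfolding Q_def[symmetric] eventually_at_infinity by (intro exI[of _ "inverse \<delta> + 1"]) auto
qed

lemma regular_variation_sequence:
  assumes rv: "regularly_varying_at_zero \<alpha> P" and r: "filterlim r at_top sequentially" and l: "0 < l"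
  shows "(\<lambda>n. P (l / r n) / P (1 / r n)) \<longlonglongrightarrow> l powr \<alpha>"
proof -
  have "((\<lambda>x. inverse (P (inverse (inverse l * x))) / inverse (P (inverse x))) \<longlongrightarrow> inverse l powr \<alpha>) at_top"
  proof -
    have "\<forall>l>0. ((\<lambda>x. inverse (P (inverse (l * x))) / inverse (P (inverse x))) \<longlongrightarrow> l powr \<alpha>) at_top"
      using rv unfolding regularly_varying_at_zero_def regularly_varying_at_infinity_def by (rule conjunct2)
    from this[rule_format, of "inverse l"] show ?thesis using l by (simp only: positive_imp_inverse_positive)
  qed
  then have "(\<lambda>n. inverse (P (inverse (inverse l * r n))) / inverse (P (inverse (r n)))) \<longlonglongrightarrow> inverse l powr \<alpha>"
    by (rule filterlim_compose[OF _ r])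
  from tendsto_inverse[OF this] have "(\<lambda>n. inverse (inverse (P (inverse (inverse l * r n))) / inverse (P (inverse (r n))))) \<longlonglongrightarrow> inverse (inverse l powr \<alpha>)"
    using l by simp
  then show ?thesis using l by (simp add: divide_inverse inverse_powr mult.commute)
qed

text \<open>Dominated convergence under the Gaussian measure: regular variation gives the pointwise limit, and
\<open>profile_mult_le\<close> a quadratic majorant that does not depend on \<open>n\<close>. The factor \<open>1 - e\<^sup>-\<^sup>a\<close> is
squeezed between \<open>a/(1+a)\<close> and \<open>a\<close>.\<close>

lemma scaled_laplace_limit:
  assumes rv: "regularly_varying_at_zero \<alpha> P" and \<alpha>: "0 < \<alpha>" and r: "filterlim r at_top sequentially" "\<And>n. 0 < r n"
    and t: "\<And>n. 0 < t n" and pos: "\<And>n. 0 < P (1 / r n)" and lim: "(\<lambda>n. t n * P (1 / r n)) \<longlonglongrightarrow> 0" and s: "0 < s"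
  shows "(\<lambda>n. 1 / (t n * P (1 / r n)) * (\<integral>y. (1 - exp (- (s * (norm (y /\<^sub>R r n))\<^sup>2))) * p (t n) y \<partial>lborel))
    \<longlonglongrightarrow> (\<integral>\<xi>. (sqrt (2 * s) * norm (\<xi>::'a)) powr \<alpha> \<partial>std_gaussian)"
proof -
  define a where "a n \<xi> = t n * \<psi> ((sqrt (2 * s) / r n) *\<^sub>R \<xi>)" for n and \<xi> :: 'a
  define b where "b n = t n * P (1 / r n)" for n
  have b: "0 < b n" for n using t pos by (simp add: b_def)
  have a0: "0 \<le> a n \<xi>" for n \<xi> using t[of n] exponent_nonneg by (simp add: a_def)
  have aP: "a n \<xi> / b n = P (sqrt (2 * s) * norm \<xi> / r n) / P (1 / r n)" for n \<xi>
    using t[of n] s r(2)[of n] by (simp add: a_def b_def exponent_eq_profile)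
  have ab: "a n \<xi> / b n \<le> 8 * (1 + sqrt (2 * s) * norm \<xi>)\<^sup>2" for n \<xi>
  proof -
    have "P ((sqrt (2 * s) * norm \<xi>) * (1 / r n)) \<le> 8 * (1 + sqrt (2 * s) * norm \<xi>)\<^sup>2 * P (1 / r n)"
      by (rule profile_mult_le) (use s r(2)[of n] in auto)
    then show ?thesis unfolding aP using pos[of n] by (simp add: pos_divide_le_eq)
  qed
  have am [measurable]: "a n \<in> borel_measurable borel" for n unfolding a_def by measurable
  have up: "1 - exp (- x) \<le> x" and low: "x / (1 + x) \<le> 1 - exp (- x)" if "0 \<le> x" for x :: real
  proof -
    show "1 - exp (- x) \<le> x" using exp_ge_add_one_self[of "- x"] by simp
    have "exp (- x) \<le> 1 / (1 + x)"
      using exp_ge_add_one_self[of x] that by (simp add: exp_minus field_simps)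
    moreover have "x / (1 + x) = 1 - 1 / (1 + x)" using that by (simp add: field_simps)
    ultimately show "x / (1 + x) \<le> 1 - exp (- x)" by simp
  qed
  have "(\<lambda>n. \<integral>\<xi>. (1 - exp (- a n \<xi>)) / b n \<partial>std_gaussian) \<longlonglongrightarrow> (\<integral>\<xi>. (sqrt (2 * s) * norm (\<xi>::'a)) powr \<alpha> \<partial>std_gaussian)"
  proof (rule integral_dominated_convergence)
    show "integrable std_gaussian (\<lambda>\<xi>::'a. 8 * (1 + sqrt (2 * s) * norm \<xi>)\<^sup>2)"
      using gaussian_square_integrable[of "sqrt (2 * s)"] by simp
    show "AE \<xi> in std_gaussian. norm ((1 - exp (- a n \<xi>)) / b n) \<le> 8 * (1 + sqrt (2 * s) * norm \<xi>)\<^sup>2" for n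
    proof (rule AE_I2)
      fix \<xi> :: 'a
      have "norm ((1 - exp (- a n \<xi>)) / b n) = (1 - exp (- a n \<xi>)) / b n"
        using a0[of n \<xi>] b[of n] by simp
      also have "\<dots> \<le> a n \<xi> / b n" using up[OF a0] b[of n] by (intro divide_right_mono) auto
      finally show "norm ((1 - exp (- a n \<xi>)) / b n) \<le> 8 * (1 + sqrt (2 * s) * norm \<xi>)\<^sup>2"
        using ab[of n \<xi>] by linarith
    qed
    show "AE \<xi> in std_gaussian. (\<lambda>n. (1 - exp (- a n \<xi>)) / b n) \<longlonglongrightarrow> (sqrt (2 * s) * norm (\<xi>::'a)) powr \<alpha>"
    proof (rule AE_I2)
      fix \<xi> :: 'a
      let ?L = "(sqrt (2 * s) * norm \<xi>) powr \<alpha>"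
      have abL: "(\<lambda>n. a n \<xi> / b n) \<longlonglongrightarrow> ?L"
      proof (cases "\<xi> = 0")
        case True
        then show ?thesis by (simp add: a_def exponent_zero)
      next
        case False
        then show ?thesis unfolding aP using s by (intro regular_variation_sequence[OF rv r(1)]) auto
      qed
      have "(\<lambda>n. b n * (a n \<xi> / b n)) \<longlonglongrightarrow> 0 * ?L"
        using lim unfolding b_def[symmetric] by (intro tendsto_mult abL)
      moreover have "b n * (a n \<xi> / b n) = a n \<xi>" for n using b[of n] by simp
      ultimately have a_lim: "(\<lambda>n. a n \<xi>) \<longlonglongrightarrow> 0" by simp
      show "(\<lambda>n. (1 - exp (- a n \<xi>)) / b n) \<longlonglongrightarrow> ?L"
      proof (rule tendsto_sandwich)
        have "(\<lambda>n. (a n \<xi> / b n) / (1 + a n \<xi>)) \<longlonglongrightarrow> ?L / (1 + 0)"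
          by (intro tendsto_intros abL a_lim) simp
        then show "(\<lambda>n. (a n \<xi> / b n) / (1 + a n \<xi>)) \<longlonglongrightarrow> ?L" by simp
        show "eventually (\<lambda>n. (a n \<xi> / b n) / (1 + a n \<xi>) \<le> (1 - exp (- a n \<xi>)) / b n) sequentially"
        proof (intro always_eventually allI)
          fix n
          have "(a n \<xi> / b n) / (1 + a n \<xi>) = (a n \<xi> / (1 + a n \<xi>)) / b n" by (simp add: mult.commute)
          also have "\<dots> \<le> (1 - exp (- a n \<xi>)) / b n"
            using low[OF a0] b[of n] by (intro divide_right_mono) auto
          finally show "(a n \<xi> / b n) / (1 + a n \<xi>) \<le> (1 - exp (- a n \<xi>)) / b n" .
        qed
        show "eventually (\<lambda>n. (1 - exp (- a n \<xi>)) / b n \<le> a n \<xi> / b n) sequentially"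
          using up[OF a0] b by (intro always_eventually allI divide_right_mono) (auto intro: less_imp_le)
      qed (rule abL)
    qed
  qed measurable
  moreover have "1 / (t n * P (1 / r n)) * (\<integral>y. (1 - exp (- (s * (norm (y /\<^sub>R r n))\<^sup>2))) * p (t n) y \<partial>lborel)
      = (\<integral>\<xi>. (1 - exp (- a n \<xi>)) / b n \<partial>std_gaussian)" for n
  proof -
    have e: "s * (norm (y /\<^sub>R r n))\<^sup>2 = (s / (r n)\<^sup>2) * (norm y)\<^sup>2" for y :: 'a
      by (simp add: power_mult_distrib power_inverse divide_inverse)
    have "sqrt (2 * (s / (r n)\<^sup>2)) = sqrt (2 * s) / r n" using r(2)[of n] by (simp add: real_sqrt_divide)
    then have "(\<integral>y. (1 - exp (- (s * (norm (y /\<^sub>R r n))\<^sup>2))) * p (t n) y \<partial>lborel) = (\<integral>\<xi>. 1 - exp (- a n \<xi>) \<partial>std_gaussian)"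
      unfolding e a_def using p_laplace[OF t, of "s / (r n)\<^sup>2" n] s r(2)[of n] by simp
    then show ?thesis by (simp add: b_def)
  qed
  ultimately show ?thesis by simp
qed

end

text \<open>The density \<open>g\<close> is homogeneous, so its transform is a pure power of \<open>s\<close>.\<close>

lemma homogeneous_power_laplace:
  assumes \<alpha>: "0 < \<alpha>" "\<alpha> < 2"
  defines "g \<equiv> \<lambda>y::'a::euclidean_space. norm y powr (- (real DIM('a) + \<alpha>))"
  shows "integrable lborel (\<lambda>y. (1 - exp (- (norm y)\<^sup>2)) * g y)"
    and "0 < (\<integral>y. (1 - exp (- (norm y)\<^sup>2)) * g y \<partial>lborel)"
    and "0 < s \<Longrightarrow> (\<integral>y. (1 - exp (- (s * (norm y)\<^sup>2))) * g y \<partial>lborel) = s powr (\<alpha> / 2) * (\<integral>y. (1 - exp (- (norm y)\<^sup>2)) * g y \<partial>lborel)"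
proof -
  let ?d = "real DIM('a)"
  have [measurable]: "g \<in> borel_measurable borel" unfolding g_def by measurable
  have "integrable homogeneous_measure (\<lambda>y::'a. min (norm y powr (2 - \<alpha>)) (norm y powr (- \<alpha>)))"
    by (rule integrable_homogeneous_min_powr) (use \<alpha> in auto)
  then have i: "integrable lborel (\<lambda>y::'a. norm y powr (- ?d) * min (norm y powr (2 - \<alpha>)) (norm y powr (- \<alpha>)))"
    unfolding homogeneous_measure_def by (subst (asm) integrable_density) auto
  show int: "integrable lborel (\<lambda>y. (1 - exp (- (norm y)\<^sup>2)) * g y)"
  proof (rule Bochner_Integration.integrable_bound)
    show "integrable lborel (\<lambda>y::'a. 2 * (norm y powr (- ?d) * min (norm y powr (2 - \<alpha>)) (norm y powr (- \<alpha>))))"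
      using i by simp
    show "AE y in lborel. norm ((1 - exp (- (norm y)\<^sup>2)) * g y) \<le> norm (2 * (norm y powr (- ?d) * min (norm y powr (2 - \<alpha>)) (norm y powr (- \<alpha>))))"
    proof (rule AE_I2)
      fix y :: 'a
      show "norm ((1 - exp (- (norm y)\<^sup>2)) * g y) \<le> norm (2 * (norm y powr (- ?d) * min (norm y powr (2 - \<alpha>)) (norm y powr (- \<alpha>))))"
      proof (cases "y = 0")
        case False
        have "(1 - exp (- (norm y)\<^sup>2)) * g y \<le> (2 * min 1 ((norm y)\<^sup>2)) * g y"
          using one_minus_exp_le_min[of 1 "(norm y)\<^sup>2"] by (intro mult_right_mono) (auto simp: g_def)
        also have "(2 * min 1 ((norm y)\<^sup>2)) * g y = (2 * min 1 ((norm y)\<^sup>2)) * (norm y powr (- ?d) * norm y powr (- \<alpha>))"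
          by (simp add: g_def powr_add[symmetric])
        also have "\<dots> = 2 * (norm y powr (- ?d) * (min 1 ((norm y)\<^sup>2) * norm y powr (- \<alpha>)))" by simp
        also have "min 1 ((norm y)\<^sup>2) * norm y powr (- \<alpha>) = min (norm y powr (2 - \<alpha>)) (norm y powr (- \<alpha>))"
        proof -
          have "(norm y)\<^sup>2 * norm y powr (- \<alpha>) = norm y powr (2 - \<alpha>)"
            using False by (simp add: powr_add[symmetric] powr_numeral[symmetric] del: powr_numeral)
          then show ?thesis by (simp add: min_mult_distrib_right min.commute)
        qed
        finally have le: "(1 - exp (- (norm y)\<^sup>2)) * g y \<le> 2 * (norm y powr (- ?d) * min (norm y powr (2 - \<alpha>)) (norm y powr (- \<alpha>)))" .
        have "0 \<le> (1 - exp (- (norm y)\<^sup>2)) * g y" by (simp add: g_def)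
        with le show ?thesis by simp
      qed simp
    qed
  qed measurable
  show "0 < (\<integral>y. (1 - exp (- (norm y)\<^sup>2)) * g y \<partial>lborel)"
  proof (rule integral_pos_if_pos_on_open[OF int])
    show "open (- {0::'a})" by (intro open_Compl closed_singleton)
    obtain e :: 'a where "norm e = 1" using vector_choose_size[of 1] zero_le_one by blast
    then have "e \<in> - {0}" by auto
    then show "- {0::'a} \<noteq> {}" by blast
  qed (auto simp: g_def)
  assume s: "0 < s"
  have gs: "g (sqrt s *\<^sub>R y) = s powr (- (?d + \<alpha>) / 2) * g y" for y
    using s by (simp add: g_def powr_mult powr_half_sqrt[symmetric] powr_powr)
  have "(\<integral>y. (1 - exp (- (norm y)\<^sup>2)) * g y \<partial>lborel) = sqrt s ^ DIM('a) * (\<integral>y. (1 - exp (- (norm (sqrt s *\<^sub>R y))\<^sup>2)) * g (sqrt s *\<^sub>R y) \<partial>lborel)"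
    by (rule integral_lborel_scaleR) (use s in auto)
  also have "\<dots> = sqrt s ^ DIM('a) * (s powr (- (?d + \<alpha>) / 2) * (\<integral>y. (1 - exp (- (s * (norm y)\<^sup>2))) * g y \<partial>lborel))"
    unfolding gs using s by (subst integral_mult_right_zero[symmetric]) (simp add: power_mult_distrib mult_ac)
  also have "sqrt s ^ DIM('a) = s powr (?d / 2)"
    using s by (simp add: powr_half_sqrt[symmetric] powr_power)
  also have "s powr (?d / 2) * (s powr (- (?d + \<alpha>) / 2) * (\<integral>y. (1 - exp (- (s * (norm y)\<^sup>2))) * g y \<partial>lborel))
      = s powr (- (\<alpha> / 2)) * (\<integral>y. (1 - exp (- (s * (norm y)\<^sup>2))) * g y \<partial>lborel)"
    by (simp add: mult.assoc[symmetric] powr_add[symmetric] field_simps)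
  finally show "(\<integral>y. (1 - exp (- (s * (norm y)\<^sup>2))) * g y \<partial>lborel) = s powr (\<alpha> / 2) * (\<integral>y. (1 - exp (- (norm y)\<^sup>2)) * g y \<partial>lborel)"
    using s by (simp add: mult.assoc[symmetric] powr_add[symmetric])
qed

text \<open>Otherwise the Gaussian measure would be concentrated at the origin and its characteristic function
would be constant.\<close>

lemma std_gaussian_absolute_moment_pos:
  assumes "0 < \<alpha>" "0 < c" and int: "integrable std_gaussian (\<lambda>\<xi>::'a::euclidean_space. (c * norm \<xi>) powr \<alpha>)"
  shows "0 < (\<integral>\<xi>. (c * norm (\<xi>::'a)) powr \<alpha> \<partial>std_gaussian)"
proof (rule ccontr)
  interpret prob_space "std_gaussian :: 'a measure" by (rule prob_space_std_gaussian)
  assume "\<not> ?thesis"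
  moreover have "0 \<le> (\<integral>\<xi>. (c * norm (\<xi>::'a)) powr \<alpha> \<partial>std_gaussian)" by simp
  ultimately have "(\<integral>\<xi>. (c * norm (\<xi>::'a)) powr \<alpha> \<partial>std_gaussian) = 0" by linarith
  then have "AE \<xi> in (std_gaussian :: 'a measure). (c * norm \<xi>) powr \<alpha> = 0"
    using integral_nonneg_eq_0_iff_AE[OF int] by simp
  then have z: "AE \<xi> in (std_gaussian :: 'a measure). \<xi> = 0"
    by eventually_elim (use assms in simp)
  obtain e :: 'a where e: "norm e = 1" using vector_choose_size[of 1] zero_le_one by blast
  have "exp (- (norm e)\<^sup>2 / 2) = (\<integral>\<xi>. cos (\<xi> \<bullet> e) \<partial>std_gaussian)"
    by (rule std_gaussian_characteristic_function[symmetric])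
  also have "\<dots> = (\<integral>\<xi>. 1 \<partial>(std_gaussian :: 'a measure))"
    by (rule integral_cong_AE) (use z in \<open>auto elim: eventually_mono\<close>)
  also have "\<dots> = 1" using prob_space by simp
  finally show False using e by simp
qed

context unimodal_semigroup
begin

text \<open>If the joint limit failed, there would be sequences \<open>t\<^sub>n\<close> and \<open>x\<^sub>n\<close> along which the quotient stays away from
\<open>c\<close>. Rescaling by \<open>r\<^sub>n = |x\<^sub>n|\<close>, the Tauberian theorem gives convergence to the density \<open>f\<close>, whose value on
the unit sphere is \<open>c\<close>.\<close>

lemma transition_density_asymptotics:
  assumes \<alpha>: "0 < \<alpha>" "\<alpha> < 2" and rv: "regularly_varying_at_zero \<alpha> P"
  shows "\<exists>c>0. \<forall>\<epsilon>>0. \<exists>\<delta>>0. \<forall>t>0. \<forall>x.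
         norm x \<ge> inverse \<delta> \<and> t * P (inverse (norm x)) \<le> \<delta> \<longrightarrow>
         \<bar>p t x / (norm x powr (- real DIM('a)) * t * P (inverse (norm x))) - c\<bar> < \<epsilon>"
proof -
  let ?d = "real DIM('a)"
  define g where "g y = norm y powr (- (?d + \<alpha>))" for y :: 'a
  note G = homogeneous_power_laplace[OF \<alpha>, where 'a = 'a, folded g_def]
  define D where "D = (\<integral>y. (1 - exp (- (norm y)\<^sup>2)) * g y \<partial>lborel)"
  have D: "0 < D" unfolding D_def by (rule G(2))
  define m where "m = (\<integral>\<xi>. (sqrt 2 * norm (\<xi>::'a)) powr \<alpha> \<partial>std_gaussian)"
  have m: "0 < m" unfolding m_def
  proof (rule std_gaussian_absolute_moment_pos)
    show "integrable std_gaussian (\<lambda>\<xi>::'a. (sqrt 2 * norm \<xi>) powr \<alpha>)"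
    proof (rule Bochner_Integration.integrable_bound)
      show "integrable std_gaussian (\<lambda>\<xi>::'a. (1 + sqrt 2 * norm \<xi>)\<^sup>2)" by (rule gaussian_square_integrable)
      show "AE \<xi> in (std_gaussian :: 'a measure). norm ((sqrt 2 * norm \<xi>) powr \<alpha>) \<le> norm ((1 + sqrt 2 * norm \<xi>)\<^sup>2)"
      proof (rule AE_I2)
        fix \<xi> :: 'a
        let ?x = "sqrt 2 * norm \<xi>"
        have "?x powr \<alpha> \<le> (1 + ?x) powr \<alpha>" using \<alpha> by (intro powr_mono2) auto
        also have "\<dots> \<le> (1 + ?x) powr 2" using \<alpha> by (intro powr_mono) auto
        also have "\<dots> = (1 + ?x)\<^sup>2" by (simp add: add_pos_nonneg)
        finally show "norm (?x powr \<alpha>) \<le> norm ((1 + ?x)\<^sup>2)" by simp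
      qed
    qed measurable
  qed (use \<alpha> in auto)
  define c where "c = m / D"
  have c: "0 < c" using m D by (simp add: c_def)
  define f where "f y = c * g y" for y
  obtain e :: 'a where e: "norm e = 1" by (rule obtain_unit)
  have fe: "f (l *\<^sub>R e) = c * l powr (- (?d + \<alpha>))" if "0 < l" for l
    using that e by (simp add: f_def g_def)
  have f_lim: "((\<lambda>l. f (l *\<^sub>R e)) \<longlongrightarrow> c) (at 1 within S)" for S
  proof -
    have "isCont (\<lambda>l. c * l powr (- (?d + \<alpha>))) 1" by (intro continuous_intros) auto
    then have "((\<lambda>l. c * l powr (- (?d + \<alpha>))) \<longlongrightarrow> c) (at 1 within S)"
      using tendsto_within_subset[where S = UNIV and x = "1::real" and T = S] unfolding isCont_def by force
    moreover have "eventually (\<lambda>l. c * l powr (- (?d + \<alpha>)) = f (l *\<^sub>R e)) (at 1 within S)"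
      unfolding eventually_at by (rule exI[of _ 1]) (auto simp: fe dist_real_def abs_less_iff)
    ultimately show ?thesis by (rule Lim_transform_eventually)
  qed
  have fI: "integrable lborel (\<lambda>y. (1 - exp (- (norm y)\<^sup>2)) * f y)"
    using G(1) by (simp add: f_def mult.left_commute)
  have fL: "(\<integral>y. (1 - exp (- (real k * (norm y)\<^sup>2))) * f y \<partial>lborel) = (\<integral>\<xi>. (sqrt (2 * real k) * norm (\<xi>::'a)) powr \<alpha> \<partial>std_gaussian)"
    if k: "k > 0" for k :: nat
  proof -
    have "(\<integral>y. (1 - exp (- (real k * (norm y)\<^sup>2))) * f y \<partial>lborel) = c * (real k powr (\<alpha> / 2) * D)"
      using G(3)[of "real k"] k by (simp add: f_def mult.left_commute D_def)
    also have "\<dots> = real k powr (\<alpha> / 2) * m" using D by (simp add: c_def)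
    also have "\<dots> = (\<integral>\<xi>. real k powr (\<alpha> / 2) * (sqrt 2 * norm (\<xi>::'a)) powr \<alpha> \<partial>std_gaussian)"
      by (simp add: m_def)
    also have "\<dots> = (\<integral>\<xi>. (sqrt (2 * real k) * norm (\<xi>::'a)) powr \<alpha> \<partial>std_gaussian)"
    proof (rule Bochner_Integration.integral_cong[OF refl])
      fix \<xi> :: 'a
      have "real k powr (\<alpha> / 2) = sqrt (real k) powr \<alpha>"
        using k by (simp add: powr_half_sqrt[symmetric] powr_powr mult.commute)
      then show "real k powr (\<alpha> / 2) * (sqrt 2 * norm \<xi>) powr \<alpha> = (sqrt (2 * real k) * norm \<xi>) powr \<alpha>"
        by (simp add: powr_mult real_sqrt_mult mult_ac)
    qed
    finally show ?thesis .
  qed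
  have "\<exists>x0>0. \<forall>x\<ge>x0. 0 < inverse (P (inverse x))"
    using rv unfolding regularly_varying_at_zero_def regularly_varying_at_infinity_def by (rule conjunct1)
  then obtain x0 where x0: "0 < x0" "\<forall>x\<ge>x0. 0 < inverse (P (inverse x))" by (elim exE conjE)
  define near where "near \<delta> t x \<longleftrightarrow> norm x \<ge> inverse \<delta> \<and> t * P (inverse (norm x)) \<le> \<delta>" for \<delta> t and x :: 'a
  define quot where "quot t x = p t x / (norm x powr (- ?d) * t * P (inverse (norm x)))" for t and x :: 'a
  define good where "good \<epsilon> \<delta> \<longleftrightarrow> (\<forall>t>0. \<forall>x. near \<delta> t x \<longrightarrow> \<bar>quot t x - c\<bar> < \<epsilon>)" for \<epsilon> \<delta>
  have good: "\<exists>\<delta>>0. good \<epsilon> \<delta>" if \<epsilon>: "\<epsilon> > 0" for \<epsilon>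
  proof (rule ccontr)
    assume neg: "\<not> (\<exists>\<delta>>0. good \<epsilon> \<delta>)"
    \<comment> \<open>The offset \<open>x0\<close> keeps \<open>\<psi>(1/r\<^sub>n)\<close> positive for all \<open>n\<close>.\<close>
    define \<delta> where "\<delta> n = inverse (x0 + real (Suc n))" for n
    have \<delta>: "0 < \<delta> n" for n using x0(1) by (simp add: \<delta>_def)
    have ex: "\<exists>t x. 0 < t \<and> near (\<delta> n) t x \<and> \<not> \<bar>quot t x - c\<bar> < \<epsilon>" for n
    proof -
      have "\<not> good \<epsilon> (\<delta> n)" using neg \<delta>[of n] by blast
      then show ?thesis unfolding good_def by (simp only: not_all not_imp) blast
    qed
    then have "\<forall>n. \<exists>t x. 0 < t \<and> near (\<delta> n) t x \<and> \<not> \<bar>quot t x - c\<bar> < \<epsilon>" ..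
    then obtain t x where tx': "\<forall>n. 0 < t n \<and> near (\<delta> n) (t n) (x n) \<and> \<not> \<bar>quot (t n) (x n) - c\<bar> < \<epsilon>" by metis
    have tx: "0 < t n" "norm (x n) \<ge> inverse (\<delta> n)" "t n * P (inverse (norm (x n))) \<le> \<delta> n"
      "\<not> \<bar>quot (t n) (x n) - c\<bar> < \<epsilon>" for n using tx' unfolding near_def by blast+
    define r where "r n = norm (x n)" for n
    have r1: "x0 + real (Suc n) \<le> r n" for n using tx(2)[of n] x0 by (simp add: r_def \<delta>_def)
    have r0: "0 < r n" and rx0: "x0 \<le> r n" for n using r1[of n] x0(1) by linarith+
    have rtop: "filterlim r at_top sequentially"
    proof (rule filterlim_at_top_mono[OF filterlim_real_sequentially])
      have "real n \<le> r n" for n using r1[of n] x0(1) by simp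
      then show "eventually (\<lambda>n. real n \<le> r n) sequentially" by simp
    qed
    have Ppos: "0 < P (1 / r n)" for n using x0(2) rx0[of n] by (simp add: inverse_eq_divide)
    define b where "b n = t n * P (1 / r n)" for n
    have b: "0 < b n" for n using tx(1) Ppos by (simp add: b_def)
    have "(\<lambda>n. b n) \<longlonglongrightarrow> 0"
    proof (rule tendsto_sandwich[OF _ _ tendsto_const])
      show "eventually (\<lambda>n. 0 \<le> b n) sequentially" using b by (simp add: less_imp_le)
      show "eventually (\<lambda>n. b n \<le> inverse (real (Suc n))) sequentially"
      proof (intro always_eventually allI)
        fix n
        have "b n \<le> \<delta> n" using tx(3)[of n] by (simp add: b_def r_def inverse_eq_divide)
        also have "\<dots> \<le> inverse (real (Suc n))" unfolding \<delta>_def using x0(1) by (intro le_imp_inverse_le) auto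
        finally show "b n \<le> inverse (real (Suc n))" .
      qed
      show "(\<lambda>n. inverse (real (Suc n))) \<longlonglongrightarrow> 0" by (rule LIMSEQ_inverse_real_of_nat)
    qed
    then have b0: "(\<lambda>n. t n * P (1 / r n)) \<longlonglongrightarrow> 0" by (simp add: b_def)
    have L: "(\<lambda>n. (1 / b n) * (\<integral>y. (1 - exp (- (real k * (norm (y /\<^sub>R r n))\<^sup>2))) * p (t n) y \<partial>lborel))
        \<longlonglongrightarrow> (\<integral>y. (1 - exp (- (real k * (norm y)\<^sup>2))) * f y \<partial>lborel) + 0 * real k" if "k > 0" for k
      using scaled_laplace_limit[OF rv \<alpha>(1) rtop r0 tx(1) Ppos b0, of "real k"] that fL[OF that] by (simp add: b_def)
    have pI: "integrable lborel (\<lambda>y. (1 - exp (- (norm (y /\<^sub>R r n))\<^sup>2)) * p (t n) y)" for n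
      using p_integrable[OF tx(1), of "1 / (r n)\<^sup>2" n] r0[of n] by (simp add: power_mult_distrib power_inverse divide_inverse)
    have fm: "f \<in> borel_measurable borel" unfolding f_def g_def by measurable
    have fn: "0 \<le> f y" for y using c by (simp add: f_def g_def)
    have fa: "f y \<le> f x" if "x \<noteq> 0" "norm x \<le> norm y" for x y
      using that c \<alpha> unfolding f_def g_def by (intro mult_left_mono powr_mono2') auto
    note dens = p_measurable[OF tx(1)] p_nonneg[OF tx(1)] p_antimono[OF tx(1)] fm fn fa r0
    have e0: "e \<noteq> 0" using e by auto
    have ib: "0 \<le> 1 / b n" for n using b[of n] by simp
    have conv: "(\<lambda>n. (1 / b n) * r n ^ DIM('a) * p (t n) (r n *\<^sub>R e)) \<longlonglongrightarrow> c"
    proof (rule order_tendstoI)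
      fix A assume "A < c"
      then have "eventually (\<lambda>l. A < f (l *\<^sub>R e)) (at_right 1)" by (rule order_tendstoD(1)[OF f_lim])
      moreover have "eventually (\<lambda>l. 1 < l) (at_right (1::real))" by (rule eventually_at_right_less)
      ultimately have "eventually (\<lambda>l. 1 < l \<and> A < f (l *\<^sub>R e)) (at_right (1::real))" by eventually_elim simp
      then obtain l where l: "1 < l" "A < f (l *\<^sub>R e)"
        using eventually_happens' trivial_limit_at_right_real by blast
      show "eventually (\<lambda>n. A < (1 / b n) * r n ^ DIM('a) * p (t n) (r n *\<^sub>R e)) sequentially"
        by (rule eventually_density_greater[of "\<lambda>n. p (t n)" f r "\<lambda>n. 1 / b n" 0 e "l *\<^sub>R e" A, OF dens ib pI fI L e0 _ l(2)]) (use l(1) e in auto)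
    next
      fix A assume "c < A"
      then have "eventually (\<lambda>l. f (l *\<^sub>R e) < A) (at_left 1)" by (rule order_tendstoD(2)[OF f_lim])
      moreover have "eventually (\<lambda>l. l \<in> {0<..<1}) (at_left (1::real))" by (rule eventually_at_leftI[of 0]) auto
      ultimately have "eventually (\<lambda>l. 0 < l \<and> l < 1 \<and> f (l *\<^sub>R e) < A) (at_left (1::real))" by eventually_elim simp
      then obtain l where l: "0 < l" "l < 1" "f (l *\<^sub>R e) < A"
        using eventually_happens' trivial_limit_at_left_real by blast
      have le0: "l *\<^sub>R e \<noteq> 0" using l e0 by simp
      show "eventually (\<lambda>n. (1 / b n) * r n ^ DIM('a) * p (t n) (r n *\<^sub>R e) < A) sequentially"
        by (rule eventually_density_less[of "\<lambda>n. p (t n)" f r "\<lambda>n. 1 / b n" 0 "l *\<^sub>R e" e A, OF dens ib pI fI L le0 _ l(3)]) (use l e in auto)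
    qed
    have "quot (t n) (x n) = (1 / b n) * r n ^ DIM('a) * p (t n) (r n *\<^sub>R e)" for n
    proof -
      have "norm (r n *\<^sub>R e) = norm (x n)" using e r0[of n] by (simp add: r_def)
      moreover have "x n \<noteq> 0" "r n *\<^sub>R e \<noteq> 0" using r0[of n] e0 by (auto simp: r_def)
      ultimately have "p (t n) (r n *\<^sub>R e) = p (t n) (x n)"
        by (intro antisym p_antimono[OF tx(1)]) auto
      moreover have "norm (x n) powr (- ?d) = 1 / r n ^ DIM('a)"
        using r0[of n] by (simp add: powr_minus_divide powr_realpow r_def)
      ultimately show ?thesis by (simp add: quot_def b_def r_def inverse_eq_divide)
    qed
    with conv have "(\<lambda>n. quot (t n) (x n)) \<longlonglongrightarrow> c" by simp
    from tendstoD[OF this \<epsilon>] have "eventually (\<lambda>n. False) sequentially"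
      using tx(4) by (simp add: dist_real_def)
    then show False by simp
  qed
  show ?thesis
  proof (rule exI[of _ c], intro conjI allI impI)
    fix \<epsilon> :: real assume "\<epsilon> > 0"
    from good[OF this] show "\<exists>\<delta>>0. \<forall>t>0. \<forall>x. norm x \<ge> inverse \<delta> \<and> t * P (inverse (norm x)) \<le> \<delta> \<longrightarrow>
         \<bar>p t x / (norm x powr (- ?d) * t * P (inverse (norm x))) - c\<bar> < \<epsilon>"
      unfolding good_def near_def quot_def .
  qed (rule c)
qed

end

section \<open>Regular variation from the Levy density\<close>

context unimodal_exponent
begin

lemma profile_measurable [measurable]: "P \<in> borel_measurable borel"
proof -
  obtain e :: 'a where e: "norm e = 1" by (rule obtain_unit)
  \<comment> \<open>No vector has negative norm, so for \<open>r < 0\<close> the profile is the value at an arbitrary fixed point.\<close>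
  have "P r = (if 0 \<le> r then \<psi> (r *\<^sub>R e) else \<psi> (SOME x. False))" for r
  proof (cases "0 \<le> r")
    case False
    then have "(\<lambda>x::'a. norm x = r) = (\<lambda>x. False)" by (auto simp: fun_eq_iff)
    then show ?thesis using False by (simp add: radial_profile_def)
  qed (simp add: profile_eq_exponent[OF e])
  then have "P = (\<lambda>r. if 0 \<le> r then \<psi> (r *\<^sub>R e) else \<psi> (SOME x. False))" by (rule ext)
  moreover have "(\<lambda>r. if 0 \<le> r then \<psi> (r *\<^sub>R e) else \<psi> (SOME x. False)) \<in> borel_measurable borel" by measurable
  ultimately show ?thesis by simp
qed

end

definition truncated_square :: "'a::euclidean_space \<Rightarrow> 'a \<Rightarrow> real" where
  "truncated_square e z = min 2 ((e \<bullet> z)\<^sup>2 / 2)"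

lemma truncated_square_measurable [measurable]: "truncated_square e \<in> borel_measurable borel"
  unfolding truncated_square_def by measurable

lemma truncated_square_nonneg: "0 \<le> truncated_square e z"
  by (simp add: truncated_square_def)

lemma truncated_square_double: "truncated_square e z \<le> truncated_square e (2 *\<^sub>R z)"
  by (simp add: truncated_square_def power_mult_distrib min.coboundedI2)

lemma truncated_square_half: "truncated_square e z / 4 \<le> truncated_square e ((1 / 2) *\<^sub>R z)"
  by (simp add: truncated_square_def power_mult_distrib power_divide min_def)

text \<open>A nonempty open set is not a null set.\<close>

lemma nn_integral_homogeneous_pos:
  fixes g :: "'a::euclidean_space \<Rightarrow> real"
  assumes [measurable]: "g \<in> borel_measurable borel" and U: "open U" "U \<noteq> {}" "\<And>y. y \<in> U \<Longrightarrow> y \<noteq> 0 \<and> 0 < g y"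
  shows "(\<integral>\<^sup>+y. ennreal (g y) * indicator U y \<partial>homogeneous_measure) \<noteq> 0"
proof
  have [measurable]: "U \<in> sets borel" using U(1) by simp
  assume "(\<integral>\<^sup>+y. ennreal (g y) * indicator U y \<partial>homogeneous_measure) = 0"
  then have "(\<integral>\<^sup>+y. ennreal (norm y powr (- real DIM('a))) * (ennreal (g y) * indicator U y) \<partial>lborel) = 0"
    unfolding homogeneous_measure_def by (subst (asm) nn_integral_density) auto
  then have "AE y in lborel. ennreal (norm y powr (- real DIM('a))) * (ennreal (g y) * indicator U y) = 0"
    by (subst (asm) nn_integral_0_iff_AE) auto
  then have "AE y in lborel. y \<notin> U"
  proof eventually_elim
    case (elim y)
    then show ?case using U(3)[of y] by (auto simp: ennreal_eq_0_iff)
  qed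
  then have "U \<in> null_sets lborel" using U(1) by (subst AE_iff_null_sets) auto
  then have "U \<in> null_sets lebesgue" by (rule null_sets_completionI)
  then show False using open_not_negligible[OF U(1,2)] by (simp add: negligible_iff_null_sets)
qed

lemma ennreal_positive_real_lower_bound:
  fixes x :: ennreal assumes "x \<noteq> 0" obtains k where "0 < k" "ennreal k \<le> x"
proof (cases x)
  case (real r)
  then show ?thesis using that[of r] assms by (cases "r = 0") auto
next
  case top then show ?thesis using that[of 1] by simp
qed

text \<open>Dilation by \<open>\<sigma>\<close> moves the first \<open>n\<close> annuli to the next ones, preserves the measure and does not decrease
\<open>g\<close>, so that every annulus contributes at least \<open>k\<close>.\<close>

lemma scaled_annuli_integral_lower_bound:
  fixes g :: "'a::euclidean_space \<Rightarrow> real"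
  assumes [measurable]: "g \<in> borel_measurable borel" and \<sigma>: "\<sigma> > 0" and g: "\<And>z. g z \<le> g (\<sigma> *\<^sub>R z)"
    and k: "ennreal k \<le> (\<integral>\<^sup>+z. ennreal (g z) * indicator A z \<partial>homogeneous_measure)" "0 \<le> k"
    and A [measurable]: "\<And>n. T n \<in> sets borel" "A \<in> sets borel"
    and T: "\<And>n z. indicator (T (Suc n)) (z::'a) \<ge> (indicator A z + indicator (T n) (z /\<^sub>R \<sigma>) :: ennreal)"
  shows "ennreal (real n * k) \<le> (\<integral>\<^sup>+z. ennreal (g z) * indicator (T n) z \<partial>homogeneous_measure)"
proof (induction n)
  case (Suc n)
  have "ennreal (real (Suc n) * k) = ennreal k + ennreal (real n * k)"
    using k(2) by (simp add: ennreal_plus[symmetric] algebra_simps del: ennreal_plus)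
  also have "\<dots> \<le> (\<integral>\<^sup>+z. ennreal (g z) * indicator A z \<partial>homogeneous_measure) + (\<integral>\<^sup>+z. ennreal (g z) * indicator (T n) z \<partial>homogeneous_measure)"
    by (intro add_mono k Suc)
  also have "(\<integral>\<^sup>+z. ennreal (g z) * indicator (T n) z \<partial>homogeneous_measure) \<le> (\<integral>\<^sup>+z. ennreal (g (\<sigma> *\<^sub>R z)) * indicator (T n) z \<partial>homogeneous_measure)"
    by (intro nn_integral_mono mult_right_mono ennreal_leI g) auto
  also have "(\<integral>\<^sup>+z. ennreal (g (\<sigma> *\<^sub>R z)) * indicator (T n) z \<partial>homogeneous_measure)
     = (\<integral>\<^sup>+z. (\<lambda>z. ennreal (g z) * indicator (T n) (z /\<^sub>R \<sigma>)) (\<sigma> *\<^sub>R z) \<partial>homogeneous_measure)"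
    using \<sigma> by simp
  also have "\<dots> = (\<integral>\<^sup>+z. ennreal (g z) * indicator (T n) (z /\<^sub>R \<sigma>) \<partial>homogeneous_measure)"
    by (rule nn_integral_homogeneous_scaleR[OF _ \<sigma>]) measurable
  also have "(\<integral>\<^sup>+z. ennreal (g z) * indicator A z \<partial>homogeneous_measure) + (\<integral>\<^sup>+z. ennreal (g z) * indicator (T n) (z /\<^sub>R \<sigma>) \<partial>homogeneous_measure)
     = (\<integral>\<^sup>+z. ennreal (g z) * (indicator A z + indicator (T n) (z /\<^sub>R \<sigma>)) \<partial>homogeneous_measure)"
    by (subst nn_integral_add[symmetric]) (auto simp: distrib_left)
  also have "\<dots> \<le> (\<integral>\<^sup>+z. ennreal (g z) * indicator (T (Suc n)) z \<partial>homogeneous_measure)"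
    by (intro nn_integral_mono mult_left_mono T) auto
  finally show ?case by (auto intro: add_left_mono)
qed simp

text \<open>These divergent integrals are what excludes growth of \<open>\<psi>\<close> like the power 0 (first bound, at
infinity) or 2 (second bound, at the origin).\<close>

lemma truncated_square_annuli_diverge:
  fixes e :: "'a::euclidean_space"
  assumes e: "norm e = 1"
  obtains k where "0 < k"
    "\<And>n. ennreal (real n * k) \<le> (\<integral>\<^sup>+z. ennreal (truncated_square e z) * indicator {z. 1 < norm z \<and> norm z < 2 ^ n} z \<partial>homogeneous_measure)"
    "\<And>n. ennreal (real n * k) \<le> (\<integral>\<^sup>+z. ennreal (truncated_square e z / (norm z)\<^sup>2) * indicator {z. (1/2) ^ n < norm z \<and> norm z < 1} z \<partial>homogeneous_measure)"
proof -
  let ?A1 = "{z::'a. 1 < norm z \<and> norm z < 2}" and ?A2 = "{z::'a. 1/2 < norm z \<and> norm z < 1}"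
  let ?U1 = "{z::'a. 1 < norm z \<and> norm z < 2 \<and> 0 < (e \<bullet> z)\<^sup>2}" and ?U2 = "{z::'a. 1/2 < norm z \<and> norm z < 1 \<and> 0 < (e \<bullet> z)\<^sup>2}"
  have ee: "e \<bullet> e = 1" using e by (simp add: dot_square_norm)
  have o1: "open ?U1" and o2: "open ?U2"
    by (intro open_Collect_conj open_Collect_less continuous_intros)+
  have "(3/2) *\<^sub>R e \<in> ?U1" "(3/4) *\<^sub>R e \<in> ?U2" using e ee by auto
  then have ne: "?U1 \<noteq> {}" "?U2 \<noteq> {}" by blast+
  have "(\<integral>\<^sup>+z. ennreal (truncated_square e z) * indicator ?U1 z \<partial>homogeneous_measure) \<noteq> 0"
    by (rule nn_integral_homogeneous_pos[OF _ o1 ne(1)]) (auto simp: truncated_square_def)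
  moreover have "(\<integral>\<^sup>+z. ennreal (truncated_square e z) * indicator ?U1 z \<partial>homogeneous_measure) \<le> (\<integral>\<^sup>+z. ennreal (truncated_square e z) * indicator ?A1 z \<partial>homogeneous_measure)"
    by (intro nn_integral_mono mult_left_mono) (auto simp: indicator_def)
  ultimately have "(\<integral>\<^sup>+z. ennreal (truncated_square e z) * indicator ?A1 z \<partial>homogeneous_measure) \<noteq> 0" by auto
  then obtain k1 where k1: "0 < k1" "ennreal k1 \<le> (\<integral>\<^sup>+z. ennreal (truncated_square e z) * indicator ?A1 z \<partial>homogeneous_measure)"
    by (rule ennreal_positive_real_lower_bound)
  have "(\<integral>\<^sup>+z. ennreal (truncated_square e z / (norm z)\<^sup>2) * indicator ?U2 z \<partial>homogeneous_measure) \<noteq> 0"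
    by (rule nn_integral_homogeneous_pos[OF _ o2 ne(2)]) (auto simp: truncated_square_def intro!: divide_pos_pos)
  moreover have "(\<integral>\<^sup>+z. ennreal (truncated_square e z / (norm z)\<^sup>2) * indicator ?U2 z \<partial>homogeneous_measure) \<le> (\<integral>\<^sup>+z. ennreal (truncated_square e z / (norm z)\<^sup>2) * indicator ?A2 z \<partial>homogeneous_measure)"
    by (intro nn_integral_mono mult_left_mono) (auto simp: indicator_def)
  ultimately have "(\<integral>\<^sup>+z. ennreal (truncated_square e z / (norm z)\<^sup>2) * indicator ?A2 z \<partial>homogeneous_measure) \<noteq> 0" by auto
  then obtain k2 where k2: "0 < k2" "ennreal k2 \<le> (\<integral>\<^sup>+z. ennreal (truncated_square e z / (norm z)\<^sup>2) * indicator ?A2 z \<partial>homogeneous_measure)"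
    by (rule ennreal_positive_real_lower_bound)
  define k where "k = min k1 k2"
  have k: "0 < k" "ennreal k \<le> ennreal k1" "ennreal k \<le> ennreal k2" using k1 k2 by (auto simp: k_def)
  show ?thesis
  proof (rule that[OF k(1)])
    fix n
    show "ennreal (real n * k) \<le> (\<integral>\<^sup>+z. ennreal (truncated_square e z) * indicator {z. 1 < norm z \<and> norm z < 2 ^ n} z \<partial>homogeneous_measure)"
    proof (rule scaled_annuli_integral_lower_bound[where \<sigma> = 2 and A = ?A1 and T = "\<lambda>n. {z. 1 < norm z \<and> norm z < 2 ^ n}"])
      show "ennreal k \<le> (\<integral>\<^sup>+z. ennreal (truncated_square e z) * indicator ?A1 z \<partial>homogeneous_measure)"
        using k(2) k1(2) by (rule order_trans)
      fix n and z :: 'a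
      have "(2::real) \<le> 2 ^ Suc n" by simp
      then show "indicator ?A1 z + indicator {z. 1 < norm z \<and> norm z < 2 ^ n} (z /\<^sub>R 2) \<le> (indicator {z. 1 < norm z \<and> norm z < 2 ^ Suc n} z :: ennreal)"
        by (auto simp: indicator_def simp del: power_Suc) (auto simp: field_simps)
    qed (use truncated_square_double k(1) in auto)
    show "ennreal (real n * k) \<le> (\<integral>\<^sup>+z. ennreal (truncated_square e z / (norm z)\<^sup>2) * indicator {z. (1/2) ^ n < norm z \<and> norm z < 1} z \<partial>homogeneous_measure)"
    proof (rule scaled_annuli_integral_lower_bound[where \<sigma> = "1/2" and A = ?A2 and T = "\<lambda>n. {z. (1/2) ^ n < norm z \<and> norm z < 1}"])
      show "ennreal k \<le> (\<integral>\<^sup>+z. ennreal (truncated_square e z / (norm z)\<^sup>2) * indicator ?A2 z \<partial>homogeneous_measure)"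
        using k(3) k2(2) by (rule order_trans)
      fix z :: 'a
      have "truncated_square e z / (norm z)\<^sup>2 = (truncated_square e z / 4) / (norm z / 2)\<^sup>2" by (simp add: power_divide)
      also have "\<dots> \<le> truncated_square e ((1/2) *\<^sub>R z) / (norm z / 2)\<^sup>2"
        by (intro divide_right_mono truncated_square_half) auto
      finally show "truncated_square e z / (norm z)\<^sup>2 \<le> truncated_square e ((1/2) *\<^sub>R z) / (norm ((1/2) *\<^sub>R z))\<^sup>2" by simp
    next
      fix n and z :: 'a
      have "(1/2::real) ^ Suc n \<le> 1/2" by (simp add: power_le_one)
      then show "indicator ?A2 z + indicator {z. (1/2) ^ n < norm z \<and> norm z < 1} (z /\<^sub>R (1/2)) \<le> (indicator {z. (1/2) ^ Suc n < norm z \<and> norm z < 1} z :: ennreal)"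
        by (auto simp: indicator_def)
    qed (use k(1) in auto)
  qed
qed

text \<open>Condition (iii).\<close>

locale regular_levy_density = unimodal_exponent \<psi> \<eta> \<nu>
  for \<psi> :: "'a::euclidean_space \<Rightarrow> real" and \<eta> \<nu> +
  fixes c :: real
  assumes c_pos: "0 < c"
    and density_limit: "((\<lambda>x. \<nu> x / (norm x powr (- real DIM('a)) * P (inverse (norm x)))) \<longlongrightarrow> c) at_infinity"
begin

text \<open>The asymptotic expression for \<open>\<nu>\<close> in (iii), up to the factor \<open>c\<close>.\<close>

definition Q :: "'a \<Rightarrow> real" where "Q x = norm x powr (- real DIM('a)) * P (inverse (norm x))"

lemma Q_nonneg: "0 \<le> Q x" unfolding Q_def using profile_nonneg by simp

lemma Q_measurable [measurable]: "Q \<in> borel_measurable borel" unfolding Q_def by measurable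

text \<open>The quotient \<open>\<nu>/Q\<close> would be 0 where \<open>\<psi>\<close> vanishes, since division by zero gives 0. So the limit being
positive makes \<open>\<psi>\<close> positive near zero, and almost monotonicity makes it positive everywhere.\<close>

lemma density_bounds:
  obtains r0 where "0 < r0" "\<And>x. 1 \<le> r0 * norm x \<Longrightarrow> c / 2 * Q x \<le> \<nu> x"
    "\<And>x. 1 \<le> r0 * norm x \<Longrightarrow> \<nu> x \<le> 2 * c * Q x" "\<And>r. 0 < r \<Longrightarrow> 0 < P r"
proof -
  have lim: "((\<lambda>x. \<nu> x / Q x) \<longlongrightarrow> c) at_infinity" using density_limit unfolding Q_def .
  have "eventually (\<lambda>x. \<nu> x / Q x > c / 2) at_infinity" "eventually (\<lambda>x. \<nu> x / Q x < 2 * c) at_infinity"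
    by (rule order_tendstoD(1)[OF lim], use c_pos in simp) (rule order_tendstoD(2)[OF lim], use c_pos in simp)
  then have "eventually (\<lambda>x. \<nu> x / Q x > c / 2 \<and> \<nu> x / Q x < 2 * c) at_infinity" by eventually_elim simp
  then obtain R where R: "\<And>x. R \<le> norm x \<Longrightarrow> \<nu> x / Q x > c / 2 \<and> \<nu> x / Q x < 2 * c"
    by (auto simp: eventually_at_infinity)
  define R' where "R' = max R 1"
  have R': "0 < R'" by (simp add: R'_def)
  have Qp: "0 < Q x" if "R' \<le> norm x" for x
  proof -
    have "\<nu> x / Q x > c / 2" using R[of x] that by (simp add: R'_def)
    then have "Q x \<noteq> 0" using c_pos by (intro notI) simp
    then show ?thesis using Q_nonneg[of x] by simp
  qed
  have Ppos: "0 < P r" if r: "0 < r" for r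
  proof -
    obtain e :: 'a where e: "norm e = 1" by (rule obtain_unit)
    define s where "s = min r (1 / R')"
    have s: "0 < s" "s \<le> r" "s \<le> 1 / R'" using r R' by (auto simp: s_def)
    have "R' \<le> inverse s" using s R' by (simp add: field_simps)
    then have "0 < Q (inverse s *\<^sub>R e)" using s e by (intro Qp) simp
    then have "P s \<noteq> 0" using s e by (auto simp: Q_def)
    then have "0 < P s" using profile_nonneg[of s] by simp
    also have "P s \<le> 8 * P r" by (rule profile_mono_up_to_constant) (use s in auto)
    finally show ?thesis by simp
  qed
  show ?thesis
  proof (rule that[of "1 / R'"])
    fix x :: 'a assume "1 \<le> 1 / R' * norm x"
    then have x: "R' \<le> norm x" using R' by (simp add: pos_le_divide_eq)
    then have "c / 2 < \<nu> x / Q x" "\<nu> x / Q x < 2 * c" using R[of x] by (auto simp: R'_def)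
    then show "c / 2 * Q x \<le> \<nu> x" "\<nu> x \<le> 2 * c * Q x"
      using Qp[OF x] by (simp_all only: pos_less_divide_eq pos_divide_less_eq less_imp_le)
  qed (use R' Ppos in auto)
qed

text \<open>The part of the jump integral over large jumps, where \<open>\<nu>\<close> is comparable with \<open>Q\<close>, rewritten in the
variable \<open>z = r x\<close>. The function \<open>g\<close> absorbs a lower bound for \<open>\<psi>(r/|z|)\<close> that depends on \<open>z\<close>.\<close>

lemma profile_jump_lower_bound:
  fixes e :: 'a
  assumes e: "norm e = 1" and r: "0 < r" and S [measurable]: "S \<in> sets borel"
    and r0: "\<And>x. 1 \<le> r0 * norm x \<Longrightarrow> c / 2 * Q x \<le> \<nu> x" "\<And>z. z \<in> S \<Longrightarrow> r \<le> r0 * norm z" 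
    and low: "\<And>z. z \<in> S \<Longrightarrow> z \<noteq> 0 \<and> k * g z \<le> c / 2 * P (r / norm z)" and k: "0 \<le> k"
    and g [measurable]: "g \<in> borel_measurable borel" "\<And>z. 0 \<le> g z"
    and I: "ennreal I \<le> (\<integral>\<^sup>+z. ennreal (truncated_square e z * g z) * indicator S z \<partial>homogeneous_measure)" "0 \<le> I"
  shows "k * I \<le> 8 * P r"
proof -
  let ?m = "truncated_square e"
  define h where "h z = ennreal (k * (?m z * g z)) * indicator S z" for z
  have "ennreal (k * I) \<le> ennreal k * (\<integral>\<^sup>+z. ennreal (?m z * g z) * indicator S z \<partial>homogeneous_measure)"
    using k I by (simp add: ennreal_mult mult_left_mono)
  also have "\<dots> = (\<integral>\<^sup>+z. h z \<partial>homogeneous_measure)"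
    unfolding h_def using k g(2) by (subst nn_integral_cmult[symmetric]) (auto simp: ennreal_mult truncated_square_nonneg mult.assoc)
  also have "\<dots> = (\<integral>\<^sup>+x. h (r *\<^sub>R x) \<partial>homogeneous_measure)"
    by (rule nn_integral_homogeneous_scaleR[OF _ r, symmetric]) (simp add: h_def)
  also have "\<dots> = (\<integral>\<^sup>+x. ennreal (norm x powr (- real DIM('a))) * h (r *\<^sub>R x) \<partial>lborel)"
    unfolding homogeneous_measure_def by (rule nn_integral_density) (auto simp: h_def)
  also have "\<dots> \<le> (\<integral>\<^sup>+x. ennreal (?m (r *\<^sub>R x) * \<nu> x) \<partial>lborel)"
  proof (rule nn_integral_mono_AE)
    show "AE x in lborel. ennreal (norm x powr (- real DIM('a))) * h (r *\<^sub>R x) \<le> ennreal (?m (r *\<^sub>R x) * \<nu> x)"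
    proof (rule AE_I2)
      fix x :: 'a
      show "ennreal (norm x powr (- real DIM('a))) * h (r *\<^sub>R x) \<le> ennreal (?m (r *\<^sub>R x) * \<nu> x)"
      proof (cases "r *\<^sub>R x \<in> S")
        case True
        have x0: "x \<noteq> 0" and kg: "k * g (r *\<^sub>R x) \<le> c / 2 * P (r / norm (r *\<^sub>R x))" using low[OF True] by auto
        have P: "r / norm (r *\<^sub>R x) = inverse (norm x)" using r by (simp add: inverse_eq_divide)
        have "1 \<le> r0 * norm x" using r0(2)[OF True] r by simp
        then have "c / 2 * Q x \<le> \<nu> x" by (rule r0(1))
        have "norm x powr (- real DIM('a)) * (k * (?m (r *\<^sub>R x) * g (r *\<^sub>R x))) = ?m (r *\<^sub>R x) * (norm x powr (- real DIM('a)) * (k * g (r *\<^sub>R x)))"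
          by simp
        also have "\<dots> \<le> ?m (r *\<^sub>R x) * (norm x powr (- real DIM('a)) * (c / 2 * P (inverse (norm x))))"
          using kg unfolding P by (intro mult_left_mono) (auto simp: truncated_square_nonneg)
        also have "\<dots> \<le> ?m (r *\<^sub>R x) * \<nu> x"
          using \<open>c / 2 * Q x \<le> \<nu> x\<close> by (intro mult_left_mono) (auto simp: truncated_square_nonneg Q_def mult_ac)
        finally show ?thesis using True by (simp add: h_def ennreal_mult'[symmetric] ennreal_leI)
      qed (simp add: h_def)
    qed
  qed
  also have "\<dots> = ennreal (\<integral>x. ?m (r *\<^sub>R x) * \<nu> x \<partial>lborel)"
  proof (rule nn_integral_eq_integral)
    show "integrable lborel (\<lambda>x. ?m (r *\<^sub>R x) * \<nu> x)"
      using integrable_min[of "r *\<^sub>R e"] by (simp add: truncated_square_def)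
    show "AE x in lborel. 0 \<le> ?m (r *\<^sub>R x) * \<nu> x"
      using AE_nonneg by eventually_elim (simp add: truncated_square_nonneg)
  qed
  also have "(\<integral>x. ?m (r *\<^sub>R x) * \<nu> x \<partial>lborel) \<le> 8 * P r"
  proof -
    have "(\<integral>x. ?m (r *\<^sub>R x) * \<nu> x \<partial>lborel) \<le> 8 * (\<integral>x. (1 - cos ((r *\<^sub>R e) \<bullet> x)) * \<nu> x \<partial>lborel)"
      using truncated_square_le_jump_part[of "r *\<^sub>R e"] by (simp add: truncated_square_def)
    also have "\<dots> \<le> 8 * \<psi> (r *\<^sub>R e)" by (intro mult_left_mono jump_part_le_exponent) simp
    finally show ?thesis using r e by (simp add: exponent_eq_profile)
  qed
  finally show ?thesis
    using profile_nonneg[of r] by (simp add: ennreal_leI ennreal_le_iff)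
qed

text \<open>On an annulus of large logarithmic width, \<open>\<psi>(r/|z|)\<close> is bounded below by a multiple of \<open>\<psi>(r/\<rho>)\<close>, or by
\<open>\<psi>(\<rho>r)/(\<rho>|z|)\<^sup>2\<close>. By \<open>truncated_square_annuli_diverge\<close> the annulus contributes an arbitrarily large
multiple of this to \<open>8 \<psi>(r)\<close>, which forces the gain of a factor 2.\<close>

lemma profile_ratio_decay:
  obtains r0 \<rho> where "0 < r0" "2 \<le> \<rho>" "\<And>x. 1 \<le> r0 * norm x \<Longrightarrow> \<nu> x \<le> 2 * c * Q x" "\<And>r. 0 < r \<Longrightarrow> 0 < P r"
    "\<And>r. 0 < r \<Longrightarrow> r \<le> r0 \<Longrightarrow> P (r / \<rho>) \<le> P r / 2"
    "\<And>r. 0 < r \<Longrightarrow> \<rho> * r \<le> r0 \<Longrightarrow> P (\<rho> * r) \<le> \<rho>\<^sup>2 / 2 * P r"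
proof -
  obtain r0 where r0: "0 < r0" "\<And>x. 1 \<le> r0 * norm x \<Longrightarrow> c / 2 * Q x \<le> \<nu> x"
    "\<And>x. 1 \<le> r0 * norm x \<Longrightarrow> \<nu> x \<le> 2 * c * Q x" "\<And>r. 0 < r \<Longrightarrow> 0 < P r" using density_bounds by blast
  obtain e :: 'a where e: "norm e = 1" by (rule obtain_unit)
  obtain k where k: "0 < k" and 
    I1: "\<And>n. ennreal (real n * k) \<le> (\<integral>\<^sup>+z. ennreal (truncated_square e z) * indicator {z. 1 < norm z \<and> norm z < 2 ^ n} z \<partial>homogeneous_measure)" and
    I2: "\<And>n. ennreal (real n * k) \<le> (\<integral>\<^sup>+z. ennreal (truncated_square e z / (norm z)\<^sup>2) * indicator {z. (1/2) ^ n < norm z \<and> norm z < 1} z \<partial>homogeneous_measure)"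
    by (rule truncated_square_annuli_diverge[OF e], rule that)
  \<comment> \<open>1024 covers the product of all constants lost below.\<close>
  obtain n0 :: nat where n0: "1024 / (c * k) < real n0" using reals_Archimedean2 by blast
  define n where "n = Suc n0"
  have n: "1024 \<le> c * (real n * k)"
  proof -
    have "1024 < c * k * real n0" using n0 c_pos k by (simp add: pos_divide_less_eq mult.commute)
    also have "\<dots> \<le> c * (real n * k)" using c_pos k by (simp add: n_def mult_ac)
    finally show ?thesis by simp
  qed
  define \<rho> where "\<rho> = (2::real) ^ n"
  have \<rho>: "2 \<le> \<rho>" by (simp add: \<rho>_def n_def)
  have low: "P (r / \<rho>) \<le> P r / 2" if r: "0 < r" "r \<le> r0" for r
  proof -
    have "(c / 16 * P (r / \<rho>)) * (real n * k) \<le> 8 * P r"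
    proof (rule profile_jump_lower_bound[OF e r(1), where S = "{z. 1 < norm z \<and> norm z < 2 ^ n}" and g = "\<lambda>z. 1" and ?r0.0 = r0])
      fix z :: 'a assume z: "z \<in> {z. 1 < norm z \<and> norm z < 2 ^ n}"
      show "r \<le> r0 * norm z" using z r r0(1) by (auto intro: order_trans[OF r(2)])
      have "P (r / \<rho>) \<le> 8 * P (r / norm z)"
      proof (rule profile_mono_up_to_constant)
        have "0 < norm z" "norm z \<le> \<rho>" using z by (auto simp: \<rho>_def intro: less_trans[OF zero_less_one])
        then show "r / \<rho> \<le> r / norm z" using r \<rho> by (intro divide_left_mono mult_pos_pos) auto
      qed (use r \<rho> in auto)
      then have "c / 16 * P (r / \<rho>) \<le> c / 16 * (8 * P (r / norm z))" using c_pos by (intro mult_left_mono) auto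
      then show "z \<noteq> 0 \<and> c / 16 * P (r / \<rho>) * 1 \<le> c / 2 * P (r / norm z)" using z by auto
    qed (use r0(2) I1[of n] k c_pos profile_nonneg in auto)
    moreover have "1024 * P (r / \<rho>) \<le> c * (real n * k) * P (r / \<rho>)" using n profile_nonneg by (rule mult_right_mono)
    ultimately have "1024 * P (r / \<rho>) \<le> 128 * P r" by (simp add: algebra_simps)
    then show ?thesis using profile_nonneg[of r] by linarith
  qed
  have up: "P (\<rho> * r) \<le> \<rho>\<^sup>2 / 2 * P r" if r: "0 < r" "\<rho> * r \<le> r0" for r
  proof -
    have "(c / (64 * \<rho>\<^sup>2) * P (\<rho> * r)) * (real n * k) \<le> 8 * P r"
    proof (rule profile_jump_lower_bound[OF e r(1), where S = "{z. (1/2) ^ n < norm z \<and> norm z < 1}" and g = "\<lambda>z. 1 / (norm z)\<^sup>2" and ?r0.0 = r0])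
      fix z :: 'a assume "z \<in> {z. (1/2) ^ n < norm z \<and> norm z < 1}"
      then have z: "1 / \<rho> < norm z" "norm z < 1" by (auto simp: \<rho>_def power_one_over)
      then have z0: "0 < norm z" using \<rho> by (meson divide_pos_pos less_le_trans less_trans zero_less_numeral zero_less_one)
      have z1: "1 < \<rho> * norm z" using z(1) \<rho> by (simp add: pos_divide_less_eq mult.commute)
      have "r = 1 * r" by simp
      also have "\<dots> \<le> (\<rho> * norm z) * r" using z1 r by (intro mult_right_mono) auto
      also have "\<dots> \<le> r0 * norm z" using mult_right_mono[OF r(2), of "norm z"] by (simp add: mult_ac)
      finally show "r \<le> r0 * norm z" .
      have "P (\<rho> * r) = P ((\<rho> * norm z) * (r / norm z))" using z0 by simp
      also have "\<dots> \<le> 8 * (1 + \<rho> * norm z)\<^sup>2 * P (r / norm z)" by (rule profile_mult_le) (use z1 z0 r in auto)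
      also have "\<dots> \<le> 8 * (2 * (\<rho> * norm z))\<^sup>2 * P (r / norm z)"
        using z1 profile_nonneg by (intro mult_right_mono mult_left_mono power_mono) auto
      finally have "P (\<rho> * r) \<le> 32 * \<rho>\<^sup>2 * (norm z)\<^sup>2 * P (r / norm z)" by (simp add: power_mult_distrib mult_ac)
      then have "(c / (64 * \<rho>\<^sup>2 * (norm z)\<^sup>2)) * P (\<rho> * r) \<le> (c / (64 * \<rho>\<^sup>2 * (norm z)\<^sup>2)) * (32 * \<rho>\<^sup>2 * (norm z)\<^sup>2 * P (r / norm z))"
        using c_pos by (intro mult_left_mono) auto
      also have "\<dots> = c / 2 * P (r / norm z)" using \<rho> z0 by (simp add: field_simps)
      finally show "z \<noteq> 0 \<and> c / (64 * \<rho>\<^sup>2) * P (\<rho> * r) * (1 / (norm z)\<^sup>2) \<le> c / 2 * P (r / norm z)" using z0 by (auto simp: mult_ac)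
    qed (use r0(2) I2[of n] k c_pos profile_nonneg in auto)
    then have "c * (real n * k) * P (\<rho> * r) \<le> 512 * \<rho>\<^sup>2 * P r" using \<rho> by (simp add: field_simps)
    moreover have "1024 * P (\<rho> * r) \<le> c * (real n * k) * P (\<rho> * r)" using n profile_nonneg by (rule mult_right_mono)
    ultimately show ?thesis by simp
  qed
  show ?thesis by (rule that[OF r0(1) \<rho> r0(3) r0(4) low up])
qed

end

context regular_levy_density
begin

text \<open>Iterating \<open>profile_ratio_decay\<close> gives power bounds; the exponent \<open>\<epsilon>\<close> is chosen such that \<open>\<rho>\<close> to the power
\<open>\<epsilon>\<close> is 2.\<close>

lemma profile_power_bounds:
  obtains r0 C \<epsilon> where "0 < r0" "0 < \<epsilon>" "\<epsilon> < 2" "1 \<le> C" "\<And>x. 1 \<le> r0 * norm x \<Longrightarrow> \<nu> x \<le> 2 * c * Q x" "\<And>r. 0 < r \<Longrightarrow> 0 < P r"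
    "\<And>r l. 0 < r \<Longrightarrow> r \<le> r0 \<Longrightarrow> 0 < l \<Longrightarrow> l \<le> 1 \<Longrightarrow> P (l * r) \<le> C * l powr \<epsilon> * P r"
    "\<And>r l. 0 < r \<Longrightarrow> 1 \<le> l \<Longrightarrow> l * r \<le> r0 \<Longrightarrow> P (l * r) \<le> C * l powr (2 - \<epsilon>) * P r"
proof -
  obtain r0 \<rho> where r0: "0 < r0" and \<rho>: "2 \<le> \<rho>" and dens: "\<And>x. 1 \<le> r0 * norm x \<Longrightarrow> \<nu> x \<le> 2 * c * Q x"
    and Ppos: "\<And>r. 0 < r \<Longrightarrow> 0 < P r" and low: "\<And>r. 0 < r \<Longrightarrow> r \<le> r0 \<Longrightarrow> P (r / \<rho>) \<le> P r / 2"
    and up: "\<And>r. 0 < r \<Longrightarrow> \<rho> * r \<le> r0 \<Longrightarrow> P (\<rho> * r) \<le> \<rho>\<^sup>2 / 2 * P r"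
    using profile_ratio_decay by blast
  define \<epsilon> where "\<epsilon> = log \<rho> 2"
  have \<epsilon>: "0 < \<epsilon>" "\<epsilon> \<le> 1" using \<rho> by (auto simp: \<epsilon>_def)
  have \<rho>\<epsilon>: "\<rho> powr \<epsilon> = 2" using \<rho> by (simp add: \<epsilon>_def)
  have pw: "(\<rho> ^ k) powr a = (\<rho> powr a) ^ k" for k a
    using \<rho> by (simp add: powr_realpow[symmetric] powr_powr powr_power mult.commute)
  define C where "C = 8 * (1 + \<rho>)\<^sup>2"
  have C: "16 \<le> C"
  proof -
    have "(1 + 1)\<^sup>2 \<le> (1 + \<rho>)\<^sup>2" using \<rho> by (intro power_mono) auto
    then show ?thesis by (simp add: C_def)
  qed
  have low_iter: "P (r / \<rho> ^ k) \<le> P r / 2 ^ k" if r: "0 < r" "r \<le> r0" for r k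
  proof (induction k)
    case (Suc k)
    have "r / \<rho> ^ k \<le> r" using r \<rho> by (simp add: pos_divide_le_eq one_le_power)
    then have "P ((r / \<rho> ^ k) / \<rho>) \<le> P (r / \<rho> ^ k) / 2" using r \<rho> by (intro low) auto
    then show ?case using Suc by (simp add: mult.commute)
  qed simp
  have up_iter: "P (\<rho> ^ k * r) \<le> (\<rho>\<^sup>2 / 2) ^ k * P r" if r: "0 < r" "\<rho> ^ k * r \<le> r0" for r k
    using r(2)
  proof (induction k)
    case (Suc k)
    have le: "\<rho> ^ k * r \<le> \<rho> * (\<rho> ^ k * r)"
      using mult_right_mono[of 1 \<rho> "\<rho> ^ k * r"] r \<rho> by simp
    have "P (\<rho> * (\<rho> ^ k * r)) \<le> \<rho>\<^sup>2 / 2 * P (\<rho> ^ k * r)" using Suc.prems r \<rho> by (intro up) (auto simp: mult.assoc)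
    also have "\<dots> \<le> \<rho>\<^sup>2 / 2 * ((\<rho>\<^sup>2 / 2) ^ k * P r)"
      using Suc.prems le by (intro mult_left_mono Suc.IH) (auto simp: mult.assoc)
    finally show ?case by (simp add: mult.assoc)
  qed simp
  show ?thesis
  proof (rule that[of r0 \<epsilon> C])
    fix r l :: real assume r: "0 < r" "r \<le> r0" and l: "0 < l" "l \<le> 1"
    obtain k where k: "\<rho> ^ k \<le> 1 / l" "1 / l < \<rho> ^ Suc k" using exists_power_bracket[of \<rho> "1 / l"] \<rho> l by auto
    have \<rho>k: "0 < \<rho> ^ k" using \<rho> by simp
    have "l * r \<le> r / \<rho> ^ k" using mult_right_mono[OF k(1), of "l * r"] l r \<rho>k by (simp add: pos_le_divide_eq mult_ac)
    then have "P (l * r) \<le> 8 * P (r / \<rho> ^ k)" using l r by (intro profile_mono_up_to_constant) auto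
    also have "\<dots> \<le> 8 * (P r / 2 ^ k)" by (intro mult_left_mono low_iter r) simp
    also have "1 / 2 ^ k \<le> 2 * l powr \<epsilon>"
    proof -
      have "(1 / l) powr \<epsilon> \<le> (\<rho> ^ Suc k) powr \<epsilon>" using k l \<epsilon> by (intro powr_mono2) auto
      also have "\<dots> = 2 ^ Suc k" unfolding pw \<rho>\<epsilon> ..
      finally show ?thesis using l by (simp add: powr_divide field_simps)
    qed
    then have "8 * (P r / 2 ^ k) \<le> 16 * l powr \<epsilon> * P r"
      using mult_left_mono[of "1 / 2 ^ k" "2 * l powr \<epsilon>" "8 * P r"] profile_nonneg[of r] by (simp add: mult_ac)
    also have "16 * l powr \<epsilon> * P r \<le> C * l powr \<epsilon> * P r"
      using C profile_nonneg by (intro mult_right_mono) auto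
    finally show "P (l * r) \<le> C * l powr \<epsilon> * P r" by simp
  next
    fix r l :: real assume r: "0 < r" and l: "1 \<le> l" "l * r \<le> r0"
    obtain k where k: "\<rho> ^ k \<le> l" "l < \<rho> ^ Suc k" using exists_power_bracket[of \<rho> l] \<rho> l by auto
    have \<rho>k: "0 < \<rho> ^ k" using \<rho> by simp
    have kr: "\<rho> ^ k * r \<le> r0" using order_trans[OF mult_right_mono[OF k(1), of r] l(2)] r by simp
    have "P (l * r) = P ((l / \<rho> ^ k) * (\<rho> ^ k * r))" using \<rho> by simp
    also have "\<dots> \<le> 8 * (1 + l / \<rho> ^ k)\<^sup>2 * P (\<rho> ^ k * r)" by (rule profile_mult_le) (use l r \<rho>k in auto)
    also have "\<dots> \<le> C * P (\<rho> ^ k * r)"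
    proof (rule mult_right_mono)
      have "l / \<rho> ^ k \<le> \<rho>" using k(2) \<rho>k by (simp add: pos_divide_le_eq)
      then show "8 * (1 + l / \<rho> ^ k)\<^sup>2 \<le> C" unfolding C_def using l \<rho>k by (intro mult_left_mono power_mono) auto
    qed (rule profile_nonneg)
    also have "\<dots> \<le> C * ((\<rho>\<^sup>2 / 2) ^ k * P r)" using C up_iter[OF r kr] by (intro mult_left_mono) auto
    also have "(\<rho>\<^sup>2 / 2) ^ k \<le> l powr (2 - \<epsilon>)"
    proof -
      have "\<rho>\<^sup>2 / 2 = \<rho> powr (2 - \<epsilon>)" using \<rho> by (simp add: powr_diff \<rho>\<epsilon>)
      then have "(\<rho>\<^sup>2 / 2) ^ k = (\<rho> ^ k) powr (2 - \<epsilon>)" by (simp add: pw)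
      also have "\<dots> \<le> l powr (2 - \<epsilon>)" using k(1) \<rho>k \<epsilon> by (intro powr_mono2) auto
      finally show ?thesis .
    qed
    then have "C * ((\<rho>\<^sup>2 / 2) ^ k * P r) \<le> C * (l powr (2 - \<epsilon>) * P r)"
      using C profile_nonneg by (intro mult_left_mono mult_right_mono) auto
    finally show "P (l * r) \<le> C * l powr (2 - \<epsilon>) * P r" by (simp add: mult.assoc)
  qed (use r0 \<epsilon> C dens Ppos in auto)
qed

end

text \<open>Constants are fixed here so that the kernel and the bounds of the convolution equation can be named.\<close>

locale levy_density_bounds = regular_levy_density \<psi> \<eta> \<nu> c
  for \<psi> :: "'a::euclidean_space \<Rightarrow> real" and \<eta> \<nu> c +
  fixes e :: 'a and r0 C \<epsilon> :: real
  assumes unit: "norm e = 1" and r0_pos: "0 < r0" and \<epsilon>_pos: "0 < \<epsilon>" and \<epsilon>_less: "\<epsilon> < 2" and C_ge: "1 \<le> C"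
    and density_upper: "\<And>x. 1 \<le> r0 * norm x \<Longrightarrow> \<nu> x \<le> 2 * c * Q x"
    and profile_pos: "\<And>r. 0 < r \<Longrightarrow> 0 < P r"
    and profile_lower_scaling: "\<And>r l. 0 < r \<Longrightarrow> r \<le> r0 \<Longrightarrow> 0 < l \<Longrightarrow> l \<le> 1 \<Longrightarrow> P (l * r) \<le> C * l powr \<epsilon> * P r"
    and profile_upper_scaling: "\<And>r l. 0 < r \<Longrightarrow> 1 \<le> l \<Longrightarrow> l * r \<le> r0 \<Longrightarrow> P (l * r) \<le> C * l powr (2 - \<epsilon>) * P r"
begin

text \<open>The logarithmic image of \<open>c (1 - cos \<langle>e, z\<rangle>) \<Lambda>(dz)\<close>. The sign of the logarithm matches the argument
\<open>1/|x|\<close> of \<open>\<psi>\<close> in (iii).\<close>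

definition kernel :: "real measure" where
  "kernel = distr (density homogeneous_measure (\<lambda>z. ennreal (c * (1 - cos (e \<bullet> z))))) borel (\<lambda>z. - ln (norm z))"

text \<open>The power bounds of \<open>profile_power_bounds\<close> in logarithmic variables.\<close>

definition B :: "real \<Rightarrow> real" where
  "B s = (if s \<le> 0 then C * exp (\<epsilon> * s) else C * exp ((2 - \<epsilon>) * s))"

definition \<delta> :: "real \<Rightarrow> real" where "\<delta> s = sqrt (C * \<bar>exp s - 1\<bar> powr \<epsilon>)"

text \<open>Near 0 this is what \<open>exponent_add_le\<close> yields with its parameter equal to \<open>\<delta>(s)\<close>. The value further
away only serves to bound the oscillation for every \<open>s\<close>.\<close>

definition \<omega> :: "real \<Rightarrow> real" where
  "\<omega> s = (if \<bar>exp s - 1\<bar> \<le> 1 then \<delta> s * (1 + \<delta> s)\<^sup>2 + 2 * \<delta> s + (\<delta> s)\<^sup>2 else 1 + 8 * (1 + exp s)\<^sup>2)"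

lemma B_measurable [measurable]: "B \<in> borel_measurable borel" unfolding B_def by measurable

lemma B_nonneg: "0 \<le> B s" using C_ge by (simp add: B_def)

lemma sets_kernel [measurable_cong, simp]: "sets kernel = sets borel" by (simp add: kernel_def)

lemma integral_kernel:
  assumes [measurable]: "h \<in> borel_measurable borel"
  shows "(\<integral>v. h v \<partial>kernel) = (\<integral>z. c * (1 - cos (e \<bullet> z)) * (h (- ln (norm z)) :: real) \<partial>homogeneous_measure)"
    and "integrable kernel h \<longleftrightarrow> integrable homogeneous_measure (\<lambda>z. c * (1 - cos (e \<bullet> z)) * h (- ln (norm z)))"
  unfolding kernel_def using c_pos
  by (simp_all add: integral_distr integrable_distr_eq integral_density integrable_density cos_le_one)

lemma B_minus_ln:
  assumes "z \<noteq> (0::'a)"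
  shows "1 \<le> norm z \<Longrightarrow> B (- ln (norm z)) = C * norm z powr (- \<epsilon>)"
    and "norm z < 1 \<Longrightarrow> B (- ln (norm z)) = C * norm z powr (- (2 - \<epsilon>))"
  using assms by (auto simp: B_def powr_def algebra_simps)

text \<open>The kernel behaves like \<open>min 1 (|z|\<^sup>2)\<close>, and the bounds on \<open>\<psi>\<close> leave a margin \<open>\<epsilon>\<close> at both ends.\<close>

lemma truncated_square_times_B_le:
  assumes "z \<noteq> (0::'a)"
  shows "min 1 ((norm z)\<^sup>2) * B (- ln (norm z)) \<le> C * min (norm z powr \<epsilon>) (norm z powr (- \<epsilon>))"
proof (cases "1 \<le> norm z")
  case True
  have "min 1 ((norm z)\<^sup>2) \<le> 1" by simp
  then have "min 1 ((norm z)\<^sup>2) * B (- ln (norm z)) \<le> 1 * B (- ln (norm z))" by (rule mult_right_mono[OF _ B_nonneg])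
  also have "\<dots> = C * norm z powr (- \<epsilon>)" using B_minus_ln(1)[OF assms True] by simp
  also have "norm z powr (- \<epsilon>) = min (norm z powr \<epsilon>) (norm z powr (- \<epsilon>))"
    using True \<epsilon>_pos by (intro min_absorb2[symmetric] powr_mono) auto
  finally show ?thesis .
next
  case False
  then have z: "0 < norm z" "norm z < 1" using assms by auto
  have "min 1 ((norm z)\<^sup>2) * B (- ln (norm z)) \<le> (norm z)\<^sup>2 * B (- ln (norm z))"
    by (rule mult_right_mono[OF _ B_nonneg]) simp
  also have "\<dots> = C * ((norm z) powr 2 * norm z powr (- (2 - \<epsilon>)))" using B_minus_ln(2)[OF assms z(2)] z by simp
  also have "(norm z) powr 2 * norm z powr (- (2 - \<epsilon>)) = norm z powr \<epsilon>" by (simp add: powr_add[symmetric] del: powr_numeral)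
  also have "norm z powr \<epsilon> = min (norm z powr \<epsilon>) (norm z powr (- \<epsilon>))"
    using z \<epsilon>_pos by (intro min_absorb1[symmetric] powr_mono') auto
  finally show ?thesis .
qed

lemma integrable_kernel_bound:
  assumes "0 \<le> x"
  shows "integrable homogeneous_measure (\<lambda>z. (1 - cos ((x *\<^sub>R e) \<bullet> z)) * B (- ln (norm z)))"
proof (rule Bochner_Integration.integrable_bound)
  show "integrable homogeneous_measure (\<lambda>z::'a. (2 + x\<^sup>2) * (C * min (norm z powr \<epsilon>) (norm z powr (- \<epsilon>))))"
    using integrable_homogeneous_min_powr[OF \<epsilon>_pos \<epsilon>_pos, where 'a = 'a] by simp
  show "AE z in homogeneous_measure. norm ((1 - cos ((x *\<^sub>R e) \<bullet> z)) * B (- ln (norm z))) \<le> norm ((2 + x\<^sup>2) * (C * min (norm z powr \<epsilon>) (norm z powr (- \<epsilon>))))"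
  proof (rule AE_I2)
    fix z :: 'a
    show "norm ((1 - cos ((x *\<^sub>R e) \<bullet> z)) * B (- ln (norm z))) \<le> norm ((2 + x\<^sup>2) * (C * min (norm z powr \<epsilon>) (norm z powr (- \<epsilon>))))"
    proof (cases "z = 0")
      case False
      have "1 - cos ((x *\<^sub>R e) \<bullet> z) \<le> (2 + x\<^sup>2) * min 1 ((norm z)\<^sup>2)"
        using order_trans[OF one_minus_cos_le min_square_le, of "x *\<^sub>R e" z] unit assms by simp
      then have "(1 - cos ((x *\<^sub>R e) \<bullet> z)) * B (- ln (norm z)) \<le> (2 + x\<^sup>2) * min 1 ((norm z)\<^sup>2) * B (- ln (norm z))"
        by (rule mult_right_mono[OF _ B_nonneg])
      also have "\<dots> \<le> (2 + x\<^sup>2) * (C * min (norm z powr \<epsilon>) (norm z powr (- \<epsilon>)))"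
        using truncated_square_times_B_le[OF False] unfolding mult.assoc by (intro mult_left_mono) auto
      finally have le: "(1 - cos ((x *\<^sub>R e) \<bullet> z)) * B (- ln (norm z)) \<le> (2 + x\<^sup>2) * (C * min (norm z powr \<epsilon>) (norm z powr (- \<epsilon>)))" .
      have "0 \<le> (1 - cos ((x *\<^sub>R e) \<bullet> z)) * B (- ln (norm z))" using B_nonneg by simp
      with le show ?thesis by simp
    qed simp
  qed
qed measurable

sublocale convolution_equation kernel B \<omega>
proof
  show "sets kernel = sets borel" by simp
next
  show "integrable kernel B"
    using integrable_kernel_bound[of 1] by (simp add: integral_kernel(2) mult.assoc)
next
  have d0: "(\<delta> \<longlongrightarrow> 0) (at 0)"
  proof -
    have "((\<lambda>s. \<bar>exp s - 1\<bar> powr \<epsilon>) \<longlongrightarrow> 0) (at (0::real))"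
    proof (rule tendsto_zero_powrI)
      show "((\<lambda>s. \<bar>exp s - 1\<bar>) \<longlongrightarrow> 0) (at (0::real))"
        by (intro tendsto_rabs_zero LIM_zero) (auto intro!: tendsto_eq_intros)
    qed (use \<epsilon>_pos in auto)
    then have "((\<lambda>s. sqrt (C * \<bar>exp s - 1\<bar> powr \<epsilon>)) \<longlongrightarrow> sqrt (C * 0)) (at (0::real))" by (intro tendsto_intros)
    then show ?thesis unfolding \<delta>_def by simp
  qed
  have "((\<lambda>s. \<delta> s * (1 + \<delta> s)\<^sup>2 + 2 * \<delta> s + (\<delta> s)\<^sup>2) \<longlongrightarrow> 0 * (1 + 0)\<^sup>2 + 2 * 0 + 0\<^sup>2) (at 0)"
    by (intro tendsto_intros d0)
  moreover have "((\<lambda>s. \<bar>exp s - 1\<bar>) \<longlongrightarrow> 0) (at (0::real))"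
    by (intro tendsto_rabs_zero LIM_zero) (auto intro!: tendsto_eq_intros)
  then have "eventually (\<lambda>s. \<bar>exp s - 1\<bar> < 1) (at (0::real))" by (rule order_tendstoD) simp
  then have "eventually (\<lambda>s. \<delta> s * (1 + \<delta> s)\<^sup>2 + 2 * \<delta> s + (\<delta> s)\<^sup>2 = \<omega> s) (at 0)"
    by eventually_elim (simp add: \<omega>_def)
  ultimately show "(\<omega> \<longlongrightarrow> 0) (at 0)" using Lim_transform_eventually by fastforce
next
  fix a b :: real assume ab: "a < b"
  let ?U = "{z::'a. exp (- b) < norm z \<and> norm z < exp (- a) \<and> cos (e \<bullet> z) < 1}"
  have U: "open ?U" by (intro open_Collect_conj open_Collect_less continuous_intros)
  have ee: "e \<bullet> e = 1" using unit by (simp add: dot_square_norm)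
  have "\<exists>t\<in>{exp (- b)<..<exp (- a)}. cos t < 1"
  proof -
    define t where "t = (exp (- b) + exp (- a)) / 2"
    have t: "exp (- b) < t" "t < exp (- a)" using ab by (simp_all add: t_def)
    show ?thesis
    proof (cases "cos t = 1")
      case False
      then have "cos t < 1" using cos_le_one[of t] by (simp only: less_le simp_thms)
      then show ?thesis using t by (intro bexI[of _ t]) auto
    next
      case True
      \<comment> \<open>If the cosine is 1 at \<open>t\<close>, then its value at \<open>t + h\<close> is \<open>cos h\<close>.\<close>
      define h where "h = min ((exp (- a) - t) / 2) 1"
      have h: "0 < h" "h \<le> 1" "h < exp (- a) - t" using t(2) by (auto simp: h_def min_less_iff_disj)
      have "sin t = 0" using True sin_cos_squared_add[of t] by simp
      then have "cos (t + h) = cos h" using True by (simp add: cos_add)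
      moreover have "cos h < cos 0" using h pi_ge_two by (intro cos_monotone_0_pi) auto
      ultimately show ?thesis using t h by (intro bexI[of _ "t + h"]) auto
    qed
  qed
  then obtain t where t: "exp (- b) < t" "t < exp (- a)" "cos t < 1" by auto
  have "t > 0" using t(1) by (meson exp_gt_zero less_trans)
  then have "t *\<^sub>R e \<in> ?U" using t unit ee by simp
  then have ne: "?U \<noteq> {}" by blast
  have "(\<integral>\<^sup>+z. ennreal (c * (1 - cos (e \<bullet> z))) * indicator ?U z \<partial>homogeneous_measure) \<noteq> 0"
    by (rule nn_integral_homogeneous_pos[OF _ U ne]) (use c_pos in \<open>auto simp: less_trans[OF exp_gt_zero]\<close>)
  moreover have "(\<integral>\<^sup>+z. ennreal (c * (1 - cos (e \<bullet> z))) * indicator ?U z \<partial>homogeneous_measure) \<le> emeasure kernel {a<..<b}"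
  proof -
    have [measurable]: "(\<lambda>z::'a. - ln (norm z)) -` {a<..<b} \<in> sets borel"
      using measurable_sets[of "\<lambda>z::'a. - ln (norm z)" borel borel "{a<..<b}"] by simp
    have "emeasure kernel {a<..<b} = (\<integral>\<^sup>+z. ennreal (c * (1 - cos (e \<bullet> z))) * indicator ((\<lambda>z. - ln (norm z)) -` {a<..<b}) z \<partial>homogeneous_measure)"
      unfolding kernel_def by (subst emeasure_distr) (auto simp: emeasure_density)
    also have "\<dots> \<ge> (\<integral>\<^sup>+z. ennreal (c * (1 - cos (e \<bullet> z))) * indicator ?U z \<partial>homogeneous_measure)"
    proof (intro nn_integral_mono mult_left_mono)
      fix z :: 'a
      have "a < - ln (norm z) \<and> - ln (norm z) < b" if "z \<in> ?U"
      proof -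
        have z: "0 < norm z" "exp (- b) < norm z" "norm z < exp (- a)" using that by (auto intro: less_trans[OF exp_gt_zero])
        have "- b < ln (norm z)" using z by (metis exp_less_cancel_iff exp_ln)
        moreover have "ln (norm z) < - a" using z by (metis exp_less_cancel_iff exp_ln)
        ultimately show ?thesis by linarith
      qed
      then show "indicator ?U z \<le> (indicator ((\<lambda>z. - ln (norm z)) -` {a<..<b}) z :: ennreal)"
        by (auto simp: indicator_def)
    qed simp
    finally show ?thesis .
  qed
  ultimately show "emeasure kernel {a<..<b} \<noteq> 0" by auto
qed

lemma profile_exp_le_B:
  assumes r: "0 < r" "r \<le> r0" "exp s * r \<le> r0"
  shows "P (exp s * r) \<le> B s * P r"
proof (cases "s \<le> 0")
  case True
  have "P (exp s * r) \<le> C * exp s powr \<epsilon> * P r" by (rule profile_lower_scaling) (use r True in auto)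
  then show ?thesis using True by (simp add: B_def powr_def)
next
  case False
  have "P (exp s * r) \<le> C * exp s powr (2 - \<epsilon>) * P r" by (rule profile_upper_scaling) (use r False in auto)
  then show ?thesis using False by (simp add: B_def powr_def)
qed

text \<open>Write \<open>d = \<delta>(s)\<close>, so that \<open>\<psi>(|e\<^sup>s - 1| r) \<le> d\<^sup>2 \<psi>(r)\<close>, and apply \<open>exponent_add_le\<close> with parameter \<open>d\<close> to the
steps from \<open>r\<close> to \<open>e\<^sup>s r\<close> and back.\<close>

lemma profile_equicontinuous:
  assumes r: "0 < r" "r \<le> r0"
  shows "\<bar>P (exp s * r) - P r\<bar> \<le> \<omega> s * P r"
proof (cases "\<bar>exp s - 1\<bar> \<le> 1")
  case False
  have "P (exp s * r) \<le> 8 * (1 + exp s)\<^sup>2 * P r" by (rule profile_mult_le) (use r in auto)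
  then have "\<bar>P (exp s * r) - P r\<bar> \<le> 8 * (1 + exp s)\<^sup>2 * P r + P r"
    using profile_nonneg[of r] profile_nonneg[of "exp s * r"] by linarith
  then show ?thesis using False by (simp add: \<omega>_def algebra_simps)
next
  case True
  show ?thesis
  proof (cases "s = 0")
    case True
    have "0 \<le> \<omega> 0" using C_ge by (simp add: \<omega>_def \<delta>_def)
    then show ?thesis using True profile_nonneg[of r] by simp
  next
    case False
    define d where "d = \<delta> s"
    define m where "m = \<bar>exp s - 1\<bar>"
    have m: "0 < m" "m \<le> 1" using True False by (auto simp: m_def)
    have d: "0 < d" "d\<^sup>2 = C * m powr \<epsilon>" using C_ge m by (auto simp: d_def \<delta>_def m_def)
    have Pm: "P (m * r) \<le> d\<^sup>2 * P r" unfolding d(2) by (rule profile_lower_scaling) (use r m in auto)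
    have dd: "(1 + 1 / d) * P (m * r) \<le> (d\<^sup>2 + d) * P r"
    proof -
      have "(1 + 1 / d) * P (m * r) \<le> (1 + 1 / d) * (d\<^sup>2 * P r)" using Pm d(1) by (intro mult_left_mono) auto
      also have "\<dots> = (d\<^sup>2 + d) * P r" using d(1) by (simp add: field_simps power2_eq_square)
      finally show ?thesis .
    qed
    have pr: "P (exp s * r) = \<psi> ((exp s * r) *\<^sub>R e)" "P r = \<psi> (r *\<^sub>R e)"
      using profile_eq_exponent[OF unit] r by simp_all
    have pm: "P (m * r) = \<psi> ((exp s - 1) *\<^sub>R r *\<^sub>R e)" "P (m * r) = \<psi> ((1 - exp s) *\<^sub>R r *\<^sub>R e)"
      using r unit by (simp_all add: exponent_eq_profile m_def abs_minus_commute abs_mult)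
    have "\<psi> (r *\<^sub>R e + (exp s - 1) *\<^sub>R r *\<^sub>R e) \<le> (1 + d) * P r + (1 + 1 / d) * P (m * r)"
      unfolding pr pm(1) by (rule exponent_add_le[OF d(1)])
    also have "r *\<^sub>R e + (exp s - 1) *\<^sub>R r *\<^sub>R e = (exp s * r) *\<^sub>R e" by (simp add: algebra_simps)
    finally have up: "P (exp s * r) \<le> (1 + d)\<^sup>2 * P r"
      using dd unfolding pr(1)[symmetric] by (simp add: power2_eq_square algebra_simps)
    have "\<psi> ((exp s * r) *\<^sub>R e + (1 - exp s) *\<^sub>R r *\<^sub>R e) \<le> (1 + d) * P (exp s * r) + (1 + 1 / d) * P (m * r)"
      unfolding pr(1) pm(2) by (rule exponent_add_le[OF d(1)])
    also have "(exp s * r) *\<^sub>R e + (1 - exp s) *\<^sub>R r *\<^sub>R e = r *\<^sub>R e" by (simp add: algebra_simps)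
    finally have "P r \<le> (1 + d) * P (exp s * r) + (d\<^sup>2 + d) * P r"
      using dd unfolding pr(2)[symmetric] by linarith
    moreover have "d * P (exp s * r) \<le> d * ((1 + d)\<^sup>2 * P r)" using up d by (intro mult_left_mono) auto
    ultimately have lo: "P r - P (exp s * r) \<le> (d * (1 + d)\<^sup>2 + d\<^sup>2 + d) * P r" by (simp add: algebra_simps)
    have w: "\<omega> s = d * (1 + d)\<^sup>2 + 2 * d + d\<^sup>2" using True by (simp add: \<omega>_def d_def)
    have "P (exp s * r) - P r \<le> (2 * d + d\<^sup>2) * P r" using up by (simp add: power2_eq_square algebra_simps)
    also have "\<dots> \<le> \<omega> s * P r" unfolding w using d profile_nonneg by (intro mult_right_mono) auto
    finally have 1: "P (exp s * r) - P r \<le> \<omega> s * P r" .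
    have "(d * (1 + d)\<^sup>2 + d\<^sup>2 + d) * P r \<le> \<omega> s * P r" unfolding w using d profile_nonneg by (intro mult_right_mono) auto
    with lo 1 show ?thesis by linarith
  qed
qed

text \<open>The density, with respect to \<open>\<Lambda>\<close>, of the Levy measure of large jumps after rescaling by \<open>r\<close> and division
by \<open>\<psi>(r)\<close>. In this form the first quotient tends to \<open>c\<close> and the second one to \<open>G(-ln |z|)\<close>.\<close>

definition rescaled_density :: "real \<Rightarrow> 'a \<Rightarrow> real" where
  "rescaled_density r z = indicator {z. r \<le> r0 * norm z} z * (\<nu> (z /\<^sub>R r) / Q (z /\<^sub>R r)) * (P (r / norm z) / P r)"

lemma rescaled_density_measurable [measurable]: "rescaled_density r \<in> borel_measurable borel"
  unfolding rescaled_density_def by measurable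

lemma rescaled_density_bounds:
  assumes r: "0 < r" "r \<le> r0" and z: "z \<noteq> 0"
  shows "0 \<le> rescaled_density r z" "rescaled_density r z \<le> 2 * c * B (- ln (norm z))"
proof -
  have nz: "0 < norm z" using z by simp
  have quot: "0 \<le> \<nu> (z /\<^sub>R r) / Q (z /\<^sub>R r)" using density_nonneg[of "z /\<^sub>R r"] Q_nonneg r z by simp
  show "0 \<le> rescaled_density r z"
    unfolding rescaled_density_def by (intro mult_nonneg_nonneg quot divide_nonneg_nonneg profile_nonneg) simp
  show "rescaled_density r z \<le> 2 * c * B (- ln (norm z))"
  proof (cases "r \<le> r0 * norm z")
    case True
    then have "1 \<le> r0 * norm (z /\<^sub>R r)" using r by (simp add: field_simps)
    then have up: "\<nu> (z /\<^sub>R r) \<le> 2 * c * Q (z /\<^sub>R r)" by (rule density_upper)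
    have "Q (z /\<^sub>R r) > 0" unfolding Q_def using r z by (simp add: profile_pos)
    then have a: "\<nu> (z /\<^sub>R r) / Q (z /\<^sub>R r) \<le> 2 * c" using up by (simp add: pos_divide_le_eq)
    have ex: "exp (- ln (norm z)) = 1 / norm z" using nz by (simp add: exp_minus inverse_eq_divide)
    have "P (exp (- ln (norm z)) * r) \<le> B (- ln (norm z)) * P r"
      by (rule profile_exp_le_B) (use r True nz in \<open>auto simp: ex pos_divide_le_eq mult.commute\<close>)
    then have b: "P (r / norm z) / P r \<le> B (- ln (norm z))" using profile_pos[OF r(1)] by (simp add: ex pos_divide_le_eq)
    have "rescaled_density r z = (\<nu> (z /\<^sub>R r) / Q (z /\<^sub>R r)) * (P (r / norm z) / P r)"
      using True by (simp add: rescaled_density_def)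
    also have "\<dots> \<le> (2 * c) * B (- ln (norm z))"
      by (rule mult_mono[OF a b]) (use c_pos profile_nonneg in simp_all)
    finally show ?thesis .
  qed (use B_nonneg c_pos in \<open>simp add: rescaled_density_def\<close>)
qed

lemma outer_jump_part_rescaled:
  assumes r: "0 < r"
  shows "(\<integral>y. indicator {y. 1 \<le> r0 * norm y} y * ((1 - cos (((x * r) *\<^sub>R e) \<bullet> y)) * \<nu> y) \<partial>lborel) / P r
    = (\<integral>z. (1 - cos ((x *\<^sub>R e) \<bullet> z)) * rescaled_density r z \<partial>homogeneous_measure)"
proof -
  let ?d = "real DIM('a)"
  let ?F = "\<lambda>z. norm z powr (- ?d) * ((1 - cos ((x *\<^sub>R e) \<bullet> z)) * rescaled_density r z)"
  have "(\<integral>z. (1 - cos ((x *\<^sub>R e) \<bullet> z)) * rescaled_density r z \<partial>homogeneous_measure) = (\<integral>z. ?F z \<partial>lborel)"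
    unfolding homogeneous_measure_def by (subst integral_density) auto
  also have "\<dots> = r ^ DIM('a) * (\<integral>y. ?F (r *\<^sub>R y) \<partial>lborel)"
    by (rule integral_lborel_scaleR[OF _ r]) measurable
  also have "\<dots> = (\<integral>y. r ^ DIM('a) * ?F (r *\<^sub>R y) \<partial>lborel)" by simp
  also have "\<dots> = (\<integral>y. indicator {y. 1 \<le> r0 * norm y} y * ((1 - cos (((x * r) *\<^sub>R e) \<bullet> y)) * \<nu> y) / P r \<partial>lborel)"
  proof (rule Bochner_Integration.integral_cong[OF refl])
    fix y :: 'a
    show "r ^ DIM('a) * ?F (r *\<^sub>R y) = indicator {y. 1 \<le> r0 * norm y} y * ((1 - cos (((x * r) *\<^sub>R e) \<bullet> y)) * \<nu> y) / P r"
    proof (cases "y = 0")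
      case False
      have Q: "Q y = norm y powr (- ?d) * P (1 / norm y)" by (simp add: Q_def inverse_eq_divide)
      have Qp: "0 < Q y" unfolding Q_def using False by (simp add: profile_pos)
      have pw: "r ^ DIM('a) * norm (r *\<^sub>R y) powr (- ?d) = norm y powr (- ?d)"
        using r by (simp add: powr_mult powr_minus powr_realpow)
      have ind: "indicator {z. r \<le> r0 * norm z} (r *\<^sub>R y) = (indicator {y. 1 \<le> r0 * norm y} y :: real)"
      proof -
        have "r \<le> r0 * norm (r *\<^sub>R y) \<longleftrightarrow> r * 1 \<le> r * (r0 * norm y)" using r by (simp add: mult_ac)
        also have "\<dots> \<longleftrightarrow> 1 \<le> r0 * norm y" using r by (simp only: mult_le_cancel_left_pos)
        finally show ?thesis by (simp add: indicator_def)
      qed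
      have "rescaled_density r (r *\<^sub>R y) = indicator {y. 1 \<le> r0 * norm y} y * (\<nu> y / Q y) * (P (1 / norm y) / P r)"
        unfolding rescaled_density_def ind using r by simp
      then have "r ^ DIM('a) * ?F (r *\<^sub>R y) = (r ^ DIM('a) * norm (r *\<^sub>R y) powr (- ?d)) * ((1 - cos ((x *\<^sub>R e) \<bullet> (r *\<^sub>R y))) * (indicator {y. 1 \<le> r0 * norm y} y * (\<nu> y / Q y) * (P (1 / norm y) / P r)))"
        by simp
      also have "\<dots> = indicator {y. 1 \<le> r0 * norm y} y * ((1 - cos ((x *\<^sub>R e) \<bullet> (r *\<^sub>R y))) * (\<nu> y / Q y)) * (norm y powr (- ?d) * P (1 / norm y)) / P r"
        unfolding pw by (simp add: mult_ac)
      also have "\<dots> = indicator {y. 1 \<le> r0 * norm y} y * ((1 - cos (((x * r) *\<^sub>R e) \<bullet> y)) * \<nu> y) / P r"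
        unfolding Q[symmetric] using Qp by (simp add: mult_ac)
      finally show ?thesis .
    qed simp
  qed
  finally show ?thesis by simp
qed

text \<open>Hence the Gaussian part and the small jumps, both of order \<open>r\<^sup>2\<close>, are negligible near zero.\<close>

lemma square_over_profile_tendsto_zero:
  assumes r: "\<And>n. 0 < r n" "\<And>n. r n \<le> r0" "r \<longlonglongrightarrow> 0"
  shows "(\<lambda>n. (r n)\<^sup>2 / P (r n)) \<longlonglongrightarrow> 0"
proof (rule tendsto_sandwich[OF _ _ tendsto_const])
  show "eventually (\<lambda>n. 0 \<le> (r n)\<^sup>2 / P (r n)) sequentially" using profile_nonneg by simp
  show "eventually (\<lambda>n. (r n)\<^sup>2 / P (r n) \<le> C * r0 powr (2 - \<epsilon>) / P r0 * r n powr \<epsilon>) sequentially"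
  proof (intro always_eventually allI)
    fix n
    have p: "0 < P (r n)" "0 < P r0" using profile_pos r(1) r0_pos by auto
    have "P ((r0 / r n) * r n) \<le> C * (r0 / r n) powr (2 - \<epsilon>) * P (r n)"
      by (rule profile_upper_scaling) (use r(1,2)[of n] r0_pos in auto)
    then have "P r0 \<le> C * (r0 / r n) powr (2 - \<epsilon>) * P (r n)" using r(1)[of n] by simp
    moreover have "(r0 / r n) powr (2 - \<epsilon>) = r0 powr (2 - \<epsilon>) * r n powr \<epsilon> / (r n)\<^sup>2"
      using r(1)[of n] r0_pos by (simp add: powr_divide powr_diff)
    ultimately have "P r0 * (r n)\<^sup>2 \<le> C * r0 powr (2 - \<epsilon>) * r n powr \<epsilon> * P (r n)"
      using r(1)[of n] by (simp add: field_simps)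
    then show "(r n)\<^sup>2 / P (r n) \<le> C * r0 powr (2 - \<epsilon>) / P r0 * r n powr \<epsilon>"
      using p by (simp add: field_simps)
  qed
  have "(\<lambda>n. r n powr \<epsilon>) \<longlonglongrightarrow> 0"
    by (rule tendsto_zero_powrI[OF r(3) tendsto_const _ \<epsilon>_pos]) (simp add: less_imp_le[OF r(1)])
  from tendsto_mult_left[OF this, of "C * r0 powr (2 - \<epsilon>) / P r0"]
  show "(\<lambda>n. C * r0 powr (2 - \<epsilon>) / P r0 * r n powr \<epsilon>) \<longlonglongrightarrow> 0" by simp
qed

text \<open>Split the Levy-Khintchine formula for \<open>\<psi>(e\<^sup>s r)/\<psi>(r)\<close> into the Gaussian part, the small jumps and the
large jumps. The first two vanish in the limit, and dominated convergence applies to the last one. A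
final dilation by \<open>x = e\<^sup>s\<close> moves \<open>x\<close> from the cosine into \<open>G\<close>.\<close>

lemma limit_equation:
  assumes r: "\<And>n. 0 < r n" "\<And>n. r n \<le> r0" "r \<longlonglongrightarrow> 0" and G: "\<And>s. (\<lambda>n. P (exp s * r n) / P (r n)) \<longlonglongrightarrow> G s"
  shows "G s = (\<integral>v. G (s + v) \<partial>kernel)"
proof -
  define x where "x = exp s"
  have x: "0 < x" by (simp add: x_def)
  have Gm [measurable]: "G \<in> borel_measurable borel"
    by (rule borel_measurable_LIMSEQ_metric[OF _ G]) measurable
  have nu_ratio: "(\<lambda>n. rescaled_density (r n) z) \<longlonglongrightarrow> c * G (- ln (norm z))" if z: "z \<noteq> 0" for z
  proof -
    have nz: "0 < norm z" using z by simp
    have "filterlim (\<lambda>n. inverse (r n) * norm z) at_top sequentially"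
    proof (rule filterlim_at_top_mult_tendsto_pos[OF tendsto_const nz, THEN filterlim_cong[THEN iffD1, rotated 3]])
      show "filterlim (\<lambda>n. inverse (r n)) at_top sequentially"
        by (rule filterlim_inverse_at_top[OF r(3)]) (use r(1) in simp)
    qed (auto simp: mult.commute)
    then have "filterlim (\<lambda>n. z /\<^sub>R r n) at_infinity sequentially"
      using r(1) by (simp add: filterlim_at_infinity_conv_norm_at_top abs_of_pos)
    from filterlim_compose[OF density_limit this]
    have 1: "(\<lambda>n. \<nu> (z /\<^sub>R r n) / Q (z /\<^sub>R r n)) \<longlonglongrightarrow> c" unfolding Q_def .
    have "exp (- ln (norm z)) = 1 / norm z" using nz by (simp add: exp_minus inverse_eq_divide)
    then have 2: "(\<lambda>n. P (r n / norm z) / P (r n)) \<longlonglongrightarrow> G (- ln (norm z))" using G[of "- ln (norm z)"] by simp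
    have "0 < r0 * norm z" using nz r0_pos by simp
    then have "eventually (\<lambda>n. r n < r0 * norm z) sequentially" by (rule order_tendstoD(2)[OF r(3)])
    then have ev: "eventually (\<lambda>n. (\<nu> (z /\<^sub>R r n) / Q (z /\<^sub>R r n)) * (P (r n / norm z) / P (r n)) = rescaled_density (r n) z) sequentially"
      by eventually_elim (simp add: rescaled_density_def)
    show ?thesis by (rule Lim_transform_eventually[OF tendsto_mult[OF 1 2] ev])
  qed
  have outer: "(\<lambda>n. \<integral>z. (1 - cos ((x *\<^sub>R e) \<bullet> z)) * rescaled_density (r n) z \<partial>homogeneous_measure)
      \<longlonglongrightarrow> (\<integral>z. (1 - cos ((x *\<^sub>R e) \<bullet> z)) * (c * G (- ln (norm z))) \<partial>homogeneous_measure)"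
  proof (rule integral_dominated_convergence)
    show "integrable homogeneous_measure (\<lambda>z::'a. 2 * c * ((1 - cos ((x *\<^sub>R e) \<bullet> z)) * B (- ln (norm z))))"
      using integrable_kernel_bound[of x] x by simp
    show "AE z in homogeneous_measure. (\<lambda>n. (1 - cos ((x *\<^sub>R e) \<bullet> z)) * rescaled_density (r n) z) \<longlonglongrightarrow> (1 - cos ((x *\<^sub>R e) \<bullet> z)) * (c * G (- ln (norm z)))"
    proof (rule AE_I2)
      fix z :: 'a
      show "(\<lambda>n. (1 - cos ((x *\<^sub>R e) \<bullet> z)) * rescaled_density (r n) z) \<longlonglongrightarrow> (1 - cos ((x *\<^sub>R e) \<bullet> z)) * (c * G (- ln (norm z)))"
        by (cases "z = 0") (auto intro!: tendsto_mult_left nu_ratio)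
    qed
    show "AE z in homogeneous_measure. norm ((1 - cos ((x *\<^sub>R e) \<bullet> z)) * rescaled_density (r n) z) \<le> 2 * c * ((1 - cos ((x *\<^sub>R e) \<bullet> z)) * B (- ln (norm z)))" for n
    proof (rule AE_I2)
      fix z :: 'a
      show "norm ((1 - cos ((x *\<^sub>R e) \<bullet> z)) * rescaled_density (r n) z) \<le> 2 * c * ((1 - cos ((x *\<^sub>R e) \<bullet> z)) * B (- ln (norm z)))"
      proof (cases "z = 0")
        case False
        note b = rescaled_density_bounds[OF r(1,2) False, of n]
        have "(1 - cos ((x *\<^sub>R e) \<bullet> z)) * rescaled_density (r n) z \<le> (1 - cos ((x *\<^sub>R e) \<bullet> z)) * (2 * c * B (- ln (norm z)))"
          using b(2) by (intro mult_left_mono) auto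
        then show ?thesis using b(1) by (simp add: abs_mult mult_ac)
      qed simp
    qed
  qed measurable
  define M where "M = (\<integral>y. indicator {y. r0 * norm y < 1} y * (norm y)\<^sup>2 * \<nu> y \<partial>lborel)"
  have iM: "integrable lborel (\<lambda>y. indicator {y. r0 * norm y < 1} y * (norm y)\<^sup>2 * \<nu> y)"
  proof (rule integrable_levy[where C = "1 + 1 / r0\<^sup>2"])
    fix y :: 'a
    show "\<bar>indicator {y. r0 * norm y < 1} y * (norm y)\<^sup>2\<bar> \<le> (1 + 1 / r0\<^sup>2) * min 1 ((norm y)\<^sup>2)"
    proof (cases "r0 * norm y < 1")
      case True
      have "(r0 * norm y)\<^sup>2 \<le> 1" using True r0_pos by (simp add: power_le_one)
      then have "(norm y)\<^sup>2 \<le> 1 / r0\<^sup>2" using r0_pos by (simp add: power_mult_distrib field_simps)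
      also have "\<dots> \<le> 1 + 1 / r0\<^sup>2" by simp
      finally have "(norm y)\<^sup>2 \<le> (1 + 1 / r0\<^sup>2) * 1" by simp
      moreover have "(norm y)\<^sup>2 \<le> (1 + 1 / r0\<^sup>2) * (norm y)\<^sup>2" by (simp add: distrib_right)
      ultimately show ?thesis using True by (simp add: min_def)
    qed simp
  qed measurable
  let ?f = "\<lambda>n y. (1 - cos (((x * r n) *\<^sub>R e) \<bullet> y)) * \<nu> y"
  let ?in = "\<lambda>n. \<integral>y. indicator {y. r0 * norm y < 1} y * ?f n y \<partial>lborel"
  let ?out = "\<lambda>n. \<integral>y. indicator {y. 1 \<le> r0 * norm y} y * ?f n y \<partial>lborel"
  have iin: "integrable lborel (\<lambda>y. indicator {y. r0 * norm y < 1} y * ?f n y)" and iout: "integrable lborel (\<lambda>y. indicator {y. 1 \<le> r0 * norm y} y * ?f n y)" for n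
    using integrable_real_mult_indicator[of "{y. r0 * norm y < 1}" lborel "?f n"] integrable_real_mult_indicator[of "{y. 1 \<le> r0 * norm y}" lborel "?f n"]
      integrable_one_minus_cos[of "(x * r n) *\<^sub>R e"] by (simp_all add: mult.commute)
  have split: "P (x * r n) / P (r n) = ?in n / P (r n) + (\<integral>z. (1 - cos ((x *\<^sub>R e) \<bullet> z)) * rescaled_density (r n) z \<partial>homogeneous_measure)
      + \<eta> * x\<^sup>2 * ((r n)\<^sup>2 / P (r n))" for n
  proof -
    have "P (x * r n) = \<psi> ((x * r n) *\<^sub>R e)" using profile_eq_exponent[OF unit] x r(1)[of n] by simp
    also have "\<dots> = (\<integral>y. ?f n y \<partial>lborel) + \<eta> * (x * r n)\<^sup>2"
      using unit x r(1)[of n] by (simp add: exponent_eq)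
    also have "(\<integral>y. ?f n y \<partial>lborel) = (\<integral>y. indicator {y. r0 * norm y < 1} y * ?f n y + indicator {y. 1 \<le> r0 * norm y} y * ?f n y \<partial>lborel)"
      by (rule Bochner_Integration.integral_cong[OF refl]) (auto simp: indicator_def)
    also have "\<dots> = ?in n + ?out n" by (rule Bochner_Integration.integral_add[OF iin iout])
    finally have "P (x * r n) / P (r n) = ?in n / P (r n) + ?out n / P (r n) + \<eta> * x\<^sup>2 * ((r n)\<^sup>2 / P (r n))"
      by (simp add: add_divide_distrib power_mult_distrib)
    then show ?thesis unfolding outer_jump_part_rescaled[OF r(1)] .
  qed
  note sq = square_over_profile_tendsto_zero[OF r]
  have inner: "(\<lambda>n. ?in n / P (r n)) \<longlonglongrightarrow> 0"
  proof (rule tendsto_sandwich[OF _ _ tendsto_const])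
    have nn: "0 \<le> ?in n" for n
      by (rule integral_nonneg_AE) (use AE_nonneg in \<open>eventually_elim, simp\<close>)
    then show "eventually (\<lambda>n. 0 \<le> ?in n / P (r n)) sequentially" using profile_nonneg by simp
    show "eventually (\<lambda>n. ?in n / P (r n) \<le> x\<^sup>2 / 2 * M * ((r n)\<^sup>2 / P (r n))) sequentially"
    proof (intro always_eventually allI)
      fix n
      have "?in n \<le> (\<integral>y. (x * r n)\<^sup>2 / 2 * (indicator {y. r0 * norm y < 1} y * (norm y)\<^sup>2 * \<nu> y) \<partial>lborel)"
      proof (rule integral_mono_AE[OF iin])
        show "AE y in lborel. indicator {y. r0 * norm y < 1} y * ?f n y \<le> (x * r n)\<^sup>2 / 2 * (indicator {y. r0 * norm y < 1} y * (norm y)\<^sup>2 * \<nu> y)"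
          using AE_nonneg
        proof eventually_elim
          case (elim y)
          have "1 - cos (((x * r n) *\<^sub>R e) \<bullet> y) \<le> (((x * r n) *\<^sub>R e) \<bullet> y)\<^sup>2 / 2"
            using one_minus_cos_le[of "((x * r n) *\<^sub>R e) \<bullet> y"] by simp
          also have "(((x * r n) *\<^sub>R e) \<bullet> y)\<^sup>2 \<le> (norm ((x * r n) *\<^sub>R e) * norm y)\<^sup>2"
            using Cauchy_Schwarz_ineq2[of "(x * r n) *\<^sub>R e" y] by (metis abs_ge_zero power2_abs power_mono)
          also have "\<dots> = (x * r n)\<^sup>2 * (norm y)\<^sup>2" using unit by (simp add: power_mult_distrib)
          finally have "1 - cos (((x * r n) *\<^sub>R e) \<bullet> y) \<le> (x * r n)\<^sup>2 / 2 * (norm y)\<^sup>2" by simp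
          from mult_right_mono[OF this elim] show ?case by (simp add: indicator_def)
        qed
      qed (use iM in simp)
      also have "\<dots> = (x * r n)\<^sup>2 / 2 * M" by (simp add: M_def)
      finally have "?in n / P (r n) \<le> (x * r n)\<^sup>2 / 2 * M / P (r n)" by (rule divide_right_mono[OF _ profile_nonneg])
      then show "?in n / P (r n) \<le> x\<^sup>2 / 2 * M * ((r n)\<^sup>2 / P (r n))" by (simp add: power_mult_distrib mult_ac)
    qed
    from tendsto_mult_left[OF sq, of "x\<^sup>2 / 2 * M"] show "(\<lambda>n. x\<^sup>2 / 2 * M * ((r n)\<^sup>2 / P (r n))) \<longlonglongrightarrow> 0" by simp
  qed
  have "(\<lambda>n. P (x * r n) / P (r n)) \<longlonglongrightarrow> 0 + (\<integral>z. (1 - cos ((x *\<^sub>R e) \<bullet> z)) * (c * G (- ln (norm z))) \<partial>homogeneous_measure) + \<eta> * x\<^sup>2 * 0"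
    unfolding split by (intro tendsto_add inner outer tendsto_mult tendsto_const sq)
  then have "G s = (\<integral>z. (1 - cos ((x *\<^sub>R e) \<bullet> z)) * (c * G (- ln (norm z))) \<partial>homogeneous_measure)"
    using LIMSEQ_unique[OF G[of s]] by (simp add: x_def)
  also have "\<dots> = (\<integral>z. (\<lambda>w. c * (1 - cos (e \<bullet> w)) * G (- ln (norm w / x))) (x *\<^sub>R z) \<partial>homogeneous_measure)"
    by (rule Bochner_Integration.integral_cong[OF refl]) (use x in simp)
  also have "\<dots> = (\<integral>w. c * (1 - cos (e \<bullet> w)) * G (- ln (norm w / x)) \<partial>homogeneous_measure)"
    by (rule integral_homogeneous_scaleR(1)[OF _ x]) measurable
  also have "\<dots> = (\<integral>w. c * (1 - cos (e \<bullet> w)) * G (s + - ln (norm w)) \<partial>homogeneous_measure)"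
  proof (rule Bochner_Integration.integral_cong[OF refl])
    fix w :: 'a
    show "c * (1 - cos (e \<bullet> w)) * G (- ln (norm w / x)) = c * (1 - cos (e \<bullet> w)) * G (s + - ln (norm w))"
      by (cases "w = 0") (simp_all add: x_def ln_div)
  qed
  also have "\<dots> = (\<integral>v. G (s + v) \<partial>kernel)" by (rule integral_kernel(1)[symmetric]) measurable
  finally show ?thesis .
qed

lemma limit_is_solution:
  assumes u: "filterlim u at_bot sequentially" and G: "\<And>s. (\<lambda>n. P (exp (u n + s)) / P (exp (u n))) \<longlonglongrightarrow> G s"
  shows "solution G"
proof -
  have "eventually (\<lambda>n. u n \<le> ln r0) sequentially" using u by (simp add: filterlim_at_bot)
  then obtain N where N: "\<And>n. n \<ge> N \<Longrightarrow> u n \<le> ln r0" by (auto simp: eventually_sequentially)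
  \<comment> \<open>After a shift of the index all bounds hold for every \<open>n\<close>, as dominated convergence requires.\<close>
  define r where "r n = exp (u (n + N))" for n
  have r: "0 < r n" "r n \<le> r0" for n
  proof -
    show "0 < r n" by (simp add: r_def)
    have "exp (u (n + N)) \<le> exp (ln r0)" using N[of "n + N"] by simp
    then show "r n \<le> r0" using r0_pos by (simp add: r_def)
  qed
  have "filterlim (\<lambda>n. u (n + N)) at_bot sequentially"
    by (rule filterlim_compose[OF u filterlim_add_const_nat_at_top])
  then have r_lim: "r \<longlonglongrightarrow> 0" unfolding r_def by (rule filterlim_compose[OF exp_at_bot])
  have lim: "(\<lambda>n. P (exp s * r n) / P (r n)) \<longlonglongrightarrow> G s" for s
    using LIMSEQ_ignore_initial_segment[OF G[of s], of N] by (simp add: r_def exp_add mult.commute)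
  have pos: "0 < P (r n)" for n using profile_pos r by blast
  have small: "eventually (\<lambda>n. exp s * r n \<le> r0) sequentially" for s
  proof -
    have "(\<lambda>n. exp s * r n) \<longlonglongrightarrow> exp s * 0" by (intro tendsto_intros r_lim)
    then have "eventually (\<lambda>n. exp s * r n < r0) sequentially" using r0_pos by (intro order_tendstoD(2)[of _ "exp s * 0"]) auto
    then show ?thesis by eventually_elim simp
  qed
  show ?thesis unfolding solution_def
  proof (intro conjI allI)
    show "G 0 = 1"
      using LIMSEQ_unique[OF lim[of 0]] pos by (simp add: less_imp_neq[OF pos, symmetric])
    show "0 \<le> G s" for s by (rule LIMSEQ_le_const[OF lim]) (use profile_nonneg in simp)
    show "G s = (\<integral>v. G (s + v) \<partial>kernel)" for s by (rule limit_equation[OF r r_lim lim])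
    fix s u
    show "G (s + u) \<le> B u * G s"
    proof (rule tendsto_le[OF _ tendsto_mult_left[OF lim] lim])
      show "eventually (\<lambda>n. P (exp (s + u) * r n) / P (r n) \<le> B u * (P (exp s * r n) / P (r n))) sequentially"
        using small[of s] small[of "s + u"]
      proof eventually_elim
        case (elim n)
        have "P (exp u * (exp s * r n)) \<le> B u * P (exp s * r n)"
          by (rule profile_exp_le_B) (use elim r in \<open>auto simp: exp_add mult_ac\<close>)
        from divide_right_mono[OF this less_imp_le[OF pos[of n]]] show ?case by (simp add: exp_add mult_ac)
      qed
    qed simp
    show "\<bar>G (s + u) - G s\<bar> \<le> \<omega> u * G s"
    proof (rule tendsto_le[OF _ tendsto_mult_left[OF lim] tendsto_rabs[OF tendsto_diff[OF lim lim]]])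
      show "eventually (\<lambda>n. \<bar>P (exp (s + u) * r n) / P (r n) - P (exp s * r n) / P (r n)\<bar> \<le> \<omega> u * (P (exp s * r n) / P (r n))) sequentially"
        using small[of s]
      proof eventually_elim
        case (elim n)
        have "\<bar>P (exp u * (exp s * r n)) - P (exp s * r n)\<bar> \<le> \<omega> u * P (exp s * r n)"
          by (rule profile_equicontinuous) (use elim r in auto)
        from divide_right_mono[OF this less_imp_le[OF pos[of n]]]
        have "\<bar>P (exp u * (exp s * r n)) - P (exp s * r n)\<bar> / P (r n) \<le> \<omega> u * (P (exp s * r n) / P (r n))" by simp
        moreover have "\<bar>P (exp (s + u) * r n) / P (r n) - P (exp s * r n) / P (r n)\<bar> = \<bar>P (exp u * (exp s * r n)) - P (exp s * r n)\<bar> / P (r n)"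
          using pos[of n] by (simp add: diff_divide_distrib[symmetric] abs_divide exp_add mult_ac)
        ultimately show ?case by simp
      qed
    qed simp
  qed
qed

text \<open>An exponential bounded by \<open>B\<close> has its exponent between the two rates of \<open>B\<close>.\<close>

lemma exponential_solution_exponent_range:
  assumes "solution (\<lambda>s. exp (\<rho> * s))"
  shows "\<epsilon> \<le> \<rho>" "\<rho> \<le> 2 - \<epsilon>"
proof -
  have b: "exp (\<rho> * s) \<le> B s" for s using solutionD(3)[OF assms, of 0 s] by simp
  have no: False if "\<And>s. 0 \<le> s \<Longrightarrow> exp (d * s) \<le> C" "0 < d" for d
  proof -
    have "exp (d * (C / d)) \<le> C" using that(2) C_ge by (intro that(1)) auto
    then have "exp C \<le> C" using that(2) by simp
    then show False using exp_ge_add_one_self[of C] by simp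
  qed
  show "\<epsilon> \<le> \<rho>"
  proof (rule ccontr)
    assume "\<not> \<epsilon> \<le> \<rho>"
    moreover have "exp ((\<epsilon> - \<rho>) * s) \<le> C" if "0 \<le> s" for s
    proof -
      have "exp (\<rho> * (- s)) \<le> C * exp (\<epsilon> * (- s))" using b[of "- s"] that by (simp add: B_def)
      then have "exp (\<rho> * (- s)) * exp (\<epsilon> * s) \<le> C * exp (\<epsilon> * (- s)) * exp (\<epsilon> * s)" by (rule mult_right_mono) simp
      then show ?thesis by (simp add: exp_add[symmetric] mult.assoc algebra_simps)
    qed
    ultimately show False using no[of "\<epsilon> - \<rho>"] by simp
  qed
  show "\<rho> \<le> 2 - \<epsilon>"
  proof (rule ccontr)
    assume "\<not> \<rho> \<le> 2 - \<epsilon>"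
    moreover have "exp ((\<rho> - (2 - \<epsilon>)) * s) \<le> C" if "0 \<le> s" for s
    proof -
      have "exp (\<rho> * s) \<le> C * exp ((2 - \<epsilon>) * s)" using b[of s] that C_ge by (cases "s = 0") (auto simp: B_def)
      then have "exp (\<rho> * s) * exp (- ((2 - \<epsilon>) * s)) \<le> C * exp ((2 - \<epsilon>) * s) * exp (- ((2 - \<epsilon>) * s))" by (rule mult_right_mono) simp
      then show ?thesis by (simp add: exp_add[symmetric] mult.assoc algebra_simps)
    qed
    ultimately show False using no[of "\<rho> - (2 - \<epsilon>)"] by simp
  qed
qed

lemma profile_regularly_varying:
  "\<exists>\<alpha>. 0 < \<alpha> \<and> \<alpha> < 2 \<and> regularly_varying_at_zero \<alpha> P"
proof -
  have "\<exists>\<rho>. solution (\<lambda>s. exp (\<rho> * s)) \<and> (\<forall>s. ((\<lambda>u. P (exp (u + s)) / P (exp u)) \<longlongrightarrow> exp (\<rho> * s)) at_bot)"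
  proof (rule asymptotic_solution_tendsto_exponential[of "\<lambda>u. P (exp u)" "\<lambda>s. 8 * (1 + exp s)\<^sup>2" "ln r0"])
    show "0 < P (exp u)" for u by (rule profile_pos) simp
    show "P (exp (u + s)) \<le> 8 * (1 + exp s)\<^sup>2 * P (exp u)" for s u
      using profile_mult_le[of "exp s" "exp u"] by (simp add: exp_add mult.commute)
    show "\<bar>P (exp (u + s)) - P (exp u)\<bar> \<le> \<omega> s * P (exp u)" if "u \<le> ln r0" for s u
    proof -
      have "exp u \<le> exp (ln r0)" using that by simp
      then have "exp u \<le> r0" using r0_pos by simp
      then show ?thesis using profile_equicontinuous[of "exp u" s] by (simp add: exp_add mult.commute)
    qed
    show "solution G" if "filterlim u at_bot sequentially" "\<And>s. (\<lambda>n. P (exp (u n + s)) / P (exp (u n))) \<longlonglongrightarrow> G s" for u G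
      using that by (rule limit_is_solution)
  qed
  then obtain \<rho> where \<rho>: "solution (\<lambda>s. exp (\<rho> * s))" and lim: "\<forall>s. ((\<lambda>u. P (exp (u + s)) / P (exp u)) \<longlongrightarrow> exp (\<rho> * s)) at_bot"
    by (elim exE conjE)
  have range: "0 < \<rho>" "\<rho> < 2"
    using exponential_solution_exponent_range[OF \<rho>] \<epsilon>_pos by linarith+
  have "regularly_varying_at_zero \<rho> P"
    unfolding regularly_varying_at_zero_def regularly_varying_at_infinity_def
  proof (intro conjI allI impI)
    show "\<exists>x0>0. \<forall>x\<ge>x0. 0 < inverse (P (inverse x))"
      by (rule exI[of _ 1]) (auto intro!: profile_pos)
    fix l :: real assume l: "0 < l"
    have "filterlim (\<lambda>x::real. - ln x) at_bot at_top"
      using ln_at_top by (simp add: filterlim_uminus_at_top)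
    from filterlim_compose[OF lim[rule_format, of "- ln l"] this]
    have "((\<lambda>x. P (exp (- ln x + - ln l)) / P (exp (- ln x))) \<longlongrightarrow> exp (\<rho> * - ln l)) at_top" .
    from tendsto_inverse[OF this]
    have "((\<lambda>x. inverse (P (exp (- ln x + - ln l)) / P (exp (- ln x)))) \<longlongrightarrow> l powr \<rho>) at_top"
      using l by (simp add: powr_def exp_minus)
    moreover have "eventually (\<lambda>x. inverse (P (exp (- ln x + - ln l)) / P (exp (- ln x))) = inverse (P (inverse (l * x))) / inverse (P (inverse x))) at_top"
      using eventually_gt_at_top[of "0::real"]
    proof eventually_elim
      case (elim x)
      have "exp (- ln x) = inverse x" "exp (- ln x + - ln l) = inverse (l * x)"
        using elim l by (simp_all add: exp_add exp_minus exp_diff divide_inverse mult.commute)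
      then show ?case by (simp add: divide_inverse mult.commute)
    qed
    ultimately show "((\<lambda>x. inverse (P (inverse (l * x))) / inverse (P (inverse x))) \<longlongrightarrow> l powr \<rho>) at_top"
      by (rule Lim_transform_eventually)
  qed
  with range show ?thesis by blast
qed

end

lemma (in regular_levy_density) exponent_regularly_varying:
  "\<exists>\<alpha>. 0 < \<alpha> \<and> \<alpha> < 2 \<and> regularly_varying_at_zero \<alpha> P"
proof -
  obtain r0 C \<epsilon> where b: "0 < r0" "0 < \<epsilon>" "\<epsilon> < 2" "1 \<le> C" "\<And>x. 1 \<le> r0 * norm x \<Longrightarrow> \<nu> x \<le> 2 * c * Q x" "\<And>r. 0 < r \<Longrightarrow> 0 < P r"
    "\<And>r l. 0 < r \<Longrightarrow> r \<le> r0 \<Longrightarrow> 0 < l \<Longrightarrow> l \<le> 1 \<Longrightarrow> P (l * r) \<le> C * l powr \<epsilon> * P r"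
    "\<And>r l. 0 < r \<Longrightarrow> 1 \<le> l \<Longrightarrow> l * r \<le> r0 \<Longrightarrow> P (l * r) \<le> C * l powr (2 - \<epsilon>) * P r"
    by (rule profile_power_bounds, rule that)
  obtain e :: 'a where e: "norm e = 1" by (rule obtain_unit)
  interpret levy_density_bounds \<psi> \<eta> \<nu> c e r0 C \<epsilon>
    by unfold_locales (fact e b)+
  show ?thesis by (rule profile_regularly_varying)
qed

section \<open>The three equivalent conditions\<close>

text \<open>The reflection in the hyperplane orthogonal to \<open>a - b\<close>.\<close>

lemma reflection_exchanging:
  fixes a b :: "'a::euclidean_space"
  assumes "norm a = norm b"
  obtains T where "orthogonal_transformation T" "T a = b"
proof (cases "a = b")
  case True
  then show ?thesis using that[of "\<lambda>x. x"] by (simp add: orthogonal_transformation_id)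
next
  case False
  define v where "v = a - b"
  have v: "v \<bullet> v \<noteq> 0" using False by (simp add: v_def)
  define T where "T x = x - (2 * (x \<bullet> v) / (v \<bullet> v)) *\<^sub>R v" for x
  have "linear T"
  proof (rule linearI)
    show "T (x + y) = T x + T y" for x y
      by (simp add: T_def inner_add_left distrib_left add_divide_distrib scaleR_add_left)
    show "T (c *\<^sub>R x) = c *\<^sub>R T x" for c x
      by (simp add: T_def scaleR_diff_right)
  qed
  moreover have "T x \<bullet> T y = x \<bullet> y" for x y
    using v by (simp add: T_def inner_diff_left inner_diff_right inner_commute field_simps)
  ultimately have "orthogonal_transformation T" by (simp add: orthogonal_transformation_def)
  moreover have "T a = b"
  proof -
    have ab: "a \<bullet> a = b \<bullet> b" using assms by (simp add: dot_square_norm)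
    have "v \<bullet> v = 2 * (a \<bullet> v)" using ab by (simp add: v_def inner_diff_left inner_diff_right inner_commute)
    then have "T a = a - v" using v by (simp add: T_def)
    then show ?thesis by (simp add: v_def)
  qed
  ultimately show ?thesis by (rule that)
qed

text \<open>The density describes the measure only away from the origin, where a function with \<open>g 0 = 0\<close> does
not see the possible atom.\<close>

lemma isotropic_unimodal_density_integral:
  fixes \<mu> :: "'a::euclidean_space measure" and g :: "'a \<Rightarrow> real"
  assumes f: "isotropic_unimodal_density \<mu> f" and sets_\<mu>: "sets \<mu> = sets borel"
    and g_meas [measurable]: "g \<in> borel_measurable borel" and g0: "g 0 = 0"
  shows "integrable \<mu> g \<longleftrightarrow> integrable lborel (\<lambda>x. g x * f x)"
    and "(\<integral>x. g x \<partial>\<mu>) = (\<integral>x. g x * f x \<partial>lborel)"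
proof -
  have [measurable]: "f \<in> borel_measurable borel" and f_nonneg: "\<And>x. x \<noteq> 0 \<Longrightarrow> 0 \<le> f x"
    and f_emeasure: "\<And>A. A \<in> sets borel \<Longrightarrow> 0 \<notin> A \<Longrightarrow> emeasure \<mu> A = (\<integral>\<^sup>+x\<in>A. ennreal (f x) \<partial>lborel)"
    using f unfolding isotropic_unimodal_density_def by blast+
  note [measurable_cong] = sets_\<mu>
  have sp: "space \<mu> = UNIV" using sets_eq_imp_space_eq[OF sets_\<mu>] by simp
  define f' where "f' x = (if x = 0 then 0 else f x)" for x
  have [measurable]: "f' \<in> borel_measurable borel" unfolding f'_def by measurable
  have f'0: "0 \<le> f' x" for x using f_nonneg by (simp add: f'_def)
  have eq: "density \<mu> (\<lambda>x. ennreal (indicator (- {0}) x)) = density lborel (\<lambda>x. ennreal (f' x))"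
  proof (rule measure_eqI)
    fix A assume "A \<in> sets (density \<mu> (\<lambda>x. ennreal (indicator (- {0}) x)))"
    then have A [measurable]: "A \<in> sets borel" using sets_\<mu> by simp
    have "emeasure (density \<mu> (\<lambda>x. ennreal (indicator (- {0}) x))) A = (\<integral>\<^sup>+x. ennreal (indicator (- {0}) x) * indicator A x \<partial>\<mu>)"
      by (rule emeasure_density) (use sets_\<mu> in auto)
    also have "\<dots> = (\<integral>\<^sup>+x. indicator (A - {0}) x \<partial>\<mu>)"
      by (rule nn_integral_cong) (auto simp: indicator_def)
    also have "\<dots> = emeasure \<mu> (A - {0})" using sets_\<mu> by simp
    also have "\<dots> = (\<integral>\<^sup>+x\<in>A - {0}. ennreal (f x) \<partial>lborel)" by (rule f_emeasure) auto
    also have "\<dots> = (\<integral>\<^sup>+x\<in>A. ennreal (f' x) \<partial>lborel)"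
      by (rule nn_integral_cong) (auto simp: indicator_def f'_def)
    also have "\<dots> = emeasure (density lborel (\<lambda>x. ennreal (f' x))) A" by (simp add: emeasure_density)
    finally show "emeasure (density \<mu> (\<lambda>x. ennreal (indicator (- {0}) x))) A = emeasure (density lborel (\<lambda>x. ennreal (f' x))) A" .
  qed (simp add: sets_\<mu>)
  have gi: "indicator (- {0}) x * g x = g x" and gf: "f' x * g x = g x * f x" for x
    using g0 by (auto simp: indicator_def f'_def)
  have "integrable \<mu> g \<longleftrightarrow> integrable (density \<mu> (\<lambda>x. ennreal (indicator (- {0}) x))) g"
    by (subst integrable_density) (auto simp: gi)
  also have "\<dots> \<longleftrightarrow> integrable lborel (\<lambda>x. g x * f x)"
    unfolding eq using f'0 by (subst integrable_density) (auto simp: gf)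
  finally show "integrable \<mu> g \<longleftrightarrow> integrable lborel (\<lambda>x. g x * f x)" .
  have "(\<integral>x. g x \<partial>\<mu>) = (\<integral>x. g x \<partial>density \<mu> (\<lambda>x. ennreal (indicator (- {0}) x)))"
    by (subst integral_density) (auto simp: gi)
  also have "\<dots> = (\<integral>x. g x * f x \<partial>lborel)"
    unfolding eq using f'0 by (subst integral_density) (auto simp: gf)
  finally show "(\<integral>x. g x \<partial>\<mu>) = (\<integral>x. g x * f x \<partial>lborel)" .
qed

lemma unimodal_exponent_of_levy_khintchine:
  fixes X :: "real \<Rightarrow> 'w \<Rightarrow> 'b::euclidean_space"
  assumes lk: "levy_khintchine M X \<psi> \<eta> N" and \<nu>: "isotropic_unimodal_density N \<nu>"
  shows "unimodal_exponent \<psi> \<eta> \<nu>"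
proof -
  have \<eta>: "0 \<le> \<eta>" and lm: "levy_measure N" and rot: "rotation_invariant N"
    and \<psi>: "\<And>\<xi>. \<psi> \<xi> = (\<integral>x. 1 - cos (\<xi> \<bullet> x) \<partial>N) + \<eta> * (norm \<xi>)\<^sup>2"
    using lk unfolding levy_khintchine_def by blast+
  have sN: "sets N = sets borel" and fin: "(\<integral>\<^sup>+x. ennreal (min 1 ((norm x)\<^sup>2)) \<partial>N) < \<infinity>"
    using lm unfolding levy_measure_def by blast+
  note [measurable_cong] = sN
  have m: "\<nu> \<in> borel_measurable borel" and nn: "\<And>x. x \<noteq> 0 \<Longrightarrow> 0 \<le> \<nu> x"
    and mono: "\<And>x y. x \<noteq> 0 \<Longrightarrow> norm x \<le> norm y \<Longrightarrow> \<nu> y \<le> \<nu> x"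
    using \<nu> unfolding isotropic_unimodal_density_def by blast+
  show ?thesis
  proof
    have "integrable N (\<lambda>x. min 1 ((norm x)\<^sup>2))"
      by (rule integrableI_bounded) (use fin in auto)
    then show "integrable lborel (\<lambda>x. min 1 ((norm x)\<^sup>2) * \<nu> x)"
      by (subst (asm) isotropic_unimodal_density_integral(1)[OF \<nu> sN]) auto
    show "\<psi> \<xi> = (\<integral>x. (1 - cos (\<xi> \<bullet> x)) * \<nu> x \<partial>lborel) + \<eta> * (norm \<xi>)\<^sup>2" for \<xi>
      unfolding \<psi> by (subst isotropic_unimodal_density_integral(2)[OF \<nu> sN]) auto
    fix \<xi> \<zeta> :: 'b assume eq: "norm \<xi> = norm \<zeta>"
    obtain T where T: "orthogonal_transformation T" "T \<zeta> = \<xi>" using reflection_exchanging eq by metis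
    have [measurable]: "T \<in> borel_measurable borel"
      using T(1) by (intro borel_measurable_continuous_onI linear_continuous_on) (auto simp: orthogonal_transformation_def linear_conv_bounded_linear)
    have "distr N borel T = N" using rot T(1) by (simp add: rotation_invariant_def)
    then have "(\<integral>x. 1 - cos (\<xi> \<bullet> x) \<partial>N) = (\<integral>x. 1 - cos (\<xi> \<bullet> x) \<partial>distr N borel T)" by simp
    also have "\<dots> = (\<integral>x. 1 - cos (\<xi> \<bullet> T x) \<partial>N)" by (rule integral_distr) measurable
    also have "\<dots> = (\<integral>x. 1 - cos (\<zeta> \<bullet> x) \<partial>N)" using T by (simp add: orthogonal_transformation_def flip: T(2))
    finally show "\<psi> \<xi> = \<psi> \<zeta>" unfolding \<psi> using eq by simp
  qed (use \<eta> m nn mono in auto)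
qed

text \<open>Fubini's theorem exchanges the Gaussian average with the law of \<open>X\<^sub>t\<close>, whose characteristic function is
\<open>e\<^sup>-\<^sup>t\<^sup>\<psi>\<close>.\<close>

lemma unimodal_semigroup_of_levy_process:
  fixes X :: "real \<Rightarrow> 'w \<Rightarrow> 'b::euclidean_space"
  assumes proc: "isotropic_unimodal_levy_process M X" and lk: "levy_khintchine M X \<psi> \<eta> N"
    and p: "\<And>t. t > 0 \<Longrightarrow> isotropic_unimodal_density (distr M borel (X t)) (p t)"
    and \<nu>: "isotropic_unimodal_density N \<nu>"
  shows "unimodal_semigroup \<psi> \<eta> \<nu> p"
proof -
  interpret isotropic_unimodal_levy_process M X by (rule proc)
  interpret unimodal_exponent \<psi> \<eta> \<nu> by (rule unimodal_exponent_of_levy_khintchine[OF lk \<nu>])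
  have char: "(CLINT x|distr M borel (X t). exp (\<i> * complex_of_real (\<xi> \<bullet> x))) = complex_of_real (exp (- t * \<psi> \<xi>))"
    if "0 \<le> t" for t \<xi> using lk that unfolding levy_khintchine_def by blast
  have pt: "p t \<in> borel_measurable borel" "\<And>x. x \<noteq> 0 \<Longrightarrow> 0 \<le> p t x"
    "\<And>x y. x \<noteq> 0 \<Longrightarrow> norm x \<le> norm y \<Longrightarrow> p t y \<le> p t x" if "0 < t" for t
    using p[OF that] unfolding isotropic_unimodal_density_def by blast+
  have main: "integrable lborel (\<lambda>y. (1 - exp (- (s * (norm y)\<^sup>2))) * p t y) \<and>
      (\<integral>y. (1 - exp (- (s * (norm y)\<^sup>2))) * p t y \<partial>lborel) = (\<integral>\<xi>. 1 - exp (- (t * \<psi> (sqrt (2 * s) *\<^sub>R \<xi>))) \<partial>std_gaussian)"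
    if t: "0 < t" and s: "0 < s" for t s
  proof -
    define D where "D = distr M borel (X t)"
    have sD [measurable_cong]: "sets D = sets borel" by (simp add: D_def)
    interpret D: prob_space D unfolding D_def by (rule prob_space_distr) (use measurable_X t in simp)
    interpret G: prob_space "std_gaussian :: 'b measure" by (rule prob_space_std_gaussian)
    interpret GD: pair_prob_space "std_gaussian :: 'b measure" D ..
    let ?c = "sqrt (2 * s)"
    have cosD: "(\<integral>x. 1 - cos (\<xi> \<bullet> x) \<partial>D) = 1 - exp (- (t * \<psi> \<xi>))" for \<xi>
    proof -
      have i: "integrable D (\<lambda>x. exp (\<i> * complex_of_real (\<xi> \<bullet> x)))"
        by (rule D.integrable_const_bound[of _ 1]) auto
      have "(\<integral>x. Re (exp (\<i> * complex_of_real (\<xi> \<bullet> x))) \<partial>D) = Re (CLINT x|D. exp (\<i> * complex_of_real (\<xi> \<bullet> x)))"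
        by (rule integral_Re[OF i])
      also have "\<dots> = exp (- (t * \<psi> \<xi>))" unfolding D_def using char[of t \<xi>] t by simp
      finally have "(\<integral>x. cos (\<xi> \<bullet> x) \<partial>D) = exp (- (t * \<psi> \<xi>))" by (simp add: Re_exp)
      moreover have "integrable D (\<lambda>x. cos (\<xi> \<bullet> x))" by (rule D.integrable_const_bound[of _ 1]) auto
      ultimately show ?thesis using D.prob_space by simp
    qed
    have "(\<integral>\<xi>. 1 - exp (- (t * \<psi> (?c *\<^sub>R \<xi>))) \<partial>std_gaussian) = (\<integral>\<xi>. (\<integral>x. 1 - cos ((?c *\<^sub>R \<xi>) \<bullet> x) \<partial>D) \<partial>std_gaussian)"
      unfolding cosD ..
    also have "\<dots> = (\<integral>x. (\<integral>\<xi>. 1 - cos ((?c *\<^sub>R \<xi>) \<bullet> x) \<partial>std_gaussian) \<partial>D)"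
    proof (rule GD.Fubini_integral[symmetric], rule GD.integrable_const_bound[of _ 2])
      have "\<bar>1 - cos x\<bar> \<le> 2" for x :: real using cos_ge_minus_one[of x] cos_le_one[of x] by linarith
      then show "AE x in std_gaussian \<Otimes>\<^sub>M D. norm (case x of (\<xi>, x) \<Rightarrow> 1 - cos ((?c *\<^sub>R \<xi>) \<bullet> x)) \<le> 2"
        by (intro AE_I2) (auto split: prod.split)
    qed measurable
    also have "\<dots> = (\<integral>x. 1 - exp (- (s * (norm x)\<^sup>2)) \<partial>D)"
      unfolding gaussian_average_one_minus_cos[OF less_imp_le[OF s]] ..
    also have "\<dots> = (\<integral>y. (1 - exp (- (s * (norm y)\<^sup>2))) * p t y \<partial>lborel)"
      by (rule isotropic_unimodal_density_integral(2)[OF p[OF t, folded D_def] sD]) auto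
    finally have 1: "(\<integral>\<xi>. 1 - exp (- (t * \<psi> (?c *\<^sub>R \<xi>))) \<partial>std_gaussian) = \<dots>" .
    have "integrable D (\<lambda>x. 1 - exp (- (s * (norm x)\<^sup>2)))"
      by (rule D.integrable_const_bound[of _ 1]) (use s in auto)
    then have "integrable lborel (\<lambda>y. (1 - exp (- (s * (norm y)\<^sup>2))) * p t y)"
      by (subst (asm) isotropic_unimodal_density_integral(1)[OF p[OF t, folded D_def] sD]) auto
    with 1 show ?thesis by simp
  qed
  show ?thesis
  proof
    fix t :: real assume t: "0 < t"
    show "p t \<in> borel_measurable borel" by (rule pt(1)[OF t])
    show "0 \<le> p t x" if "x \<noteq> 0" for x by (rule pt(2)[OF t that])
    show "p t y \<le> p t x" if "x \<noteq> 0" "norm x \<le> norm y" for x y by (rule pt(3)[OF t that])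
    fix s :: real assume s: "0 < s"
    show "integrable lborel (\<lambda>y. (1 - exp (- (s * (norm y)\<^sup>2))) * p t y)"
      using main[OF t s] by (rule conjunct1)
    show "(\<integral>y. (1 - exp (- (s * (norm y)\<^sup>2))) * p t y \<partial>lborel) = (\<integral>\<xi>. 1 - exp (- (t * \<psi> (sqrt (2 * s) *\<^sub>R \<xi>))) \<partial>std_gaussian)"
      using main[OF t s] by (rule conjunct2)
  qed
qed

theorem theorem7:
  fixes M :: "'w measure"
    and X :: "real \<Rightarrow> 'w \<Rightarrow> 'a::euclidean_space"
    and \<psi> :: "'a \<Rightarrow> real" and \<eta> :: real and N :: "'a measure"
    and p :: "real \<Rightarrow> 'a \<Rightarrow> real" and \<nu> :: "'a \<Rightarrow> real"
  assumes "isotropic_unimodal_levy_process M X"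
    and "levy_khintchine M X \<psi> \<eta> N"
    and "\<And>t. t > 0 \<Longrightarrow> isotropic_unimodal_density (distr M borel (X t)) (p t)"
    and "isotropic_unimodal_density N \<nu>"
  shows
    "((\<exists>\<alpha>. 0 < \<alpha> \<and> \<alpha> < 2 \<and> regularly_varying_at_zero \<alpha> (radial_profile \<psi>)) \<longleftrightarrow>
      (\<exists>c>0. \<forall>\<epsilon>>0. \<exists>\<delta>>0. \<forall>t>0. \<forall>x.
         norm x \<ge> inverse \<delta> \<and> t * radial_profile \<psi> (inverse (norm x)) \<le> \<delta> \<longrightarrow>
         \<bar>p t x / (norm x powr (- real DIM('a)) * t * radial_profile \<psi> (inverse (norm x))) - c\<bar> < \<epsilon>))
     \<and>
     ((\<exists>\<alpha>. 0 < \<alpha> \<and> \<alpha> < 2 \<and> regularly_varying_at_zero \<alpha> (radial_profile \<psi>)) \<longleftrightarrow>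
      (\<exists>c>0. ((\<lambda>x. \<nu> x / (norm x powr (- real DIM('a)) * radial_profile \<psi> (inverse (norm x))))
                \<longlongrightarrow> c) at_infinity))"
    (is "(?i \<longleftrightarrow> ?ii) \<and> (?i \<longleftrightarrow> ?iii)")
proof -
  interpret unimodal_semigroup \<psi> \<eta> \<nu> p
    by (rule unimodal_semigroup_of_levy_process[OF assms])
  have 12: ?ii if "?i"
    using that by (elim exE conjE) (rule transition_density_asymptotics)
  have 23: ?iii if "?ii"
    using that by (elim exE conjE) (rule exI, rule conjI, assumption, rule levy_density_asymptotics)
  have 31: ?i if iii: "?iii"
  proof -
    obtain c where c: "0 < c" "((\<lambda>x. \<nu> x / (norm x powr (- real DIM('a)) * P (inverse (norm x)))) \<longlongrightarrow> c) at_infinity"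
      using iii by (elim exE conjE)
    interpret regular_levy_density \<psi> \<eta> \<nu> c by unfold_locales (fact c)+
    show ?thesis by (rule exponent_regularly_varying)
  qed
  show ?thesis
  proof (intro conjI iffI)
    show ?ii if ?i using that by (rule 12)
    show ?i if ?ii using that by (rule 31[OF 23])
    show ?iii if ?i using that by (rule 23[OF 12])
    show ?i if ?iii using that by (rule 31)
  qed
qed

end
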